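(* Let $(X_k)_{k\ge 0}$ be a Markov chain with transition kernel $P$ on a Polish space $E$ endowed with a complete metric $d$, and let $\lambda$ be a $P$-invariant probability measure. Suppose that for $\lambda\otimes\lambda$-a.e. $(x,x')\in E\times E$, there exists a coupling $\mathbf{Q}\in\mathcal{C}(\mathbf{P}^x,\mathbf{P}^{x'})$ such that $$\mathbf{Q}\Big[\sum_{n=0}^\infty d(X_n,X_n')^2<\infty\Big]>0.$$ Then the Markov chain is a.e. weak-* ergodic in the sense that $$\|P^n(x,\cdot)-\lambda\|_{\mathrm{BL}}\to 0\quad\text{as }n\to\infty\text{ for }\lambda\text{-a.e. }x\in E.$$
   Context: $E$ is a Polish space with Borel $\sigma$-field $\mathcal{E}$ and $d$ is a complete metric for its topology. $P:E\times\mathcal{E}\to[0,1]$ is a transition kernel, and $\mathbf{P}^x$ is the law on path space of the Markov chain $(X_k)_{k\ge 0}$ with transition kernel $P$ and $X_0=x$. "$P$-invariant" means $\lambda P=\lambda$. $\mathcal{C}(\mathbf{P}_1,\mathbf{P}_2)$ is the set of couplings of the path-space probabilities $\mathbf{P}_1,\mathbf{P}_2$: probability measures $\mathbf{Q}$ on the product of path space with itself whose first and second marginals are $\mathbf{P}_1$ and $\mathbf{P}_2$; $(X_n,X_n')_{n\ge 0}$ denotes the coordinate process on this product. $\mathrm{Lip}(E)$ is the class of functions $f:E\to\mathbb{R}$ with $\|f\|_\infty\le 1$ and $|f(x)-f(y)|\le d(x,y)$ for all $x,y\in E$. For a finite signed measure $\varrho$ on $E$, $\|\varrho\|_{\mathrm{BL}}=\sup_{f\in\mathrm{Lip}(E)}|\int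 f\,d\varrho|$. *)

theory Defs
  imports "HOL-Probability.Probability"
begin

text \<open>
  The Polish space \<open>E\<close> with its complete metric is a type of class \<^class>\<open>polish_space\<close> with
  its metric \<^const>\<open>dist\<close>; its \<open>\<sigma>\<close>-field is \<^const>\<open>borel\<close>. Path space is \<open>nat \<Rightarrow> E\<close> with the
  product \<open>\<sigma>\<close>-field.
\<close>

abbreviation path_space :: "(nat \<Rightarrow> 'a :: polish_space) measure" where
  "path_space \<equiv> PiM UNIV (\<lambda>_. borel)"

definition transition_kernel :: "('a :: polish_space \<Rightarrow> 'a measure) \<Rightarrow> bool" where
  "transition_kernel P \<longleftrightarrow> P \<in> borel \<rightarrow>\<^sub>M prob_algebra borel"

primrec kernel_power :: "('a :: polish_space \<Rightarrow> 'a measure) \<Rightarrow> nat \<Rightarrow> 'a \<Rightarrow> 'a measure" where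
  "kernel_power P 0 x = return borel x"
| "kernel_power P (Suc n) x = kernel_power P n x \<bind> P"

text \<open>The monadic bind \<open>\<lambda> \<bind> P\<close> is the measure \<open>\<lambda>P\<close>, that is \<open>A \<mapsto> \<integral> P x A \<lambda>(dx)\<close>.\<close>

definition invariant_prob :: "('a :: polish_space \<Rightarrow> 'a measure) \<Rightarrow> 'a measure \<Rightarrow> bool" where
  "invariant_prob P lam \<longleftrightarrow> prob_space lam \<and> sets lam = sets borel \<and> lam \<bind> P = lam"

text \<open>
  The law of the chain is the Ionescu-Tulcea measure whose initial law is the point mass at
  \<open>x\<close> and whose conditional law of coordinate \<open>n + 1\<close> given the past \<open>\<omega>\<close> is \<open>P (\<omega> n)\<close>.
  The lemmas \<open>path_law_0\<close> and \<open>path_law_Suc\<close> below give the start at \<open>x\<close> and the Markov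
  property with kernel \<open>P\<close>, which determine the law.
\<close>

definition step_kernel ::
  "('a :: polish_space \<Rightarrow> 'a measure) \<Rightarrow> 'a \<Rightarrow> nat \<Rightarrow> (nat \<Rightarrow> 'a) \<Rightarrow> 'a measure" where
  "step_kernel P x i \<omega> = (case i of 0 \<Rightarrow> return borel x | Suc n \<Rightarrow> P (\<omega> n))"

definition path_law :: "('a :: polish_space \<Rightarrow> 'a measure) \<Rightarrow> 'a \<Rightarrow> (nat \<Rightarrow> 'a) measure" where
  "path_law P x =
     projective_family.lim UNIV (Ionescu_Tulcea.CI (step_kernel P x) (\<lambda>_. borel)) (\<lambda>_. borel)"

definition couplings :: "'b measure \<Rightarrow> 'b measure \<Rightarrow> ('b \<times> 'b) measure set" where
  "couplings P1 P2 = {Q. prob_space Q \<and> sets Q = sets (P1 \<Otimes>\<^sub>M P2) \<and>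
     distr Q P1 fst = P1 \<and> distr Q P2 snd = P2}"

definition Lip :: "('a :: metric_space \<Rightarrow> real) set" where
  "Lip = {f. (\<forall>x. \<bar>f x\<bar> \<le> 1) \<and> (\<forall>x y. \<bar>f x - f y\<bar> \<le> dist x y)}"

text \<open>
  The BL norm of a finite signed measure \<open>\<rho> = \<mu> - \<nu>\<close>, given by finite Borel measures \<open>\<mu>\<close>, \<open>\<nu>\<close>
  (every finite signed measure has this form), where \<open>\<integral> f d\<rho> = \<integral> f d\<mu> - \<integral> f d\<nu>\<close>.
  The supremum is over a bounded set, by \<open>bdd_above_BL\<close>.
\<close>

definition BL_norm_diff :: "'a :: metric_space measure \<Rightarrow> 'a measure \<Rightarrow> real" where
  "BL_norm_diff \<mu> \<nu> = (SUP f\<in>Lip. \<bar>(\<integral>y. f y \<partial>\<mu>) - (\<integral>y. f y \<partial>\<nu>)\<bar>)"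

lemma bdd_above_BL:
  assumes "finite_measure \<mu>" "finite_measure \<nu>"
  shows "bdd_above ((\<lambda>f. \<bar>(\<integral>y. f y \<partial>\<mu>) - (\<integral>y. f y \<partial>\<nu>)\<bar>) ` Lip)"
proof -
  have *: "\<bar>\<integral>y. f y \<partial>m\<bar> \<le> measure m (space m)"
    if "f \<in> Lip" "finite_measure m" for f and m :: "'a measure"
  proof -
    interpret finite_measure m by fact
    have "\<bar>\<integral>y. f y \<partial>m\<bar> \<le> (\<integral>y. \<bar>f y\<bar> \<partial>m)"
      by (rule integral_abs_bound)
    also have "\<dots> \<le> (\<integral>y. 1 \<partial>m)"
      using that by (intro integral_mono') (auto simp: Lip_def)
    finally show ?thesis by simp
  qed
  show ?thesis
    by (rule bdd_aboveI2[where M = "measure \<mu> (space \<mu>) + measure \<nu> (space \<nu>)"])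
       (use *[OF _ assms(1)] *[OF _ assms(2)] in \<open>smt (verit)\<close>)
qed

lemma Ionescu_Tulcea_step_kernel:
  fixes P :: "'a :: polish_space \<Rightarrow> 'a measure"
  assumes "transition_kernel P"
  shows "Ionescu_Tulcea (step_kernel P x) (\<lambda>_. borel)"
proof (rule Ionescu_Tulcea.intro)
  have P: "P \<in> borel \<rightarrow>\<^sub>M subprob_algebra borel"
    using assms by (simp add: transition_kernel_def measurable_prob_algebraD)
  show "step_kernel P x i \<in> PiM {0..<i} (\<lambda>_. borel) \<rightarrow>\<^sub>M subprob_algebra borel" for i
  proof (cases i)
    case 0
    then show ?thesis
      by (auto simp: step_kernel_def[abs_def] space_subprob_algebra
               intro!: measurable_const prob_space_imp_subprob_space prob_space_return)
  next
    case (Suc n)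
    then show ?thesis
      unfolding step_kernel_def[abs_def] nat.case Suc
      by (intro measurable_compose[OF _ P] measurable_component_singleton) auto
  qed
  show "prob_space (step_kernel P x i \<omega>)"
    if "\<omega> \<in> space (PiM {0..<i} (\<lambda>_. borel :: 'a measure))" for i and \<omega> :: "nat \<Rightarrow> 'a"
    using measurable_space[of P borel "prob_algebra borel"] assms
    by (auto simp: step_kernel_def transition_kernel_def space_prob_algebra
             intro!: prob_space_return split: nat.split)
qed

context
  fixes P :: "'a :: polish_space \<Rightarrow> 'a measure" and x :: 'a
  assumes kernel: "transition_kernel P"
begin

interpretation IT: Ionescu_Tulcea "step_kernel P x" "\<lambda>_. borel"
  by (rule Ionescu_Tulcea_step_kernel[OF kernel])

lemma sets_path_law: "sets (path_law P x) = sets path_space"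
  by (simp add: path_law_def)

lemma distr_path_law:
  "distr (path_law P x) (PiM {0..<n} (\<lambda>_. borel)) (\<lambda>\<omega>. restrict \<omega> {0..<n}) =
     IT.C 0 n (\<lambda>_. undefined)"
proof (rule measure_eqI)
  have u: "(\<lambda>_. undefined) \<in> space (PiM {0..<0::nat} (\<lambda>_. borel :: 'a measure))"
    by (simp add: space_PiM PiE_def)
  show "sets (distr (path_law P x) (PiM {0..<n} (\<lambda>_. borel)) (\<lambda>\<omega>. restrict \<omega> {0..<n})) =
      sets (IT.C 0 n (\<lambda>_. undefined))"
    using IT.sets_C[OF u, of n] by simp
  fix A assume "A \<in> sets (distr (path_law P x) (PiM {0..<n} (\<lambda>_. borel)) (\<lambda>\<omega>. restrict \<omega> {0..<n}))"
  then have A: "A \<in> sets (PiM {0..<n} (\<lambda>_. borel))" by simp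
  have "emeasure (distr (path_law P x) (PiM {0..<n} (\<lambda>_. borel)) (\<lambda>\<omega>. restrict \<omega> {0..<n})) A =
      emeasure (path_law P x) (prod_emb UNIV (\<lambda>_. borel) {0..<n} A)"
    by (rule emeasure_distr_restrict[OF _ sets_path_law A]) auto
  also have "\<dots> = emeasure (IT.CI {0..<n}) A"
    unfolding path_law_def by (rule IT.lim[OF _ A]) auto
  also have "\<dots> = emeasure (IT.C 0 n (\<lambda>_. undefined)) A"
    using IT.emeasure_CI[of "{0..<n}" n A] A sets.sets_into_space[OF A]
    by (simp add: prod_emb_id space_PiM)
  finally show "emeasure (distr (path_law P x) (PiM {0..<n} (\<lambda>_. borel)) (\<lambda>\<omega>. restrict \<omega> {0..<n})) A =
      emeasure (IT.C 0 n (\<lambda>_. undefined)) A" .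
qed

lemma prob_space_path_law: "prob_space (path_law P x)"
proof -
  have "prob_space (distr (path_law P x) (PiM {0..<0::nat} (\<lambda>_. borel)) (\<lambda>\<omega>. restrict \<omega> {0..<0}))"
    unfolding distr_path_law by (rule IT.prob_space_C) (simp add: space_PiM PiE_def)
  then show ?thesis
    by (rule prob_space_distrD[rotated])
       (unfold measurable_cong_sets[OF sets_path_law refl], rule measurable_restrict_subset, simp)
qed

lemma path_law_0: "distr (path_law P x) borel (\<lambda>\<omega>. \<omega> 0) = return borel x"
proof (rule measure_eqI)
  fix B assume "B \<in> sets (distr (path_law P x) borel (\<lambda>\<omega>. \<omega> 0))"
  then have B[measurable]: "B \<in> sets borel" by simp
  let ?u = "\<lambda>_::nat. undefined :: 'a"
  let ?M = "\<lambda>n. PiM {0..<n} (\<lambda>_. borel :: 'a measure)"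
  let ?S = "{\<omega> \<in> space (?M (Suc 0)). \<omega> 0 \<in> B}"
  note [measurable_cong] = sets_path_law
  have u: "?u \<in> space (?M 0)"
    by (simp add: space_PiM PiE_def)
  have S[measurable]: "?S \<in> sets (?M (Suc 0))"
    by measurable
  have "emeasure (distr (path_law P x) borel (\<lambda>\<omega>. \<omega> 0)) B =
      emeasure (distr (path_law P x) (?M (Suc 0)) (\<lambda>\<omega>. restrict \<omega> {0..<Suc 0})) ?S"
    by (subst (1 2) emeasure_distr)
       (auto intro!: arg_cong2[where f=emeasure] measurable_restrict simp: space_PiM)
  also have "\<dots> = emeasure (IT.eP 0 ?u) ?S"
    unfolding distr_path_law using bind_return[OF IT.measurable_eP u] by simp
  also have "\<dots> = emeasure (step_kernel P x 0 ?u) B"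
    by (subst IT.emeasure_eP[OF u S])
       (auto intro!: arg_cong2[where f=emeasure] simp: space_PiM PiE_def extensional_def)
  finally show "emeasure (distr (path_law P x) borel (\<lambda>\<omega>. \<omega> 0)) B = emeasure (return borel x) B"
    by (simp add: step_kernel_def)
qed simp

lemma path_law_Suc:
  assumes A[measurable]: "A \<in> sets (PiM {0..<Suc n} (\<lambda>_. borel))" and B[measurable]: "B \<in> sets borel"
  shows "emeasure (path_law P x) {\<omega>. restrict \<omega> {0..<Suc n} \<in> A \<and> \<omega> (Suc n) \<in> B} =
    (\<integral>\<^sup>+\<omega>. indicator A (restrict \<omega> {0..<Suc n}) * emeasure (P (\<omega> n)) B \<partial>path_law P x)"
proof -
  let ?u = "\<lambda>_::nat. undefined :: 'a"
  let ?M = "\<lambda>n. PiM {0..<n} (\<lambda>_. borel :: 'a measure)"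
  let ?S = "{\<omega> \<in> space (?M (Suc (Suc n))). restrict \<omega> {0..<Suc n} \<in> A \<and> \<omega> (Suc n) \<in> B}"
  note [measurable_cong] = sets_path_law
  have P[measurable]: "P \<in> borel \<rightarrow>\<^sub>M subprob_algebra borel"
    using kernel by (simp add: transition_kernel_def measurable_prob_algebraD)
  have u: "?u \<in> space (?M 0)"
    by (simp add: space_PiM PiE_def)
  have r[measurable]: "(\<lambda>\<omega>. restrict \<omega> {0..<Suc n}) \<in> ?M (Suc (Suc n)) \<rightarrow>\<^sub>M ?M (Suc n)"
    by (rule measurable_restrict_subset) auto
  have r'[measurable]: "(\<lambda>\<omega>. restrict \<omega> {0..<k}) \<in> path_law P x \<rightarrow>\<^sub>M ?M k" for k
    unfolding measurable_cong_sets[OF sets_path_law refl] by (rule measurable_restrict_subset) auto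
  have S[measurable]: "?S \<in> sets (?M (Suc (Suc n)))"
    by measurable
  have space_C: "space (IT.C 0 (Suc n) ?u) = space (?M (Suc n))"
    using IT.space_C[OF u, of "Suc n"] by simp
  have sets_C: "sets (IT.C 0 (Suc n) ?u) = sets (?M (Suc n))"
    using IT.sets_C[OF u, of "Suc n"] by simp
  have "emeasure (path_law P x) {\<omega>. restrict \<omega> {0..<Suc n} \<in> A \<and> \<omega> (Suc n) \<in> B} =
      emeasure (distr (path_law P x) (?M (Suc (Suc n))) (\<lambda>\<omega>. restrict \<omega> {0..<Suc (Suc n)})) ?S"
    by (subst emeasure_distr)
       (auto intro!: arg_cong2[where f=emeasure]
             simp: space_PiM sets_eq_imp_space_eq[OF sets_path_law] Int_absorb1)
  also have "\<dots> = emeasure (IT.C 0 (Suc n) ?u \<bind> IT.eP (Suc n)) ?S"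
    unfolding distr_path_law by simp
  also have "\<dots> = (\<integral>\<^sup>+\<omega>. emeasure (IT.eP (Suc n) \<omega>) ?S \<partial>IT.C 0 (Suc n) ?u)"
  proof (rule emeasure_bind[OF _ _ S])
    show "space (IT.C 0 (Suc n) ?u) \<noteq> {}"
      unfolding space_C by (simp add: space_PiM PiE_eq_empty_iff)
    show "IT.eP (Suc n) \<in> IT.C 0 (Suc n) ?u \<rightarrow>\<^sub>M subprob_algebra (?M (Suc (Suc n)))"
      unfolding measurable_cong_sets[OF sets_C refl] by (rule IT.measurable_eP)
  qed
  also have "\<dots> = (\<integral>\<^sup>+\<omega>. indicator A \<omega> * emeasure (P (\<omega> n)) B \<partial>IT.C 0 (Suc n) ?u)"
  proof (rule nn_integral_cong)
    fix \<omega> assume "\<omega> \<in> space (IT.C 0 (Suc n) ?u)"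
    then have \<omega>: "\<omega> \<in> space (?M (Suc n))"
      unfolding space_C .
    have eq: "restrict (fun_upd \<omega> (Suc n) y) {0..<Suc n} = \<omega>" for y
      using \<omega> by (auto simp: space_PiM PiE_def extensional_def fun_eq_iff)
    have "(fun_upd \<omega> (Suc n) -` ?S) \<inter> space borel = (if \<omega> \<in> A then B else {})"
    proof -
      have "fun_upd \<omega> (Suc n) y \<in> space (?M (Suc (Suc n)))" for y
        using \<omega> by (auto simp: space_PiM PiE_def extensional_def)
      then show ?thesis
        by (auto simp: eq)
    qed
    then show "emeasure (IT.eP (Suc n) \<omega>) ?S = indicator A \<omega> * emeasure (P (\<omega> n)) B"
      by (subst IT.emeasure_eP[OF \<omega> S]) (simp add: step_kernel_def)
  qed
  also have "\<dots> = (\<integral>\<^sup>+\<omega>. indicator A (restrict \<omega> {0..<Suc n}) * emeasure (P (restrict \<omega> {0..<Suc n} n)) B \<partial>path_law P x)"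
  proof -
    have [measurable]: "(\<lambda>\<omega>. emeasure (P (\<omega> n)) B) \<in> borel_measurable (?M (Suc n))"
      by (rule measurable_compose[OF _ measurable_compose[OF P measurable_emeasure_subprob_algebra[OF B]]])
         (rule measurable_component_singleton, simp)
    show ?thesis
      unfolding distr_path_law[symmetric] by (subst nn_integral_distr) (auto simp del: restrict_apply)
  qed
  finally show ?thesis by simp
qed

end

end

theory Submission
  imports Defs
begin

text \<open>
  The proof has two halves: mean ergodicity in \<open>L\<^sup>2(\<lambda>)\<close>, which only sees typical starting
  points at a given time, and a zero-one argument that turns it into convergence from a fixed
  starting point.

  \<^bold>\<open>What a coupling gives.\<close>
  Write \<open>\<omega> \<sim>\<^sub>M \<omega>'\<close> if the squared distances along the two paths sum up to at most \<open>M\<close>. A coupling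
  that charges \<open>\<Union>\<^sub>M {\<omega> \<sim>\<^sub>M \<omega>'}\<close> charges one of these sets with some mass \<open>\<delta> > 0\<close>, and then
  \<open>D \<delta> \<le> \<integral> U dP\<^sup>x + \<integral> V dP\<^sup>x\<^sup>'\<close> whenever \<open>D \<le> U \<omega> + V \<omega>'\<close> for all \<open>\<omega> \<sim>\<^sub>M \<omega>'\<close>. This inequality
  (\<open>overlap\<close>) replaces the coupling everywhere. The point of a uniform \<open>M\<close> is that
  long time averages of a Lipschitz function differ little along \<open>\<omega>\<close> and \<open>\<omega>'\<close>, at a rate that depends
  on \<open>M\<close> only.

  \<^bold>\<open>Convergence in \<open>L\<^sup>2\<close>\<close> (\<open>energy_tendsto_0\<close>).
  Let \<open>u\<close> be bounded with \<open>\<integral> u d\<lambda> = 0\<close>, and let \<open>u\<^sub>n = P\<^sup>n u\<close>. The norms \<open>\<parallel>u\<^sub>n\<parallel>\<^sub>2\<close> decrease, and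
  \<open>E\<^sub>\<lambda> (u\<^sub>n(X\<^sub>m) - u\<^sub>n\<^sub>+\<^sub>m(X\<^sub>0))\<^sup>2 = \<parallel>u\<^sub>n\<parallel>\<^sup>2 - \<parallel>u\<^sub>n\<^sub>+\<^sub>m\<parallel>\<^sup>2\<close>. Hence for large \<open>n\<close> the number \<open>u\<^sub>n\<^sub>+\<^sub>m(x)\<close> can be read
  off the path at time \<open>m\<close>, whatever \<open>m\<close> is, by evaluating \<open>u\<^sub>n\<close>, or a Lipschitz function \<open>g\<close> close
  to \<open>u\<^sub>n\<close> in \<open>L\<^sup>1(\<lambda>)\<close>. On \<open>\<omega> \<sim>\<^sub>M \<omega>'\<close> the values of \<open>g\<close> agree on average over a long range of times \<open>m\<close>.
  Therefore \<open>u\<^sub>n\<^sub>+\<^sub>m(x)\<close> and \<open>u\<^sub>n\<^sub>+\<^sub>m(x')\<close> agree on average too, for almost all \<open>x\<close> and \<open>x'\<close>, so that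
  \<open>u\<^sub>n\<^sub>+\<^sub>m\<close> is nearly constant, that is nearly zero.

  \<^bold>\<open>From almost every starting point\<close> (\<open>averages_tendsto_0_AE\<close>, \<open>mean_tendsto_0_AE\<close>).
  Let \<open>f\<close> be Lipschitz with \<open>\<integral> f d\<lambda> = 0\<close>, and suppose that \<open>P\<^sup>n f(x) > e\<close> along times
  \<open>t\<^sub>0 < t\<^sub>1 < \<dots>\<close>. By the first part the correlations of \<open>f(X\<^sub>n)\<close> decay under the stationary law, so
  the averages of \<open>f(X\<^sub>t\<^sub>0), f(X\<^sub>t\<^sub>1), \<dots>\<close> tend to \<open>0\<close> almost surely along a subsequence. It suffices that
  this null event \<open>B\<close> of divergence, which depends on \<open>x\<close> through the times, is null for \<open>P\<^sup>x\<close> as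
  well, because then \<open>E\<^sup>x\<close> of the averages tends to \<open>0\<close>, whereas it exceeds \<open>e\<close>. Now \<open>B\<close> is determined by
  the path after any time \<open>n\<close>, and is nearly unaffected by passing from \<open>\<omega>\<close> to \<open>\<omega>' \<sim>\<^sub>M \<omega>\<close>. So the
  probability of \<open>B\<close> given \<open>X\<^sub>n = y\<close> is at most \<open>1 - \<rho>(y)\<close>, where the measurable function \<open>\<rho> \<ge> 0\<close> does
  not depend on the times, nor therefore on \<open>B\<close>, and is not \<open>\<lambda>\<close>-almost everywhere zero.
  The zero-one law gives \<open>E\<^sup>x (1\<^sub>B \<rho>(X\<^sub>n)) \<rightarrow> 0\<close>. But averages of \<open>\<rho>(X\<^sub>n)\<close> tend to \<open>\<integral> \<rho> d\<lambda> > 0\<close> under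
  \<open>P\<^sup>x\<close> along a subsequence, for \<open>x\<close> outside a null set that is independent of \<open>B\<close>, and so \<open>P\<^sup>x(B) = 0\<close>.

  \<^bold>\<open>From single functions to the BL norm\<close> (\<open>BL_norm_diff_tendsto_0\<close>).
  Countably many functions suffice: a Lipschitz partition of unity on small balls approximates
  all of \<open>Lip\<close> at once, up to the small mass that finitely many balls leave uncovered.
\<close>

section \<open>The path law and the Markov property\<close>

lemma space_path_space [simp]: "space path_space = UNIV"
  by (simp add: space_PiM PiE_UNIV_domain)

lemma path_Collect: "Measurable.pred path_space Q \<Longrightarrow> {\<omega>. Q \<omega>} \<in> sets path_space"
  using Measurable.pred_def[of Q path_space] by simp

lemma emeasure_distr_nn_integral:
  assumes "T \<in> M \<rightarrow>\<^sub>M N" "A \<in> sets N"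
  shows "emeasure (distr M N T) A = (\<integral>\<^sup>+x. indicator A (T x) \<partial>M)"
proof -
  have "emeasure (distr M N T) A = (\<integral>\<^sup>+y. indicator A y \<partial>distr M N T)"
    using assms(2) by (intro nn_integral_indicator[symmetric]) simp
  also have "\<dots> = (\<integral>\<^sup>+x. indicator A (T x) \<partial>M)"
    using assms by (intro nn_integral_distr) auto
  finally show ?thesis .
qed

text \<open>
  The constrained coordinates of a basic cylinder are bounded, and the others up to the bound may be
  constrained by \<^term>\<open>UNIV\<close>. So events about initial stretches of a path determine a law.
\<close>

lemma prod_emb_as_box:
  fixes J :: "nat set" and A :: "nat \<Rightarrow> 'a :: polish_space set"
  assumes J: "finite J" and A: "\<And>i. i \<in> J \<Longrightarrow> A i \<in> sets (borel :: 'a measure)"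
  obtains n :: nat and A' :: "nat \<Rightarrow> 'a set" where "prod_emb UNIV (\<lambda>_. borel) J (Pi\<^sub>E J A) = {\<omega>. \<forall>i<n. \<omega> i \<in> A' i}"
    "\<And>i. A' i \<in> sets (borel :: 'a measure)"
proof -
  obtain n where n: "\<And>i. i \<in> J \<Longrightarrow> i < n"
    using J finite_nat_set_iff_bounded by auto
  show ?thesis
  proof (rule that[of n "\<lambda>i. if i \<in> J then A i else UNIV"])
    show "prod_emb UNIV (\<lambda>_. borel) J (Pi\<^sub>E J A) =
        {\<omega>. \<forall>i<n. \<omega> i \<in> (if i \<in> J then A i else UNIV)}"
      using n by (auto simp: prod_emb_def PiE_iff PiE_UNIV_domain)
  qed (use A in auto)
qed

locale markov_kernel =
  fixes P :: "'a :: polish_space \<Rightarrow> 'a measure"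
  assumes kernel: "transition_kernel P"
begin

abbreviation PL :: "'a \<Rightarrow> (nat \<Rightarrow> 'a) measure" where "PL \<equiv> path_law P"

lemma kernel_prob_algebra [measurable]: "P \<in> borel \<rightarrow>\<^sub>M prob_algebra borel"
  using kernel by (simp add: transition_kernel_def)

lemma kernel_subprob_algebra [measurable]: "P \<in> borel \<rightarrow>\<^sub>M subprob_algebra borel"
  by (rule measurable_prob_algebraD[OF kernel_prob_algebra])

lemma sets_kernel_at [simp, measurable_cong]: "sets (P x) = sets borel"
  using measurable_space[OF kernel_prob_algebra, of x] by (auto simp: space_prob_algebra)

lemma prob_space_kernel: "prob_space (P x)"
  using measurable_space[OF kernel_prob_algebra, of x] by (auto simp: space_prob_algebra)

lemma sets_PL [simp, measurable_cong]: "sets (PL x) = sets path_space"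
  by (rule sets_path_law[OF kernel])

lemma space_PL [simp]: "space (PL x) = UNIV"
  using sets_eq_imp_space_eq[OF sets_PL[of x]] by simp

lemma prob_space_PL: "prob_space (PL x)"
  by (rule prob_space_path_law[OF kernel])

sublocale PL: prob_space "PL x" for x
  by (rule prob_space_PL)

lemma measurable_coordinate: "(\<lambda>\<omega>. \<omega> n) \<in> PL x \<rightarrow>\<^sub>M borel"
  unfolding measurable_cong_sets[OF sets_PL refl] by (rule measurable_component_singleton) simp

text \<open>
  The expectation of \<open>v(X\<^sub>n)\<close> on the event that \<open>X\<^sub>i \<in> A\<^sub>i\<close> for \<open>i < n\<close>, for the chain started at \<open>x\<close>
  (see \<open>nn_integral_box\<close> below).
\<close>

primrec box_value :: "nat \<Rightarrow> (nat \<Rightarrow> 'a set) \<Rightarrow> ('a \<Rightarrow> ennreal) \<Rightarrow> 'a \<Rightarrow> ennreal" where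
  "box_value 0 A v x = v x"
| "box_value (Suc n) A v x = indicator (A 0) x * (\<integral>\<^sup>+y. box_value n (\<lambda>i. A (Suc i)) v y \<partial>P x)"

text \<open>
  The recursion can also be run from the last coordinate. The Markov property peels off the last
  coordinate of a box, whereas measurability in the starting point and the first step
  decomposition need the recursion from the front.
\<close>

lemma box_value_Suc_back:
  "box_value (Suc n) A v = box_value n A (\<lambda>y. indicator (A n) y * (\<integral>\<^sup>+z. v z \<partial>P y))"
proof (induction n arbitrary: A)
  case (Suc n)
  show ?case
  proof
    fix x
    have "box_value (Suc (Suc n)) A v x =
        indicator (A 0) x * (\<integral>\<^sup>+y. box_value (Suc n) (\<lambda>i. A (Suc i)) v y \<partial>P x)"
      by (rule box_value.simps(2))
    also have "\<dots> = box_value (Suc n) A (\<lambda>y. indicator (A (Suc n)) y * (\<integral>\<^sup>+z. v z \<partial>P y)) x"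
      unfolding Suc.IH by (subst box_value.simps(2)) simp
    finally show "box_value (Suc (Suc n)) A v x = \<dots>" .
  qed
qed auto

lemma measurable_box_value:
  assumes "\<And>i. A i \<in> sets borel" and [measurable]: "v \<in> borel_measurable borel"
  shows "box_value n A v \<in> borel_measurable borel"
  using assms(1)
proof (induction n arbitrary: A)
  case 0
  have "box_value 0 A v = v" by auto
  then show ?case by simp
next
  case (Suc n)
  have [measurable]: "A 0 \<in> sets borel" by (rule Suc.prems)
  have [measurable]: "box_value n (\<lambda>i. A (Suc i)) v \<in> borel_measurable borel"
    by (rule Suc.IH) (rule Suc.prems)
  have eq: "box_value (Suc n) A v =
      (\<lambda>x. indicator (A 0) x * (\<integral>\<^sup>+y. box_value n (\<lambda>i. A (Suc i)) v y \<partial>P x))"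
    by auto
  show ?case
    unfolding eq by measurable
qed

text \<open>
  The Markov property in its defining form, extended from events to functions of the next coordinate.
\<close>

lemma nn_integral_next_coordinate:
  assumes A: "\<And>i. A i \<in> sets borel" and "v \<in> borel_measurable borel"
  shows "(\<integral>\<^sup>+\<omega>. indicator {\<omega>. \<forall>i\<le>n. \<omega> i \<in> A i} \<omega> * v (\<omega> (Suc n)) \<partial>PL x) =
    (\<integral>\<^sup>+\<omega>. indicator {\<omega>. \<forall>i\<le>n. \<omega> i \<in> A i} \<omega> * (\<integral>\<^sup>+z. v z \<partial>P (\<omega> n)) \<partial>PL x)"
  using assms(2)
proof induction
  case (cong f g)
  then show ?case by (simp add: space_borel cong: nn_integral_cong)
next
  case (set B)
  note [measurable] = A set
  let ?A = "{\<omega> \<in> space (PiM {0..<Suc n} (\<lambda>_. borel)). \<forall>i\<in>{0..<Suc n}. \<omega> i \<in> A i}"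
  have [measurable]: "?A \<in> sets (PiM {0..<Suc n} (\<lambda>_. borel))"
    by measurable
  have r: "restrict \<omega> {0..<Suc n} \<in> ?A \<longleftrightarrow> (\<forall>i\<le>n. \<omega> i \<in> A i)" for \<omega>
    by (auto simp: space_PiM)
  have "(\<integral>\<^sup>+\<omega>. indicator {\<omega>. \<forall>i\<le>n. \<omega> i \<in> A i} \<omega> * indicator B (\<omega> (Suc n)) \<partial>PL x) =
      (\<integral>\<^sup>+\<omega>. indicator {\<omega>. restrict \<omega> {0..<Suc n} \<in> ?A \<and> \<omega> (Suc n) \<in> B} \<omega> \<partial>PL x)"
    unfolding r by (auto intro!: nn_integral_cong split: split_indicator)
  also have "\<dots> = emeasure (PL x) {\<omega>. restrict \<omega> {0..<Suc n} \<in> ?A \<and> \<omega> (Suc n) \<in> B}"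
    unfolding r by (rule nn_integral_indicator, unfold sets_PL, rule path_Collect) measurable
  also have "\<dots> = (\<integral>\<^sup>+\<omega>. indicator ?A (restrict \<omega> {0..<Suc n}) * emeasure (P (\<omega> n)) B \<partial>PL x)"
    by (rule path_law_Suc[OF kernel]) auto
  also have "\<dots> = (\<integral>\<^sup>+\<omega>. indicator {\<omega>. \<forall>i\<le>n. \<omega> i \<in> A i} \<omega> * (\<integral>\<^sup>+z. indicator B z \<partial>P (\<omega> n)) \<partial>PL x)"
    using r by (intro nn_integral_cong) (simp add: indicator_def del: restrict_apply nn_integral_indicator flip: nn_integral_indicator)
  finally show ?case .
next
  case (mult u c)
  note [measurable] = A mult(2)
  have "(\<integral>\<^sup>+\<omega>. indicator {\<omega>. \<forall>i\<le>n. \<omega> i \<in> A i} \<omega> * (c * u (\<omega> (Suc n))) \<partial>PL x) =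
      c * (\<integral>\<^sup>+\<omega>. indicator {\<omega>. \<forall>i\<le>n. \<omega> i \<in> A i} \<omega> * u (\<omega> (Suc n)) \<partial>PL x)"
    by (subst nn_integral_cmult[symmetric]) (auto simp: ac_simps)
  also have "\<dots> = c * (\<integral>\<^sup>+\<omega>. indicator {\<omega>. \<forall>i\<le>n. \<omega> i \<in> A i} \<omega> * (\<integral>\<^sup>+z. u z \<partial>P (\<omega> n)) \<partial>PL x)"
    by (simp add: mult)
  also have "\<dots> = (\<integral>\<^sup>+\<omega>. indicator {\<omega>. \<forall>i\<le>n. \<omega> i \<in> A i} \<omega> * (\<integral>\<^sup>+z. c * u z \<partial>P (\<omega> n)) \<partial>PL x)"
  proof -
    have "(\<integral>\<^sup>+z. c * u z \<partial>P y) = c * (\<integral>\<^sup>+z. u z \<partial>P y)" for y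
      by (rule nn_integral_cmult) measurable
    then show ?thesis
      by (subst nn_integral_cmult[symmetric]) (simp_all add: ac_simps)
  qed
  finally show ?case .
next
  case (add u v)
  note [measurable] = A add(1,3)
  show ?case
    by (simp add: distrib_left nn_integral_add add)
next
  case (seq U)
  note [measurable] = A seq(1)
  have inc: "incseq (\<lambda>i. U i (y :: 'a))" for y
    using seq by (auto simp: incseq_def le_fun_def)
  have "(\<integral>\<^sup>+\<omega>. indicator {\<omega>. \<forall>i\<le>n. \<omega> i \<in> A i} \<omega> * (\<Squnion>k. U k) (\<omega> (Suc n)) \<partial>PL x) =
    (\<integral>\<^sup>+\<omega>. (SUP k. indicator {\<omega>. \<forall>i\<le>n. \<omega> i \<in> A i} \<omega> * U k (\<omega> (Suc n))) \<partial>PL x)"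
    by (simp add: SUP_apply SUP_mult_left_ennreal image_comp)
  also have "\<dots> = (SUP k. \<integral>\<^sup>+\<omega>. indicator {\<omega>. \<forall>i\<le>n. \<omega> i \<in> A i} \<omega> * U k (\<omega> (Suc n)) \<partial>PL x)"
    by (intro nn_integral_monotone_convergence_SUP)
       (auto simp: incseq_def le_fun_def intro!: mult_left_mono incseqD[OF inc])
  also have "\<dots> = (SUP k. \<integral>\<^sup>+\<omega>. indicator {\<omega>. \<forall>i\<le>n. \<omega> i \<in> A i} \<omega> * (\<integral>\<^sup>+z. U k z \<partial>P (\<omega> n)) \<partial>PL x)"
    by (simp add: seq)
  also have "\<dots> = (\<integral>\<^sup>+\<omega>. (SUP k. indicator {\<omega>. \<forall>i\<le>n. \<omega> i \<in> A i} \<omega> * (\<integral>\<^sup>+z. U k z \<partial>P (\<omega> n))) \<partial>PL x)"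
    by (intro nn_integral_monotone_convergence_SUP[symmetric])
       (auto simp: incseq_def le_fun_def intro!: mult_left_mono nn_integral_mono incseqD[OF inc])
  also have "\<dots> = (\<integral>\<^sup>+\<omega>. indicator {\<omega>. \<forall>i\<le>n. \<omega> i \<in> A i} \<omega> * (\<integral>\<^sup>+z. (\<Squnion>k. U k) z \<partial>P (\<omega> n)) \<partial>PL x)"
    by (simp add: SUP_apply SUP_mult_left_ennreal[symmetric] nn_integral_monotone_convergence_SUP
         incseq_def le_fun_def incseqD[OF inc] image_comp)
  finally show ?case .
qed

lemma nn_integral_start:
  assumes [measurable]: "v \<in> borel_measurable borel"
  shows "(\<integral>\<^sup>+\<omega>. v (\<omega> 0) \<partial>PL x) = v x"
proof -
  have "(\<integral>\<^sup>+\<omega>. v (\<omega> 0) \<partial>PL x) = (\<integral>\<^sup>+y. v y \<partial>distr (PL x) borel (\<lambda>\<omega>. \<omega> 0))"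
    by (subst nn_integral_distr) auto
  then show ?thesis
    by (simp add: path_law_0[OF kernel] nn_integral_return)
qed

lemma nn_integral_box:
  assumes "\<And>i. A i \<in> sets borel" "v \<in> borel_measurable borel"
  shows "(\<integral>\<^sup>+\<omega>. indicator {\<omega>. \<forall>i<n. \<omega> i \<in> A i} \<omega> * v (\<omega> n) \<partial>PL x) = box_value n A v x"
  using assms
proof (induction n arbitrary: v)
  case 0
  then show ?case by (simp add: nn_integral_start)
next
  case (Suc n)
  note [measurable] = Suc.prems
  let ?v = "\<lambda>y. indicator (A n) y * (\<integral>\<^sup>+z. v z \<partial>P y)"
  have "(\<integral>\<^sup>+\<omega>. indicator {\<omega>. \<forall>i<Suc n. \<omega> i \<in> A i} \<omega> * v (\<omega> (Suc n)) \<partial>PL x) =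
    (\<integral>\<^sup>+\<omega>. indicator {\<omega>. \<forall>i\<le>n. \<omega> i \<in> A i} \<omega> * (\<integral>\<^sup>+z. v z \<partial>P (\<omega> n)) \<partial>PL x)"
    using nn_integral_next_coordinate[OF Suc.prems, where n=n and x=x] by (simp add: less_Suc_eq_le)
  also have "\<dots> = (\<integral>\<^sup>+\<omega>. indicator {\<omega>. \<forall>i<n. \<omega> i \<in> A i} \<omega> * ?v (\<omega> n) \<partial>PL x)"
    by (intro nn_integral_cong) (auto split: split_indicator simp: le_less)
  also have "\<dots> = box_value n A ?v x"
    by (rule Suc.IH) auto
  finally show ?case
    unfolding box_value_Suc_back .
qed

lemma emeasure_box:
  assumes [measurable]: "\<And>i. A i \<in> sets borel"
  shows "emeasure (PL x) {\<omega>. \<forall>i<n. \<omega> i \<in> A i} = box_value n A (\<lambda>_. 1) x"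
proof -
  have [measurable]: "{\<omega>. \<forall>i<n. \<omega> i \<in> A i} \<in> sets path_space"
    by (rule path_Collect) measurable
  show ?thesis
    using nn_integral_box[where A=A and v="\<lambda>_. 1" and n=n and x=x] by simp
qed

lemma PL_measurable [measurable]: "PL \<in> borel \<rightarrow>\<^sub>M prob_algebra path_space"
proof (rule measurable_prob_algebra_generated[OF sets_PiM Int_stable_prod_algebra])
  fix C assume "C \<in> prod_algebra (UNIV :: nat set) (\<lambda>_. borel :: 'a measure)"
  from prod_algebraE[OF this] obtain J E where C:
    "C = prod_emb UNIV (\<lambda>_. borel) J (\<Pi>\<^sub>E j\<in>J. E j)" and "finite J"
    "\<And>i. i \<in> J \<Longrightarrow> E i \<in> sets (borel :: 'a measure)" by metis
  then obtain n :: nat and A where "C = {\<omega>. \<forall>i<n. \<omega> i \<in> A i}" and A: "\<And>i. A i \<in> sets (borel :: 'a measure)"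
    using prod_emb_as_box[of J E] by blast
  then have "(\<lambda>x. emeasure (PL x) C) = box_value n A (\<lambda>_. 1)"
    by (auto simp: emeasure_box)
  then show "(\<lambda>x. emeasure (PL x) C) \<in> borel_measurable borel"
    using measurable_box_value[OF A, of "\<lambda>_. 1" n] by simp
qed (use prod_algebra_sets_into_space prob_space_PL in auto)

lemma PL_measurable_subprob [measurable]: "PL \<in> borel \<rightarrow>\<^sub>M subprob_algebra path_space"
  by (rule measurable_prob_algebraD[OF PL_measurable])

lemma measurable_case_nat_path: "case_nat x \<in> path_space \<rightarrow>\<^sub>M path_space"
  for x :: 'a
proof (rule measurable_PiM_single')
  fix i :: nat
  show "(\<lambda>\<omega>. case_nat x \<omega> i) \<in> path_space \<rightarrow>\<^sub>M borel"
    by (cases i) simp_all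
qed (auto simp: space_PiM PiE_UNIV_domain)

lemma first_step_kernel:
  "(\<lambda>y. distr (PL y) path_space (case_nat x)) \<in> P z \<rightarrow>\<^sub>M subprob_algebra path_space"
  unfolding measurable_cong_sets[OF sets_kernel_at refl]
  by (rule measurable_compose[OF PL_measurable_subprob measurable_distr[OF measurable_case_nat_path]])

text \<open>
  Boxes generate the product \<open>\<sigma>\<close>-field, and on boxes the two sides agree by the recursion for
  \<open>box_value\<close>.
\<close>

lemma path_law_first_step: "PL x = P x \<bind> (\<lambda>y. distr (PL y) path_space (case_nat x))"
proof (rule measure_eqI_PiM_infinite)
  have K: "(\<lambda>y. distr (PL y) path_space (case_nat x)) \<in> P x \<rightarrow>\<^sub>M subprob_algebra path_space"
    by (rule first_step_kernel)
  show sets: "sets (P x \<bind> (\<lambda>y. distr (PL y) path_space (case_nat x))) = sets path_space"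
    by (subst sets_bind[OF _ ]) (auto simp: prob_space.not_empty[OF prob_space_kernel])
  fix E and J :: "nat set"
  assume "finite J" "\<And>i. i \<in> J \<Longrightarrow> E i \<in> sets (borel :: 'a measure)"
  then obtain n :: nat and A where
    eq: "prod_emb UNIV (\<lambda>_. borel) J (Pi\<^sub>E J E) = {\<omega>. \<forall>i<n. \<omega> i \<in> A i}"
    and A[measurable]: "\<And>i. A i \<in> sets (borel :: 'a measure)"
    using prod_emb_as_box[of J E] by blast
  have C: "{\<omega> :: nat \<Rightarrow> 'a. \<forall>i<n. \<omega> i \<in> A i} \<in> sets path_space"
    by (rule path_Collect) measurable
  show "emeasure (PL x) (prod_emb UNIV (\<lambda>_. borel) J (Pi\<^sub>E J E)) =
      emeasure (P x \<bind> (\<lambda>y. distr (PL y) path_space (case_nat x)))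
        (prod_emb UNIV (\<lambda>_. borel) J (Pi\<^sub>E J E))"
  proof (cases n)
    case 0
    have "prob_space (P x \<bind> (\<lambda>y. distr (PL y) path_space (case_nat x)))"
      by (rule prob_space.prob_space_bind[OF prob_space_kernel _ K])
         (auto intro!: PL.prob_space_distr)
    then show ?thesis
      using prob_space.emeasure_space_1 sets_eq_imp_space_eq[OF sets] PL.emeasure_space_1[of x]
      unfolding eq 0 by fastforce
  next
    case (Suc m)
    have "emeasure (P x \<bind> (\<lambda>y. distr (PL y) path_space (case_nat x))) {\<omega>. \<forall>i<n. \<omega> i \<in> A i} =
        (\<integral>\<^sup>+y. emeasure (distr (PL y) path_space (case_nat x)) {\<omega>. \<forall>i<n. \<omega> i \<in> A i} \<partial>P x)"
      by (rule emeasure_bind[OF prob_space.not_empty[OF prob_space_kernel] K C])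
    also have "\<dots> = (\<integral>\<^sup>+y. indicator (A 0) x * box_value m (\<lambda>i. A (Suc i)) (\<lambda>_. 1) y \<partial>P x)"
    proof (rule nn_integral_cong)
      fix y
      have "emeasure (distr (PL y) path_space (case_nat x)) {\<omega>. \<forall>i<n. \<omega> i \<in> A i} =
          emeasure (PL y) {\<omega>. x \<in> A 0 \<and> (\<forall>i<m. \<omega> i \<in> A (Suc i))}"
        by (subst emeasure_distr[OF _ C])
           (auto intro!: arg_cong2[where f=emeasure] simp: Suc All_less_Suc2)
      also have "\<dots> = indicator (A 0) x * box_value m (\<lambda>i. A (Suc i)) (\<lambda>_. 1) y"
        using emeasure_box[of "\<lambda>i. A (Suc i)" y m] by (cases "x \<in> A 0") auto
      finally show "emeasure (distr (PL y) path_space (case_nat x)) {\<omega>. \<forall>i<n. \<omega> i \<in> A i} = \<dots>" .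
    qed
    also have "\<dots> = indicator (A 0) x * (\<integral>\<^sup>+y. box_value m (\<lambda>i. A (Suc i)) (\<lambda>_. 1) y \<partial>P x)"
      using measurable_box_value[of "\<lambda>i. A (Suc i)" "\<lambda>_. 1" m]
      by (intro nn_integral_cmult) (simp add: measurable_cong_sets[OF sets_kernel_at refl])
    also have "\<dots> = box_value n A (\<lambda>_. 1) x"
      by (simp add: Suc)
    finally show ?thesis
      unfolding eq by (simp add: emeasure_box)
  qed
qed (auto intro: PL.finite_measure)

lemma nn_integral_first_step:
  assumes [measurable]: "F \<in> borel_measurable path_space"
  shows "(\<integral>\<^sup>+\<omega>. F \<omega> \<partial>PL x) = (\<integral>\<^sup>+y. \<integral>\<^sup>+\<omega>. F (case_nat x \<omega>) \<partial>PL y \<partial>P x)"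
  by (subst path_law_first_step, subst nn_integral_bind[OF assms first_step_kernel])
     (simp add: nn_integral_distr)

lemma AE_PL_start: "AE \<omega> in PL x. \<omega> 0 = x"
proof -
  have [measurable]: "{\<omega>. \<omega> 0 \<noteq> x} \<in> sets path_space"
    by (rule path_Collect) measurable
  have "emeasure (PL x) {\<omega>. \<omega> 0 \<noteq> x} = (\<integral>\<^sup>+\<omega>. indicator {\<omega>. \<omega> 0 \<noteq> x} \<omega> \<partial>PL x)"
    by (subst nn_integral_indicator) auto
  also have "\<dots> = (\<integral>\<^sup>+\<omega>. indicator (- {x}) (\<omega> 0) \<partial>PL x)"
    by (rule nn_integral_cong) (simp split: split_indicator)
  also have "\<dots> = 0"
    by (subst nn_integral_start) auto
  finally show ?thesis
    by (subst AE_iff_measurable[OF _ refl]) auto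
qed

lemma measurable_shift: "(\<lambda>\<omega> i. \<omega> (n + i)) \<in> path_space \<rightarrow>\<^sub>M path_space"
  for n :: nat
  by (rule measurable_PiM_single') (auto simp: space_PiM PiE_UNIV_domain)

text \<open>
  The shift \<open>\<theta>\<^sup>n\<close> is written \<open>\<lambda>\<omega> i. \<omega> (n + i)\<close>; that \<open>G\<close> is a function of the first \<open>n + 1\<close>
  coordinates is expressed by its invariance under changes of the other ones. The proof is by
  induction on \<open>n\<close> with the first step decomposition: as a function of the remaining path, \<open>G\<close> loses
  one coordinate.
\<close>

lemma markov_property:
  assumes [measurable]: "G \<in> borel_measurable path_space" "H \<in> borel_measurable path_space"
    and G: "\<And>\<omega> \<omega>'. (\<forall>i\<le>n. \<omega> i = \<omega>' i) \<Longrightarrow> G \<omega> = (G \<omega>' :: ennreal)"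
  shows "(\<integral>\<^sup>+\<omega>. G \<omega> * H (\<lambda>i. \<omega> (n + i)) \<partial>PL x) =
    (\<integral>\<^sup>+\<omega>. G \<omega> * (\<integral>\<^sup>+\<omega>'. H \<omega>' \<partial>PL (\<omega> n)) \<partial>PL x)"
  using assms(1) G
proof (induction n arbitrary: G x)
  case 0
  have eq: "AE \<omega> in PL x. G \<omega> = G (\<lambda>_. x)"
    using AE_PL_start by eventually_elim (auto intro: "0.prems")
  have "(\<integral>\<^sup>+\<omega>. G \<omega> * H (\<lambda>i. \<omega> (0 + i)) \<partial>PL x) = (\<integral>\<^sup>+\<omega>. G (\<lambda>_. x) * H \<omega> \<partial>PL x)"
    using eq by (intro nn_integral_cong_AE) auto
  also have "\<dots> = G (\<lambda>_. x) * (\<integral>\<^sup>+\<omega>. H \<omega> \<partial>PL x)"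
    by (rule nn_integral_cmult) measurable
  also have "\<dots> = (\<integral>\<^sup>+\<omega>. G (\<lambda>_. x) * (\<integral>\<^sup>+\<omega>'. H \<omega>' \<partial>PL x) \<partial>PL x)"
    by (simp add: PL.emeasure_space_1[simplified])
  also have "\<dots> = (\<integral>\<^sup>+\<omega>. G \<omega> * (\<integral>\<^sup>+\<omega>'. H \<omega>' \<partial>PL (\<omega> 0)) \<partial>PL x)"
    using eq AE_PL_start[of x] by (intro nn_integral_cong_AE) auto
  finally show ?case .
next
  case (Suc n)
  note [measurable] = Suc.prems(1)
  have "(\<integral>\<^sup>+\<omega>. G \<omega> * H (\<lambda>i. \<omega> (Suc n + i)) \<partial>PL x) =
      (\<integral>\<^sup>+y. \<integral>\<^sup>+\<omega>. G (case_nat x \<omega>) * H (\<lambda>i. \<omega> (n + i)) \<partial>PL y \<partial>P x)"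
    using measurable_compose[OF measurable_shift[of "Suc n"] assms(2)]
    by (subst nn_integral_first_step) auto
  also have "\<dots> = (\<integral>\<^sup>+y. \<integral>\<^sup>+\<omega>. G (case_nat x \<omega>) * (\<integral>\<^sup>+\<omega>'. H \<omega>' \<partial>PL (\<omega> n)) \<partial>PL y \<partial>P x)"
    by (intro nn_integral_cong Suc.IH) (auto intro!: Suc.prems split: nat.split)
  also have "\<dots> = (\<integral>\<^sup>+\<omega>. G \<omega> * (\<integral>\<^sup>+\<omega>'. H \<omega>' \<partial>PL (\<omega> (Suc n))) \<partial>PL x)"
    by (subst nn_integral_first_step[of _ x]) auto
  finally show ?case .
qed

lemma distr_shift_PL:
  "distr (PL x) path_space (\<lambda>\<omega> i. \<omega> (n + i)) = distr (PL x) borel (\<lambda>\<omega>. \<omega> n) \<bind> PL"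
proof (rule measure_eqI)
  show "sets (distr (PL x) path_space (\<lambda>\<omega> i. \<omega> (n + i))) = sets (distr (PL x) borel (\<lambda>\<omega>. \<omega> n) \<bind> PL)"
    by (subst sets_bind[where N=path_space]) auto
  fix A assume "A \<in> sets (distr (PL x) path_space (\<lambda>\<omega> i. \<omega> (n + i)))"
  then have A: "A \<in> sets path_space" by simp
  have shift: "(\<lambda>\<omega> i. \<omega> (n + i)) \<in> PL x \<rightarrow>\<^sub>M path_space"
    by (simp add: measurable_cong_sets[OF sets_PL refl] measurable_shift)
  have "emeasure (distr (PL x) path_space (\<lambda>\<omega> i. \<omega> (n + i))) A =
      (\<integral>\<^sup>+\<omega>. indicator A (\<lambda>i. \<omega> (n + i)) \<partial>PL x)"
    by (rule emeasure_distr_nn_integral[OF shift A])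
  also have "\<dots> = (\<integral>\<^sup>+\<omega>. emeasure (PL (\<omega> n)) A \<partial>PL x)"
    using markov_property[of "\<lambda>_. 1" "indicator A" n x] A by simp
  also have "\<dots> = (\<integral>\<^sup>+y. emeasure (PL y) A \<partial>distr (PL x) borel (\<lambda>\<omega>. \<omega> n))"
    using measurable_compose[OF PL_measurable_subprob measurable_emeasure_subprob_algebra[OF A]]
    by (intro nn_integral_distr[symmetric] measurable_coordinate) simp
  also have "\<dots> = emeasure (distr (PL x) borel (\<lambda>\<omega>. \<omega> n) \<bind> PL) A"
    using A by (intro emeasure_bind[symmetric, where N=path_space]) simp_all
  finally show "emeasure (distr (PL x) path_space (\<lambda>\<omega> i. \<omega> (n + i))) A =
      emeasure (distr (PL x) borel (\<lambda>\<omega>. \<omega> n) \<bind> PL) A" .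
qed

lemma distr_coordinate_1: "distr (PL x) borel (\<lambda>\<omega>. \<omega> (Suc 0)) = P x"
proof (rule measure_eqI)
  fix A assume "A \<in> sets (distr (PL x) borel (\<lambda>\<omega>. \<omega> (Suc 0)))"
  then have A: "A \<in> sets borel" by simp
  have F: "(\<lambda>\<omega>. indicator A (\<omega> (Suc 0)) :: ennreal) \<in> borel_measurable path_space"
    using A by (intro measurable_compose[OF measurable_component_singleton]) auto
  have "emeasure (distr (PL x) borel (\<lambda>\<omega>. \<omega> (Suc 0))) A = (\<integral>\<^sup>+\<omega>. indicator A (\<omega> (Suc 0)) \<partial>PL x)"
    by (rule emeasure_distr_nn_integral[OF measurable_coordinate A])
  also have "\<dots> = (\<integral>\<^sup>+y. \<integral>\<^sup>+\<omega>. indicator A (\<omega> 0) \<partial>PL y \<partial>P x)"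
    by (subst nn_integral_first_step[OF F]) simp
  also have "\<dots> = (\<integral>\<^sup>+y. indicator A y \<partial>P x)"
    using A by (intro nn_integral_cong nn_integral_start) simp
  finally show "emeasure (distr (PL x) borel (\<lambda>\<omega>. \<omega> (Suc 0))) A = emeasure (P x) A"
    using A by simp
qed simp

lemma distr_coordinate: "distr (PL x) borel (\<lambda>\<omega>. \<omega> n) = kernel_power P n x"
proof (induction n)
  case 0
  then show ?case by (simp add: path_law_0[OF kernel])
next
  case (Suc n)
  have shift: "(\<lambda>\<omega> i. \<omega> (n + i)) \<in> PL x \<rightarrow>\<^sub>M path_space"
    by (simp add: measurable_cong_sets[OF sets_PL refl] measurable_shift)
  have c1: "(\<lambda>\<omega>. \<omega> (Suc 0)) \<in> path_space \<rightarrow>\<^sub>M (borel :: 'a measure)"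
    by (rule measurable_component_singleton) simp
  have "distr (PL x) borel (\<lambda>\<omega>. \<omega> (Suc n)) =
      distr (distr (PL x) path_space (\<lambda>\<omega> i. \<omega> (n + i))) borel (\<lambda>\<omega>. \<omega> (Suc 0))"
    by (subst distr_distr[OF c1 shift]) (simp add: comp_def)
  also have "\<dots> = distr (PL x) borel (\<lambda>\<omega>. \<omega> n) \<bind> (\<lambda>y. distr (PL y) borel (\<lambda>\<omega>. \<omega> (Suc 0)))"
    unfolding distr_shift_PL by (rule distr_bind[where K=path_space, OF _ _ c1]) simp_all
  also have "\<dots> = kernel_power P (Suc n) x"
    unfolding distr_coordinate_1 Suc.IH by simp
  finally show ?case .
qed

end

section \<open>Couplings and the stationary chain\<close>

lemma integrable_bounded:
  fixes f :: "'b \<Rightarrow> real"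
  assumes "finite_measure M" "f \<in> borel_measurable M" "\<And>x. \<bar>f x\<bar> \<le> b"
  shows "integrable M f"
  using assms by (intro finite_measure.integrable_const_bound[where B=b]) auto

lemma abs_integral_le:
  fixes f :: "'b \<Rightarrow> real"
  assumes "prob_space M" "\<And>x. \<bar>f x\<bar> \<le> b" "f \<in> borel_measurable M"
  shows "\<bar>\<integral>x. f x \<partial>M\<bar> \<le> b"
proof -
  interpret prob_space M by fact
  have "\<bar>\<integral>x. f x \<partial>M\<bar> \<le> (\<integral>x. \<bar>f x\<bar> \<partial>M)"
    by (rule integral_abs_bound)
  also have "\<dots> \<le> (\<integral>x. b \<partial>M)"
    using assms integrable_bounded[OF finite_measure_axioms assms(3,2)] by (intro integral_mono) auto
  finally show ?thesis by (simp add: prob_space)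
qed

lemma integral_bind_bounded:
  fixes f :: "'b \<Rightarrow> real"
  assumes "f \<in> borel_measurable K" "\<And>x. \<bar>f x\<bar> \<le> b" "N \<in> M \<rightarrow>\<^sub>M subprob_algebra K" "prob_space M"
  shows "(\<integral>y. f y \<partial>(M \<bind> N)) = (\<integral>x. \<integral>y. f y \<partial>N x \<partial>M)"
proof -
  interpret prob_space M by fact
  have "AE x in M. emeasure (N x) (space (N x)) \<le> ennreal 1"
  proof (rule AE_I2)
    fix x assume "x \<in> space M"
    then have "subprob_space (N x)"
      using measurable_space[OF assms(3)] by (simp add: space_subprob_algebra)
    then show "emeasure (N x) (space (N x)) \<le> ennreal 1"
      by (simp add: subprob_space.emeasure_space_le_1)
  qed
  then show ?thesis
    using assms by (intro integral_bind[where B=b and B'=1 and K=K]) (auto intro: finite_measure)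
qed

text \<open>
  The index is a natural number, so that countably many classes exhaust the pairs of paths with
  summable squared distances.
\<close>

definition l2_close :: "nat \<Rightarrow> (nat \<Rightarrow> 'a :: metric_space) \<Rightarrow> (nat \<Rightarrow> 'a) \<Rightarrow> bool" where
  "l2_close M \<omega> \<omega>' \<longleftrightarrow> (\<forall>N. (\<Sum>n<N. (dist (\<omega> n) (\<omega>' n))\<^sup>2) \<le> real M)"

text \<open>
  The trace that a coupling leaves on its marginals: the dual form of \<open>\<delta> \<le> Q[\<omega> \<sim>\<^sub>M \<omega>']\<close>. It
  mentions integrals under \<open>\<mu>\<close> and \<open>\<nu>\<close> only. Bounded real functions are used so that no integrability
  questions arise.
\<close>

definition overlap ::
  "nat \<Rightarrow> real \<Rightarrow> (nat \<Rightarrow> 'a :: polish_space) measure \<Rightarrow> (nat \<Rightarrow> 'a) measure \<Rightarrow> bool" where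
  "overlap M \<delta> \<mu> \<nu> \<longleftrightarrow> (\<forall>U \<in> borel_measurable path_space. \<forall>V \<in> borel_measurable path_space. \<forall>b D.
     (\<forall>\<omega>. 0 \<le> U \<omega> \<and> U \<omega> \<le> b \<and> 0 \<le> V \<omega> \<and> V \<omega> \<le> (b::real)) \<longrightarrow>
     (\<forall>\<omega> \<omega>'. l2_close M \<omega> \<omega>' \<longrightarrow> D \<le> U \<omega> + V \<omega>') \<longrightarrow>
     D * \<delta> \<le> (\<integral>\<omega>. U \<omega> \<partial>\<mu>) + (\<integral>\<omega>. V \<omega> \<partial>\<nu>))"

lemma overlapD:
  assumes "overlap M \<delta> \<mu> \<nu>" "U \<in> borel_measurable path_space" "V \<in> borel_measurable path_space"
    "\<And>\<omega>. 0 \<le> U \<omega>" "\<And>\<omega>. U \<omega> \<le> b" "\<And>\<omega>. 0 \<le> V \<omega>" "\<And>\<omega>. V \<omega> \<le> b"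
    "\<And>\<omega> \<omega>'. l2_close M \<omega> \<omega>' \<Longrightarrow> D \<le> U \<omega> + V \<omega>'"
  shows "D * \<delta> \<le> (\<integral>\<omega>. U \<omega> \<partial>\<mu>) + (\<integral>\<omega>. V \<omega> \<partial>\<nu>)"
  using assms unfolding overlap_def by blast

text \<open>
  Continuity of measure selects \<open>M\<close>. Then the inequality is integrated over \<open>{\<omega> \<sim>\<^sub>M \<omega>'}\<close>
  with respect to the coupling.
\<close>

lemma overlap_if_coupling:
  fixes \<mu> \<nu> :: "(nat \<Rightarrow> 'a :: polish_space) measure"
  assumes [measurable_cong]: "sets \<mu> = sets path_space" "sets \<nu> = sets path_space"
    and Q: "Q \<in> couplings \<mu> \<nu>"
    and pos: "measure Q {(\<omega>, \<omega>') \<in> space Q. summable (\<lambda>n. (dist (\<omega> n) (\<omega>' n))\<^sup>2)} > 0"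
  shows "\<exists>M \<delta>. \<delta> > 0 \<and> overlap M \<delta> \<mu> \<nu>"
proof -
  interpret Q: prob_space Q
    using Q by (simp add: couplings_def)
  have sets_Q [measurable_cong]: "sets Q = sets (path_space \<Otimes>\<^sub>M path_space)"
    using Q assms(1,2) by (simp add: couplings_def cong: sets_pair_measure_cong)
  have space_Q [simp]: "space Q = UNIV"
    using sets_eq_imp_space_eq[OF sets_Q] by (simp add: space_pair_measure)
  have \<mu>: "\<mu> = distr Q \<mu> fst" and \<nu>: "\<nu> = distr Q \<nu> snd"
    using Q by (simp_all add: couplings_def)
  define \<Omega> where "\<Omega> M = {z. l2_close M (fst z) (snd z :: nat \<Rightarrow> 'a)}" for M
  have [measurable]: "(\<lambda>z. \<Sum>n<N. (dist (fst z n) (snd z n :: 'a))\<^sup>2) \<in> borel_measurable Q" for N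
    by measurable
  have "{z\<in>space Q. l2_close M (fst z) (snd z)} \<in> sets Q" for M
    unfolding l2_close_def by measurable
  then have \<Omega>[measurable]: "\<Omega> M \<in> sets Q" for M
    by (simp add: \<Omega>_def)
  have sub: "{(\<omega>, \<omega>') \<in> space Q. summable (\<lambda>n. (dist (\<omega> n) (\<omega>' n))\<^sup>2)} \<subseteq> (\<Union>M. \<Omega> M)"
  proof clarify
    fix \<omega> \<omega>' :: "nat \<Rightarrow> 'a" assume *: "summable (\<lambda>n. (dist (\<omega> n) (\<omega>' n))\<^sup>2)"
    obtain M :: nat where "(\<Sum>n. (dist (\<omega> n) (\<omega>' n))\<^sup>2) \<le> real M"
      using real_arch_simple by blast
    then have "l2_close M \<omega> \<omega>'"
      unfolding l2_close_def using sum_le_suminf[OF *] by (meson finite_lessThan order_trans zero_le_power2)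
    then show "(\<omega>, \<omega>') \<in> (\<Union>M. \<Omega> M)"
      by (auto simp: \<Omega>_def)
  qed
  have "\<exists>M. measure Q (\<Omega> M) > 0"
  proof (rule ccontr)
    assume "\<not> ?thesis"
    then have "measure Q (\<Omega> M) = 0" for M
      by (meson measure_nonneg not_le order_antisym)
    then have "(\<Union>M. \<Omega> M) \<in> null_sets Q"
      by (intro null_sets_UN) (auto simp: null_sets_def Q.emeasure_eq_measure)
    then have "measure Q (\<Union>M. \<Omega> M) = 0"
      by (simp add: null_setsD1 measure_def)
    then show False
      using Q.finite_measure_mono[OF sub] pos by (simp add: sets.countable_UN)
  qed
  then obtain M where M: "measure Q (\<Omega> M) > 0" by blast
  have "overlap M (measure Q (\<Omega> M)) \<mu> \<nu>"
    unfolding overlap_def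
  proof (intro ballI allI impI)
    fix U V :: "(nat \<Rightarrow> 'a) \<Rightarrow> real" and b D
    assume [measurable]: "U \<in> borel_measurable path_space" "V \<in> borel_measurable path_space"
      and b: "\<forall>\<omega>. 0 \<le> U \<omega> \<and> U \<omega> \<le> b \<and> 0 \<le> V \<omega> \<and> V \<omega> \<le> b"
      and D: "\<forall>\<omega> \<omega>'. l2_close M \<omega> \<omega>' \<longrightarrow> D \<le> U \<omega> + V \<omega>'"
    have i: "integrable Q (\<lambda>z. U (fst z))" "integrable Q (\<lambda>z. V (snd z))"
      using b by (auto intro!: integrable_bounded[where b=b] simp: Q.finite_measure_axioms)
    have "D * measure Q (\<Omega> M) = (\<integral>z. D * indicator (\<Omega> M) z \<partial>Q)"
      by simp
    also have "\<dots> \<le> (\<integral>z. U (fst z) + V (snd z) \<partial>Q)"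
    proof (rule integral_mono)
      have "integrable Q (indicator (\<Omega> M) :: _ \<Rightarrow> real)"
        by (rule integrable_bounded[where b=1]) (auto simp: Q.finite_measure_axioms split: split_indicator)
      then show "integrable Q (\<lambda>z. D * indicator (\<Omega> M) z)" by simp
    qed (use D b i in \<open>auto simp: \<Omega>_def split: split_indicator\<close>)
    also have "\<dots> = (\<integral>z. U (fst z) \<partial>Q) + (\<integral>z. V (snd z) \<partial>Q)"
      using i by simp
    also have "(\<integral>z. U (fst z) \<partial>Q) = (\<integral>\<omega>. U \<omega> \<partial>\<mu>)"
      by (subst \<mu>, subst integral_distr) auto
    also have "(\<integral>z. V (snd z) \<partial>Q) = (\<integral>\<omega>. V \<omega> \<partial>\<nu>)"
      by (subst \<nu>, subst integral_distr) auto
    finally show "D * measure Q (\<Omega> M) \<le> (\<integral>\<omega>. U \<omega> \<partial>\<mu>) + (\<integral>\<omega>. V \<omega> \<partial>\<nu>)" .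
  qed
  with M show ?thesis by blast
qed

context markov_kernel
begin

lemma measure_PL_UNIV [simp]: "measure (PL x) UNIV = 1"
  using PL.prob_space[of x] by simp

text \<open>
  The function \<open>P\<^sup>n u\<close>, as an expectation along the chain (see \<open>mean_eq_kernel_power\<close>).
\<close>

definition mean :: "('a \<Rightarrow> real) \<Rightarrow> nat \<Rightarrow> 'a \<Rightarrow> real" where
  "mean u n x = (\<integral>\<omega>. u (\<omega> n) \<partial>PL x)"

lemma mean_eq_kernel_power:
  assumes "u \<in> borel_measurable borel"
  shows "mean u n x = (\<integral>y. u y \<partial>kernel_power P n x)"
  unfolding mean_def distr_coordinate[symmetric]
  by (rule integral_distr[OF measurable_coordinate assms, symmetric])

lemma measurable_integral_PL:
  fixes F :: "(nat \<Rightarrow> 'a) \<Rightarrow> real"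
  assumes "F \<in> borel_measurable path_space"
  shows "(\<lambda>x. \<integral>\<omega>. F \<omega> \<partial>PL x) \<in> borel_measurable borel"
  by (rule measurable_compose[OF PL_measurable_subprob integral_measurable_subprob_algebra[OF assms]])

lemma measurable_mean [measurable]:
  assumes [measurable]: "u \<in> borel_measurable borel"
  shows "mean u n \<in> borel_measurable borel"
proof -
  have "(\<lambda>x. \<integral>\<omega>. u (\<omega> n) \<partial>PL x) \<in> borel_measurable borel"
    by (rule measurable_integral_PL) measurable
  then show ?thesis
    unfolding mean_def[abs_def] .
qed

lemma abs_mean_le:
  assumes [measurable]: "u \<in> borel_measurable borel" and "\<And>x. \<bar>u x\<bar> \<le> b"
  shows "\<bar>mean u n x\<bar> \<le> b"
  unfolding mean_def using assms(2) by (intro abs_integral_le prob_space_PL) auto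

lemma integral_shift:
  fixes F :: "(nat \<Rightarrow> 'a) \<Rightarrow> real"
  assumes F [measurable]: "F \<in> borel_measurable path_space" and b: "\<And>\<omega>. \<bar>F \<omega>\<bar> \<le> b"
  shows "(\<integral>\<omega>. F (\<lambda>i. \<omega> (m + i)) \<partial>PL x) = (\<integral>\<omega>. \<integral>\<omega>'. F \<omega>' \<partial>PL (\<omega> m) \<partial>PL x)"
proof -
  have shift: "(\<lambda>\<omega> i. \<omega> (m + i)) \<in> PL x \<rightarrow>\<^sub>M path_space"
    by (simp add: measurable_cong_sets[OF sets_PL refl] measurable_shift)
  have "(\<integral>\<omega>. F (\<lambda>i. \<omega> (m + i)) \<partial>PL x) = (\<integral>\<omega>. F \<omega> \<partial>distr (PL x) path_space (\<lambda>\<omega> i. \<omega> (m + i)))"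
    by (rule integral_distr[OF shift F, symmetric])
  also have "\<dots> = (\<integral>y. \<integral>\<omega>'. F \<omega>' \<partial>PL y \<partial>distr (PL x) borel (\<lambda>\<omega>. \<omega> m))"
    unfolding distr_shift_PL using b
    by (intro integral_bind_bounded[where K=path_space and b=b] PL.prob_space_distr measurable_coordinate) auto
  also have "\<dots> = (\<integral>\<omega>. \<integral>\<omega>'. F \<omega>' \<partial>PL (\<omega> m) \<partial>PL x)"
    by (rule integral_distr[OF measurable_coordinate measurable_integral_PL[OF F]])
  finally show ?thesis .
qed

lemma mean_add:
  assumes [measurable]: "u \<in> borel_measurable borel" and "\<And>x. \<bar>u x\<bar> \<le> b"
  shows "mean u (n + m) x = (\<integral>\<omega>. mean u n (\<omega> m) \<partial>PL x)"
  using integral_shift[of "\<lambda>\<omega>. u (\<omega> n)" b, where m=m and x=x] assms(2) by (simp add: mean_def add.commute)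

end

locale stationary_chain = markov_kernel +
  fixes lam :: "'a measure"
  assumes invariant: "invariant_prob P lam"
begin

text \<open>
  The law of the stationary chain.
\<close>

definition Plam :: "(nat \<Rightarrow> 'a) measure" where
  "Plam = lam \<bind> PL"

lemma sets_lam [simp, measurable_cong]: "sets lam = sets borel"
  using invariant by (simp add: invariant_prob_def)

lemma space_lam [simp]: "space lam = UNIV"
  using sets_eq_imp_space_eq[OF sets_lam] by simp

lemma lam_invariant: "lam \<bind> P = lam"
  using invariant by (simp add: invariant_prob_def)

sublocale lam: prob_space lam
  using invariant by (simp add: invariant_prob_def)

lemma kernel_lam: "PL \<in> lam \<rightarrow>\<^sub>M subprob_algebra path_space"
  by (simp add: measurable_cong_sets[OF sets_lam refl])

lemma sets_Plam [simp, measurable_cong]: "sets Plam = sets path_space"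
  unfolding Plam_def by (rule sets_bind[where N=path_space]) auto

lemma space_Plam [simp]: "space Plam = UNIV"
  using sets_eq_imp_space_eq[OF sets_Plam] by simp

sublocale Plam: prob_space Plam
  unfolding Plam_def
  by (rule lam.prob_space_bind[OF _ kernel_lam]) (simp add: prob_space_PL)

lemma measure_lam_UNIV [simp]: "measure lam UNIV = 1"
  using lam.prob_space by simp

lemma measure_Plam_UNIV [simp]: "measure Plam UNIV = 1"
  using Plam.prob_space by simp

lemma integral_Plam:
  fixes F :: "(nat \<Rightarrow> 'a) \<Rightarrow> real"
  assumes "F \<in> borel_measurable path_space" "\<And>\<omega>. \<bar>F \<omega>\<bar> \<le> b"
  shows "(\<integral>\<omega>. F \<omega> \<partial>Plam) = (\<integral>x. \<integral>\<omega>. F \<omega> \<partial>PL x \<partial>lam)"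
  unfolding Plam_def
  by (rule integral_bind_bounded[OF assms kernel_lam lam.prob_space_axioms])

lemma AE_Plam:
  assumes "Measurable.pred path_space Q"
  shows "(AE \<omega> in Plam. Q \<omega>) \<longleftrightarrow> (AE x in lam. AE \<omega> in PL x. Q \<omega>)"
  unfolding Plam_def by (rule AE_bind[OF kernel_lam assms])

lemma lam_kernel_power: "lam \<bind> kernel_power P n = lam"
proof (induction n)
  case 0
  have "kernel_power P 0 = return borel"
    by auto
  then show ?case by (simp add: bind_return'')
next
  case (Suc n)
  have k: "kernel_power P n \<in> lam \<rightarrow>\<^sub>M subprob_algebra borel"
    unfolding measurable_cong_sets[OF sets_lam refl] distr_coordinate[symmetric]
    by (rule measurable_compose[OF PL_measurable_subprob measurable_distr]) simp
  have "lam \<bind> kernel_power P (Suc n) = lam \<bind> (\<lambda>x. kernel_power P n x \<bind> P)"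
    by (intro arg_cong[where f="\<lambda>K. lam \<bind> K"]) auto
  also have "\<dots> = (lam \<bind> kernel_power P n) \<bind> P"
    by (rule bind_assoc[OF k kernel_subprob_algebra, symmetric])
  finally show ?case
    unfolding Suc.IH lam_invariant .
qed

lemma distr_coordinate_Plam: "distr Plam borel (\<lambda>\<omega>. \<omega> n) = lam"
proof -
  have "distr Plam borel (\<lambda>\<omega>. \<omega> n) = lam \<bind> (\<lambda>x. distr (PL x) borel (\<lambda>\<omega>. \<omega> n))"
    unfolding Plam_def by (rule distr_bind[OF kernel_lam]) simp_all
  then show ?thesis
    by (simp add: distr_coordinate lam_kernel_power)
qed

lemma distr_shift_Plam: "distr Plam path_space (\<lambda>\<omega> i. \<omega> (n + i)) = Plam"
proof -
  have c: "(\<lambda>x. distr (PL x) borel (\<lambda>\<omega>. \<omega> n)) \<in> lam \<rightarrow>\<^sub>M subprob_algebra borel"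
    unfolding measurable_cong_sets[OF sets_lam refl]
    by (rule measurable_compose[OF PL_measurable_subprob measurable_distr]) simp
  have "distr Plam path_space (\<lambda>\<omega> i. \<omega> (n + i)) =
      lam \<bind> (\<lambda>x. distr (PL x) path_space (\<lambda>\<omega> i. \<omega> (n + i)))"
    unfolding Plam_def by (rule distr_bind[OF kernel_lam _ measurable_shift]) simp
  also have "\<dots> = (lam \<bind> (\<lambda>x. distr (PL x) borel (\<lambda>\<omega>. \<omega> n))) \<bind> PL"
    unfolding distr_shift_PL by (rule bind_assoc[OF c PL_measurable_subprob, symmetric])
  also have "\<dots> = Plam"
    by (simp add: distr_coordinate lam_kernel_power Plam_def)
  finally show ?thesis .
qed

lemma integral_coordinate_Plam:
  fixes u :: "'a \<Rightarrow> real"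
  assumes "u \<in> borel_measurable borel"
  shows "(\<integral>\<omega>. u (\<omega> n) \<partial>Plam) = (\<integral>x. u x \<partial>lam)"
  by (subst (2) distr_coordinate_Plam[symmetric, of n], subst integral_distr[OF _ assms]) simp_all

lemma integral_mean:
  assumes u [measurable]: "u \<in> borel_measurable borel" and b: "\<And>x. \<bar>u x\<bar> \<le> b"
  shows "(\<integral>x. mean u n x \<partial>lam) = (\<integral>x. u x \<partial>lam)"
  unfolding mean_def using integral_Plam[of "\<lambda>\<omega>. u (\<omega> n)" b] b integral_coordinate_Plam[OF u] by simp

text \<open>
  By stationarity it suffices to take \<open>n = 0\<close>, where \<open>X\<^sub>0\<close> is a constant under each \<open>P\<^sup>x\<close>.
\<close>

lemma correlation:
  assumes u [measurable]: "u \<in> borel_measurable borel" "v \<in> borel_measurable borel"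
    and b: "\<And>x. \<bar>u x\<bar> \<le> 1" "\<And>x. \<bar>v x\<bar> \<le> 1"
  shows "(\<integral>\<omega>. v (\<omega> n) * u (\<omega> (n + k)) \<partial>Plam) = (\<integral>x. v x * mean u k x \<partial>lam)"
proof -
  have prod: "\<bar>v x * u y\<bar> \<le> 1" for x y
    using b(2)[of x] b(1)[of y] by (simp add: abs_mult mult_le_one)
  have shift: "(\<lambda>\<omega> i. \<omega> (n + i)) \<in> Plam \<rightarrow>\<^sub>M path_space"
    by (simp add: measurable_cong_sets[OF sets_Plam refl] measurable_shift)
  have F: "(\<lambda>\<omega>. v (\<omega> 0) * u (\<omega> k)) \<in> borel_measurable path_space"
    by measurable
  have "(\<integral>\<omega>. v (\<omega> n) * u (\<omega> (n + k)) \<partial>Plam) =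
      (\<integral>\<omega>. v (\<omega> 0) * u (\<omega> k) \<partial>distr Plam path_space (\<lambda>\<omega> i. \<omega> (n + i)))"
    by (subst integral_distr[OF shift F]) simp
  also have "\<dots> = (\<integral>x. \<integral>\<omega>. v (\<omega> 0) * u (\<omega> k) \<partial>PL x \<partial>lam)"
    unfolding distr_shift_Plam by (rule integral_Plam[OF F prod])
  also have "\<dots> = (\<integral>x. v x * mean u k x \<partial>lam)"
  proof (rule Bochner_Integration.integral_cong[OF refl])
    fix x
    have "(\<integral>\<omega>. v (\<omega> 0) * u (\<omega> k) \<partial>PL x) = (\<integral>\<omega>. v x * u (\<omega> k) \<partial>PL x)"
      using AE_PL_start[of x] by (intro integral_cong_AE) auto
    then show "(\<integral>\<omega>. v (\<omega> 0) * u (\<omega> k) \<partial>PL x) = v x * mean u k x"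
      by (simp add: mean_def)
  qed
  finally show ?thesis .
qed

definition energy :: "('a \<Rightarrow> real) \<Rightarrow> nat \<Rightarrow> real" where
  "energy u n = (\<integral>x. (mean u n x)\<^sup>2 \<partial>lam)"

text \<open>
  Given \<open>X\<^sub>0\<close>, the variable \<open>(P\<^sup>n u)(X\<^sub>m)\<close> has mean \<open>(P\<^sup>n\<^sup>+\<^sup>m u)(X\<^sub>0)\<close>. So the left side is a conditional
  variance. Once the energy has nearly reached its limit, \<open>(P\<^sup>n u)(X\<^sub>m)\<close> is nearly determined by
  \<open>X\<^sub>0\<close>, uniformly in \<open>m\<close>.
\<close>

lemma energy_drop:
  assumes u [measurable]: "u \<in> borel_measurable borel" and b: "\<And>x. \<bar>u x\<bar> \<le> 1"
  shows "(\<integral>\<omega>. (mean u n (\<omega> m) - mean u (n + m) (\<omega> 0))\<^sup>2 \<partial>Plam) = energy u n - energy u (n + m)"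
proof -
  note mb = abs_mean_le[OF u b]
  have sq: "\<bar>(mean u n x)\<^sup>2\<bar> \<le> 1" for n x
    using mb[of n x] by (simp add: abs_square_le_1)
  have prod: "\<bar>mean u n x * mean u k y\<bar> \<le> 1" for n x k y
    using mb[of n x] mb[of k y] by (simp add: abs_mult mult_le_one)
  have eq: "mean (mean u n) m x = mean u (n + m) x" for x
    unfolding mean_add[OF u b] by (simp add: mean_def[of "mean u n"])
  have i: "integrable Plam (\<lambda>\<omega>. (mean u k (\<omega> j))\<^sup>2)"
    "integrable Plam (\<lambda>\<omega>. mean u k (\<omega> j) * mean u k' (\<omega> j'))" for k j k' j'
    using sq prod by (auto intro!: integrable_bounded[where b=1] Plam.finite_measure_axioms)
  have "(\<integral>\<omega>. (mean u n (\<omega> m) - mean u (n + m) (\<omega> 0))\<^sup>2 \<partial>Plam) =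
      (\<integral>\<omega>. (mean u n (\<omega> m))\<^sup>2 + (mean u (n + m) (\<omega> 0))\<^sup>2
         - 2 * (mean u (n + m) (\<omega> 0) * mean u n (\<omega> m)) \<partial>Plam)"
    by (simp add: power2_diff mult_ac)
  also have "\<dots> = (\<integral>\<omega>. (mean u n (\<omega> m))\<^sup>2 \<partial>Plam) + (\<integral>\<omega>. (mean u (n + m) (\<omega> 0))\<^sup>2 \<partial>Plam)
      - 2 * (\<integral>\<omega>. mean u (n + m) (\<omega> 0) * mean u n (\<omega> m) \<partial>Plam)"
    using i by simp
  also have "(\<integral>\<omega>. (mean u n (\<omega> m))\<^sup>2 \<partial>Plam) = energy u n"
    unfolding energy_def by (rule integral_coordinate_Plam) simp
  also have "(\<integral>\<omega>. (mean u (n + m) (\<omega> 0))\<^sup>2 \<partial>Plam) = energy u (n + m)"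
    unfolding energy_def by (rule integral_coordinate_Plam) simp
  also have "(\<integral>\<omega>. mean u (n + m) (\<omega> 0) * mean u n (\<omega> m) \<partial>Plam) = energy u (n + m)"
    using correlation[of "mean u n" "mean u (n + m)" 0 m] mb
    by (simp add: eq energy_def power2_eq_square)
  finally show ?thesis by simp
qed

end

section \<open>Approximation in mean\<close>

text \<open>
  The Borel-Cantelli argument in the form used below: \<open>\<Sum>\<^sub>k u\<^sub>k\<close> has finite integral.
\<close>

lemma AE_tendsto_0_geometric:
  fixes u :: "nat \<Rightarrow> 'b \<Rightarrow> real"
  assumes int: "\<And>k. integrable M (u k)" and nonneg: "\<And>k x. 0 \<le> u k x"
    and bound: "\<And>k. (\<integral>x. u k x \<partial>M) \<le> c * (1/2)^k"
  shows "AE x in M. (\<lambda>k. u k x) \<longlonglongrightarrow> 0"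
proof -
  note [measurable] = borel_measurable_integrable[OF int]
  have c: "0 \<le> c"
    using order_trans[OF Bochner_Integration.integral_nonneg bound[of 0]] nonneg by simp
  have geo: "summable (\<lambda>k. c * (1/2::real)^k)"
    by (intro summable_mult) simp
  have "(\<integral>\<^sup>+x. (\<Sum>k. ennreal (u k x)) \<partial>M) = (\<Sum>k. \<integral>\<^sup>+x. ennreal (u k x) \<partial>M)"
    by (rule nn_integral_suminf) measurable
  also have "\<dots> = (\<Sum>k. ennreal (\<integral>x. u k x \<partial>M))"
    by (simp add: nn_integral_eq_integral int nonneg)
  also have "\<dots> \<le> (\<Sum>k. ennreal (c * (1/2)^k))"
    by (intro suminf_le ennreal_leI bound) auto
  also have "\<dots> = ennreal (\<Sum>k. c * (1/2)^k)"
    using c geo by (intro suminf_ennreal2) auto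
  also have "\<dots> < top"
    by simp
  finally have "(\<integral>\<^sup>+x. (\<Sum>k. ennreal (u k x)) \<partial>M) \<noteq> \<infinity>"
    by simp
  then have "AE x in M. (\<Sum>k. ennreal (u k x)) \<noteq> \<infinity>"
    by (intro nn_integral_noteq_infinite) measurable
  then show ?thesis
    by eventually_elim (intro summable_LIMSEQ_zero summable_suminf_not_top, auto simp: nonneg)
qed

text \<open>
  Used twice: for Lipschitz functions on the state space, and for functions of finitely
  many coordinates on path space.
\<close>

definition L1_approximable :: "'b measure \<Rightarrow> (('b \<Rightarrow> real) \<Rightarrow> bool) \<Rightarrow> ('b \<Rightarrow> real) \<Rightarrow> bool" where
  "L1_approximable M G f \<longleftrightarrow> (\<forall>e>0. \<exists>g. G g \<and> (\<integral>x. \<bar>f x - g x\<bar> \<partial>M) < e)"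

locale L1_approximation = finite_measure M for M :: "'b measure" +
  fixes G :: "('b \<Rightarrow> real) \<Rightarrow> bool"
  assumes integrable_G: "G g \<Longrightarrow> integrable M g"
    and const_G: "G (\<lambda>_. c)"
    and add_G: "G g \<Longrightarrow> G h \<Longrightarrow> G (\<lambda>x. g x + h x)"
    and cmult_G: "G g \<Longrightarrow> G (\<lambda>x. c * g x)"
begin

lemma approximable_G: "G g \<Longrightarrow> L1_approximable M G g"
  unfolding L1_approximable_def by (auto intro: exI[of _ g])

lemma approximable_add:
  assumes "L1_approximable M G f" "L1_approximable M G f'" "integrable M f" "integrable M f'"
  shows "L1_approximable M G (\<lambda>x. f x + f' x)"
  unfolding L1_approximable_def
proof (intro allI impI)
  fix e :: real assume "e > 0"
  then have e2: "e / 2 > 0" by simp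
  obtain g where g: "G g" "(\<integral>x. \<bar>f x - g x\<bar> \<partial>M) < e / 2"
    using assms(1) e2 unfolding L1_approximable_def by blast
  obtain g' where g': "G g'" "(\<integral>x. \<bar>f' x - g' x\<bar> \<partial>M) < e / 2"
    using assms(2) e2 unfolding L1_approximable_def by blast
  note i = integrable_G[OF g(1)] integrable_G[OF g'(1)]
  have "(\<integral>x. \<bar>f x + f' x - (g x + g' x)\<bar> \<partial>M) \<le> (\<integral>x. \<bar>f x - g x\<bar> + \<bar>f' x - g' x\<bar> \<partial>M)"
    using i assms(3,4) by (intro integral_mono) auto
  also have "\<dots> < e"
    using i assms(3,4) g(2) g'(2) by simp
  finally show "\<exists>g. G g \<and> (\<integral>x. \<bar>f x + f' x - g x\<bar> \<partial>M) < e"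
    using add_G[OF g(1) g'(1)] by blast
qed

lemma approximable_cmult:
  assumes "L1_approximable M G f"
  shows "L1_approximable M G (\<lambda>x. c * f x)"
  unfolding L1_approximable_def
proof (intro allI impI)
  fix e :: real assume "e > 0"
  then have e2: "e / (\<bar>c\<bar> + 1) > 0" by simp
  obtain g where g: "G g" "(\<integral>x. \<bar>f x - g x\<bar> \<partial>M) < e / (\<bar>c\<bar> + 1)"
    using assms(1) e2 unfolding L1_approximable_def by blast
  have "(\<integral>x. \<bar>c * f x - c * g x\<bar> \<partial>M) = \<bar>c\<bar> * (\<integral>x. \<bar>f x - g x\<bar> \<partial>M)"
    by (simp add: abs_mult flip: right_diff_distrib)
  also have "\<dots> \<le> (\<bar>c\<bar> + 1) * (\<integral>x. \<bar>f x - g x\<bar> \<partial>M)"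
    by (intro mult_right_mono) auto
  also have "\<dots> < e"
    using g(2) by (simp add: field_simps)
  finally show "\<exists>g. G g \<and> (\<integral>x. \<bar>c * f x - g x\<bar> \<partial>M) < e"
    using cmult_G[OF g(1)] by blast
qed

lemma approximable_limit:
  assumes s: "\<And>i. L1_approximable M G (s i)" "\<And>i. integrable M (s i)" and f: "integrable M f"
    and lim: "\<And>x. x \<in> space M \<Longrightarrow> (\<lambda>i. s i x) \<longlonglongrightarrow> f x"
    and dom: "\<And>i x. x \<in> space M \<Longrightarrow> \<bar>s i x\<bar> \<le> w x" "integrable M w"
  shows "L1_approximable M G f"
  unfolding L1_approximable_def
proof (intro allI impI)
  fix e :: real assume "e > 0"
  then have e2: "e / 2 > 0" by simp
  note [measurable] = borel_measurable_integrable[OF f] borel_measurable_integrable[OF s(2)]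
  have "(\<lambda>i. \<integral>x. \<bar>f x - s i x\<bar> \<partial>M) \<longlonglongrightarrow> (\<integral>x. 0 \<partial>M)"
  proof (rule integral_dominated_convergence[where w="\<lambda>x. \<bar>f x\<bar> + w x"])
    show "AE x in M. (\<lambda>i. \<bar>f x - s i x\<bar>) \<longlonglongrightarrow> 0"
    proof (rule AE_I2)
      fix x assume "x \<in> space M"
      then show "(\<lambda>i. \<bar>f x - s i x\<bar>) \<longlonglongrightarrow> 0"
        using tendsto_rabs[OF tendsto_diff[OF tendsto_const[of "f x"] lim[of x]]] by simp
    qed
    show "AE x in M. norm \<bar>f x - s i x\<bar> \<le> \<bar>f x\<bar> + w x" for i
    proof (rule AE_I2)
      fix x assume "x \<in> space M"
      then show "norm \<bar>f x - s i x\<bar> \<le> \<bar>f x\<bar> + w x"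
        using dom(1)[of x i] by simp
    qed
  qed (use f dom in auto)
  then have "\<forall>\<^sub>F i in sequentially. (\<integral>x. \<bar>f x - s i x\<bar> \<partial>M) < e / 2"
    using e2 by (intro order_tendstoD(2)) auto
  then obtain i where i: "(\<integral>x. \<bar>f x - s i x\<bar> \<partial>M) < e / 2"
    by (auto simp: eventually_sequentially)
  obtain g where g: "G g" "(\<integral>x. \<bar>s i x - g x\<bar> \<partial>M) < e / 2"
    using s(1)[of i] e2 unfolding L1_approximable_def by blast
  note ig = integrable_G[OF g(1)]
  have "(\<integral>x. \<bar>f x - g x\<bar> \<partial>M) \<le> (\<integral>x. \<bar>f x - s i x\<bar> + \<bar>s i x - g x\<bar> \<partial>M)"
    using f s(2) ig by (intro integral_mono) auto
  also have "\<dots> < e"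
    using f s(2) ig i g(2) by simp
  finally show "\<exists>g. G g \<and> (\<integral>x. \<bar>f x - g x\<bar> \<partial>M) < e"
    using g(1) by blast
qed

lemma integrable_indicator_set: "A \<in> sets M \<Longrightarrow> integrable M (indicator A :: 'b \<Rightarrow> real)"
  by (intro integrable_bounded[where b=1] finite_measure_axioms) (auto split: split_indicator)

text \<open>
  The sets with approximable indicator form a Dynkin system; simple functions follow by linearity,
  and integrable functions by dominated convergence.
\<close>

theorem approximable_integrable:
  assumes gen: "sets M = sigma_sets (space M) C" "Int_stable C" "C \<subseteq> Pow (space M)"
    and C: "\<And>A. A \<in> C \<Longrightarrow> L1_approximable M G (indicator A)"
    and "integrable M f"
  shows "L1_approximable M G f"
proof -
  have sets: "L1_approximable M G (indicator A)" if "A \<in> sets M" for A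
  proof -
    have "A \<in> sigma_sets (space M) C"
      using that by (simp add: gen(1))
    with gen(2,3) show ?thesis
    proof (induction rule: sigma_sets_induct_disjoint[consumes 3, case_names basic empty compl union])
      case (basic A)
      then show ?case by (rule C)
    next
      case empty
      have "indicator {} = (\<lambda>x. 0 :: real)" by auto
      then show ?case using approximable_G[OF const_G[of 0]] by simp
    next
      case (compl A)
      then have A: "A \<in> sets M"
        by (simp add: gen(1))
      have "L1_approximable M G (\<lambda>x. 1 + (-1) * indicator A x)"
        using integrable_indicator_set[OF A]
        by (intro approximable_add approximable_cmult approximable_G[OF const_G] compl(2)) auto
      then show ?case
      proof (rule approximable_limit[where s="\<lambda>_. \<lambda>x. 1 + (-1) * indicator A x" and w="\<lambda>_. 1"])
        show "integrable M (\<lambda>x. 1 + - 1 * indicator A x :: real)"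
          using integrable_indicator_set[OF A] by auto
        show "integrable M (indicator (space M - A) :: 'b \<Rightarrow> real)"
          using A by (intro integrable_indicator_set) auto
      qed (auto split: split_indicator)
    next
      case (union A)
      then have A: "A i \<in> sets M" for i
        by (auto simp: gen(1))
      have fin: "L1_approximable M G (indicator (\<Union>i<n. A i))" for n
      proof (induction n)
        case 0
        have "indicator (\<Union>i<0. A i) = (\<lambda>x. 0 :: real)" by auto
        then show ?case using approximable_G[OF const_G[of 0]] by (simp only:)
      next
        case (Suc n)
        have eq: "indicator (\<Union>i<Suc n. A i) = (\<lambda>x. indicator (\<Union>i<n. A i) x + (indicator (A n) x :: real))"
        proof
          fix x
          have "x \<notin> A n" if "i < n" "x \<in> A i" for i
            using disjoint_family_onD[OF union(1), of i n] that by auto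
          then show "indicator (\<Union>i<Suc n. A i) x = indicator (\<Union>i<n. A i) x + (indicator (A n) x :: real)"
            by (auto simp: lessThan_Suc split: split_indicator)
        qed
        have "(\<Union>i<n. A i) \<in> sets M"
          using A by auto
        then show ?case
          unfolding eq using Suc union(3) A by (intro approximable_add integrable_indicator_set) auto
      qed
      show ?case
      proof (rule approximable_limit[of "\<lambda>n. indicator (\<Union>i<n. A i)" _ "\<lambda>_. 1"])
        show "integrable M (indicator (\<Union>i<n. A i) :: 'b \<Rightarrow> real)" for n
          using A by (intro integrable_indicator_set sets.finite_UN) auto
        show "integrable M (indicator (\<Union>i. A i) :: 'b \<Rightarrow> real)"
          using A by (intro integrable_indicator_set sets.countable_UN) auto
        show "L1_approximable M G (indicator (\<Union>i<n. A i))" for n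
          by (rule fin)
        show "(\<lambda>n. indicator (\<Union>i<n. A i) x :: real) \<longlonglongrightarrow> indicator (\<Union>i. A i) x" for x
          by (rule LIMSEQ_indicator_UN)
      qed (auto split: split_indicator)
    qed
  qed
  show ?thesis
    using assms(5)
  proof induction
    case (base A c)
    have "L1_approximable M G (\<lambda>x. c * indicator A x)"
      by (intro approximable_cmult sets base)
    then show ?case by (simp add: mult.commute)
  next
    case (add f g)
    then show ?case by (intro approximable_add)
  next
    case (lim f s)
    then show ?case
      by (intro approximable_limit[of s f "\<lambda>x. 2 * \<bar>f x\<bar>"]) auto
  qed
qed

end

definition bounded_lipschitz :: "('a :: metric_space \<Rightarrow> real) \<Rightarrow> bool" where
  "bounded_lipschitz g \<longleftrightarrow> (\<exists>L. L-lipschitz_on UNIV g) \<and> (\<exists>b. \<forall>x. \<bar>g x\<bar> \<le> b)"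

lemma bounded_lipschitzI: "L-lipschitz_on UNIV g \<Longrightarrow> (\<And>x. \<bar>g x\<bar> \<le> b) \<Longrightarrow> bounded_lipschitz g"
  unfolding bounded_lipschitz_def by blast

lemma bounded_lipschitz_const: "bounded_lipschitz (\<lambda>_. c)"
  by (rule bounded_lipschitzI[OF lipschitz_on_constant, of _ "\<bar>c\<bar>"]) simp

lemma bounded_lipschitz_add:
  assumes "bounded_lipschitz g" "bounded_lipschitz h"
  shows "bounded_lipschitz (\<lambda>x. g x + h x)"
proof -
  obtain L b L' b' where *: "L-lipschitz_on UNIV g" "\<And>x. \<bar>g x\<bar> \<le> b" "L'-lipschitz_on UNIV h" "\<And>x. \<bar>h x\<bar> \<le> b'"
    using assms unfolding bounded_lipschitz_def by blast
  have "\<bar>g x + h x\<bar> \<le> b + b'" for x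
    using *(2)[of x] *(4)[of x] by linarith
  then show ?thesis
    by (rule bounded_lipschitzI[OF lipschitz_on_add[OF *(1,3)]])
qed

lemma bounded_lipschitz_cmult:
  assumes "bounded_lipschitz g"
  shows "bounded_lipschitz (\<lambda>x. c * g x)"
proof -
  obtain L b where *: "L-lipschitz_on UNIV g" "\<And>x. \<bar>g x\<bar> \<le> b"
    using assms unfolding bounded_lipschitz_def by blast
  have "\<bar>c * g x\<bar> \<le> \<bar>c\<bar> * b" for x
    using *(2)[of x] by (simp add: abs_mult mult_left_mono)
  then show ?thesis
    by (rule bounded_lipschitzI[OF lipschitz_on_cmult_real[OF *(1)]])
qed

lemma lipschitz_borel_measurable:
  assumes "L-lipschitz_on UNIV (g :: 'a :: metric_space \<Rightarrow> real)"
  shows "g \<in> borel_measurable borel"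
  using lipschitz_on_continuous_on[OF assms] by (rule borel_measurable_continuous_onI)

lemma bounded_lipschitz_measurable:
  "bounded_lipschitz g \<Longrightarrow> g \<in> borel_measurable borel"
  by (auto simp: bounded_lipschitz_def intro: lipschitz_borel_measurable)

lemma bounded_lipschitz_infdist_bump: "bounded_lipschitz (\<lambda>x. max 0 (1 - c * infdist x S))"
  if "0 \<le> c" for c :: real and S :: "'a :: metric_space set"
proof (rule bounded_lipschitzI)
  show "c-lipschitz_on UNIV (\<lambda>x. max 0 (1 - c * infdist x S))"
  proof (rule lipschitz_onI)
    fix x y
    have "\<bar>max 0 (1 - c * infdist x S) - max 0 (1 - c * infdist y S)\<bar> \<le> \<bar>c * infdist x S - c * infdist y S\<bar>"
      by linarith
    also have "\<dots> = c * \<bar>infdist x S - infdist y S\<bar>"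
      using that by (simp add: abs_mult flip: right_diff_distrib)
    also have "\<dots> \<le> c * dist x y"
      by (intro mult_left_mono infdist_triangle_abs that)
    finally show "dist (max 0 (1 - c * infdist x S)) (max 0 (1 - c * infdist y S)) \<le> c * dist x y"
      by (simp add: dist_real_def)
  qed (rule that)
  show "\<bar>max 0 (1 - c * infdist x S)\<bar> \<le> 1" for x
    using mult_nonneg_nonneg[OF that infdist_nonneg, of x S] by simp
qed

text \<open>
  The indicator of a closed set is the limit of the bumps \<open>max 0 (1 - i d(x, S))\<close>.
\<close>

theorem bounded_lipschitz_dense:
  fixes M :: "'a :: metric_space measure"
  assumes "finite_measure M" and sets_M: "sets M = sets borel" and f: "integrable M f"
  shows "L1_approximable M bounded_lipschitz f"
proof -
  interpret finite_measure M by fact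
  interpret L1_approximation M bounded_lipschitz
  proof unfold_locales
    show "integrable M g" if "bounded_lipschitz g" for g
      using that bounded_lipschitz_measurable[OF that]
      by (auto simp: bounded_lipschitz_def measurable_cong_sets[OF sets_M refl] intro: integrable_bounded finite_measure_axioms)
  qed (fact bounded_lipschitz_const bounded_lipschitz_add bounded_lipschitz_cmult)+
  have space: "space M = UNIV"
    using sets_eq_imp_space_eq[OF sets_M] by simp
  show ?thesis
  proof (rule approximable_integrable[where C="Collect closed"])
    show "sets M = sigma_sets (space M) (Collect closed)"
      unfolding sets_M space by (simp add: borel_eq_closed)
    show "Int_stable (Collect closed :: 'a set set)"
      by (auto simp: Int_stable_def)
    fix S :: "'a set" assume "S \<in> Collect closed"
    then have S: "closed S" by simp
    show "L1_approximable M bounded_lipschitz (indicator S)"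
    proof (cases "S = {}")
      case True
      then have "indicator S = (\<lambda>_. 0 :: real)" by auto
      then show ?thesis using approximable_G[OF bounded_lipschitz_const[of 0]] by simp
    next
      case False
      define s where "s i x = max 0 (1 - real i * infdist x S)" for i x
      have lip: "bounded_lipschitz (s i)" for i
        unfolding s_def by (rule bounded_lipschitz_infdist_bump) simp
      have lim: "(\<lambda>i. s i x) \<longlonglongrightarrow> indicator S x" for x
      proof (cases "x \<in> S")
        case True
        then show ?thesis
          by (simp add: s_def)
      next
        case x: False
        then have "infdist x S > 0"
          using in_closed_iff_infdist_zero[OF S False, of x] infdist_nonneg[of x S] by simp
        then obtain n :: nat where n: "1 < real n * infdist x S"
          using ex_less_of_nat_mult by blast
        have "s i x = 0" if "i \<ge> n" for i
        proof -
          have "real n * infdist x S \<le> real i * infdist x S"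
            using that by (intro mult_right_mono infdist_nonneg) auto
          then show ?thesis
            using n by (simp add: s_def)
        qed
        then show ?thesis
          using x by (intro tendsto_eventually) (auto simp: eventually_sequentially)
      qed
      show ?thesis
      proof (rule approximable_limit[of s _ "\<lambda>_. 1"])
        show "integrable M (indicator S :: 'a \<Rightarrow> real)"
          using S by (intro integrable_indicator_set) (simp add: sets_M)
        show "\<bar>s i x\<bar> \<le> 1" for i x
          using mult_nonneg_nonneg[OF of_nat_0_le_iff infdist_nonneg, of i x S] by (simp add: s_def)
      qed (auto intro: lim approximable_G lip integrable_G)
    qed
  qed (use f space in auto)
qed

definition finite_horizon :: "nat \<Rightarrow> ((nat \<Rightarrow> 'a) \<Rightarrow> 'c) \<Rightarrow> bool" where
  "finite_horizon n g \<longleftrightarrow> (\<forall>\<omega> \<omega>'. (\<forall>i\<le>n. \<omega> i = \<omega>' i) \<longrightarrow> g \<omega> = g \<omega>')"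

lemma finite_horizon_mono: "finite_horizon n g \<Longrightarrow> n \<le> m \<Longrightarrow> finite_horizon m g"
  unfolding finite_horizon_def by (meson order_trans)

definition cylinder_function :: "((nat \<Rightarrow> 'a :: polish_space) \<Rightarrow> real) \<Rightarrow> bool" where
  "cylinder_function g \<longleftrightarrow> g \<in> borel_measurable path_space \<and> (\<exists>b. \<forall>\<omega>. \<bar>g \<omega>\<bar> \<le> b) \<and> (\<exists>n. finite_horizon n g)"

lemma cylinder_functionI:
  "g \<in> borel_measurable path_space \<Longrightarrow> (\<And>\<omega>. \<bar>g \<omega>\<bar> \<le> b) \<Longrightarrow> finite_horizon n g \<Longrightarrow> cylinder_function g"
  unfolding cylinder_function_def by blast

text \<open>
  A function \<open>g\<close> of finitely many coordinates that is close in \<open>L\<^sup>1\<close> to the indicator of \<open>B\<close> yields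
  the set \<open>A = {g > 1/2}\<close>, since \<open>\<bar>1\<^sub>B - g\<bar> \<ge> 1/2\<close> on the symmetric difference.
\<close>

lemma cylinder_set_approximation:
  fixes M :: "(nat \<Rightarrow> 'a :: polish_space) measure"
  assumes "prob_space M" and sets_M [measurable_cong]: "sets M = sets path_space"
    and B [measurable]: "B \<in> sets path_space" and "0 < e"
  obtains n A where "A \<in> sets path_space" "finite_horizon n (\<lambda>\<omega>. \<omega> \<in> A)" "measure M (B - A) + measure M (A - B) < e"
proof -
  interpret prob_space M by fact
  have space_M: "space M = UNIV"
    using sets_eq_imp_space_eq[OF sets_M] by simp
  interpret L1_approximation M cylinder_function
  proof unfold_locales
    show "integrable M g" if "cylinder_function g" for g
      using that by (auto simp: cylinder_function_def measurable_cong_sets[OF sets_M refl]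
          intro: integrable_bounded finite_measure_axioms)
    show "cylinder_function (\<lambda>_. c)" for c
      by (rule cylinder_functionI[where b="\<bar>c\<bar>" and n=0]) (auto simp: finite_horizon_def)
    show "cylinder_function (\<lambda>x. g x + h x)" if "cylinder_function g" "cylinder_function h" for g h
    proof -
      obtain b b' n n' where *: "g \<in> borel_measurable path_space" "\<And>\<omega>. \<bar>g \<omega>\<bar> \<le> b" "finite_horizon n g"
        "h \<in> borel_measurable path_space" "\<And>\<omega>. \<bar>h \<omega>\<bar> \<le> b'" "finite_horizon n' h"
        using \<open>cylinder_function g\<close> \<open>cylinder_function h\<close> unfolding cylinder_function_def by blast
      show ?thesis
      proof (rule cylinder_functionI[where b="b + b'" and n="max n n'"])
        show "\<bar>g \<omega> + h \<omega>\<bar> \<le> b + b'" for \<omega>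
          using *(2)[of \<omega>] *(5)[of \<omega>] by linarith
        show "finite_horizon (max n n') (\<lambda>\<omega>. g \<omega> + h \<omega>)"
          using *(3,6) unfolding finite_horizon_def by (metis max.coboundedI1 max.coboundedI2)
      qed (use * in measurable)
    qed
    show "cylinder_function (\<lambda>x. c * g x)" if "cylinder_function g" for c g
    proof -
      obtain b n where *: "g \<in> borel_measurable path_space" "\<And>\<omega>. \<bar>g \<omega>\<bar> \<le> b" "finite_horizon n g"
        using \<open>cylinder_function g\<close> unfolding cylinder_function_def by blast
      show ?thesis
      proof (rule cylinder_functionI[where b="\<bar>c\<bar> * b" and n=n])
        show "\<bar>c * g \<omega>\<bar> \<le> \<bar>c\<bar> * b" for \<omega>
          using *(2)[of \<omega>] by (simp add: abs_mult mult_left_mono)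
        show "finite_horizon n (\<lambda>\<omega>. c * g \<omega>)"
          using *(3) unfolding finite_horizon_def by metis
      qed (use * in measurable)
    qed
  qed
  have "L1_approximable M cylinder_function (indicator B)"
  proof (rule approximable_integrable[where C="prod_algebra UNIV (\<lambda>_. borel :: 'a measure)"])
    show "sets M = sigma_sets (space M) (prod_algebra UNIV (\<lambda>_. borel))"
      unfolding sets_M space_M by (simp add: sets_PiM PiE_UNIV_domain)
    show "prod_algebra UNIV (\<lambda>_. borel) \<subseteq> Pow (space M)"
      by (simp add: space_M)
    fix S assume "S \<in> prod_algebra (UNIV :: nat set) (\<lambda>_. borel :: 'a measure)"
    from prod_algebraE[OF this] obtain J E where S:
      "S = prod_emb UNIV (\<lambda>_. borel) J (\<Pi>\<^sub>E j\<in>J. E j)" and "finite J"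
      "\<And>i. i \<in> J \<Longrightarrow> E i \<in> sets (borel :: 'a measure)" by metis
    then obtain n :: nat and A where S: "S = {\<omega>. \<forall>i<n. \<omega> i \<in> A i}"
      and [measurable]: "\<And>i. A i \<in> sets (borel :: 'a measure)"
      using prod_emb_as_box[of J E] by blast
    have [measurable]: "S \<in> sets path_space"
      unfolding S by (rule path_Collect) measurable
    show "L1_approximable M cylinder_function (indicator S)"
    proof (intro approximable_G cylinder_functionI[where b=1 and n=n])
      show "finite_horizon n (indicator S :: (nat \<Rightarrow> 'a) \<Rightarrow> real)"
        by (auto simp: finite_horizon_def S indicator_def)
    qed (auto split: split_indicator)
  qed (auto simp: Int_stable_prod_algebra intro!: integrable_indicator_set)
  then obtain g where g: "cylinder_function g" "(\<integral>\<omega>. \<bar>indicator B \<omega> - g \<omega>\<bar> \<partial>M) < e / 2"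
    using \<open>0 < e\<close> unfolding L1_approximable_def by (meson half_gt_zero)
  then obtain n where n: "finite_horizon n g" and [measurable]: "g \<in> borel_measurable path_space"
    unfolding cylinder_function_def by blast
  define A where "A = {\<omega>. g \<omega> > 1/2}"
  have [measurable]: "A \<in> sets path_space"
    unfolding A_def by (rule path_Collect) measurable
  have eq: "measure M (B - A) + measure M (A - B) = (\<integral>\<omega>. indicator (B - A) \<omega> + indicator (A - B) \<omega> \<partial>M)"
    by (subst Bochner_Integration.integral_add) (auto intro!: integrable_indicator_set simp: space_M)
  have le: "\<dots> \<le> (\<integral>\<omega>. 2 * \<bar>indicator B \<omega> - g \<omega>\<bar> \<partial>M)"
  proof (rule integral_mono)
    show "integrable M (\<lambda>\<omega>. indicator (B - A) \<omega> + indicator (A - B) \<omega> :: real)"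
      by (intro Bochner_Integration.integrable_add integrable_indicator_set) measurable
    show "integrable M (\<lambda>\<omega>. 2 * \<bar>indicator B \<omega> - g \<omega>\<bar>)"
      using integrable_G[OF g(1)] integrable_indicator_set[of B] by auto
  qed (auto simp: A_def split: split_indicator)
  show ?thesis
  proof (rule that)
    show "finite_horizon n (\<lambda>\<omega>. \<omega> \<in> A)"
      using n unfolding finite_horizon_def A_def mem_Collect_eq by metis
    show "measure M (B - A) + measure M (A - B) < e"
      using eq le g(2) by simp
  qed fact
qed

section \<open>Convergence in mean square\<close>

context stationary_chain
begin

lemma decseq_energy:
  assumes [measurable]: "u \<in> borel_measurable borel" and "\<And>x. \<bar>u x\<bar> \<le> 1"
  shows "decseq (energy u)"
proof (rule decseq_SucI)
  fix n
  have "0 \<le> (\<integral>\<omega>. (mean u n (\<omega> 1) - mean u (n + 1) (\<omega> 0))\<^sup>2 \<partial>Plam)"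
    by (rule Bochner_Integration.integral_nonneg) simp
  also have "\<dots> = energy u n - energy u (n + 1)"
    by (rule energy_drop[OF assms])
  finally show "energy u (Suc n) \<le> energy u n"
    by simp
qed

text \<open>
  For a centred function, \<open>\<bar>h(x)\<bar> \<le> \<integral> \<bar>h(x) - h(y)\<bar> \<lambda>(dy)\<close>. This is where the mean zero enters.
\<close>

lemma energy_le_spread:
  assumes u [measurable]: "u \<in> borel_measurable borel" and b: "\<And>x. \<bar>u x\<bar> \<le> 1"
    and centered: "(\<integral>x. u x \<partial>lam) = 0"
  shows "energy u n \<le> (\<integral>z. \<bar>mean u n (fst z) - mean u n (snd z)\<bar> \<partial>(lam \<Otimes>\<^sub>M lam))"
proof -
  interpret pair_prob_space lam lam ..
  note mb = abs_mean_le[OF u b]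
  have two: "\<bar>\<bar>mean u n x - mean u n y\<bar>\<bar> \<le> 2" for x y
    using mb[of n x] mb[of n y] by linarith
  have i: "integrable lam (mean u n)"
    using mb by (intro integrable_bounded[where b=1] lam.finite_measure_axioms) auto
  have i2: "integrable lam (\<lambda>y. \<bar>mean u n x - mean u n y\<bar>)" for x
    using two by (intro integrable_bounded[where b=2] lam.finite_measure_axioms) auto
  have i3: "integrable (lam \<Otimes>\<^sub>M lam) (\<lambda>z. \<bar>mean u n (fst z) - mean u n (snd z)\<bar>)"
    using two by (intro integrable_bounded[where b=2] finite_measure_axioms) auto
  have "(mean u n x)\<^sup>2 \<le> (\<integral>y. \<bar>mean u n x - mean u n y\<bar> \<partial>lam)" for x
  proof -
    have "(mean u n x)\<^sup>2 \<le> \<bar>mean u n x\<bar>"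
      using mult_right_mono[OF mb[of n x], of "\<bar>mean u n x\<bar>"] by (simp add: power2_eq_square flip: abs_mult)
    also have "\<bar>mean u n x\<bar> = \<bar>\<integral>y. mean u n x - mean u n y \<partial>lam\<bar>"
      using i integral_mean[OF u b, of n] centered by simp
    also have "\<dots> \<le> (\<integral>y. \<bar>mean u n x - mean u n y\<bar> \<partial>lam)"
      by (rule integral_abs_bound)
    finally show ?thesis .
  qed
  then have "energy u n \<le> (\<integral>x. \<integral>y. \<bar>mean u n x - mean u n y\<bar> \<partial>lam \<partial>lam)"
    unfolding energy_def
  proof (intro integral_mono)
    show "integrable lam (\<lambda>x. (mean u n x)\<^sup>2)"
      using mb by (intro integrable_bounded[where b=1] lam.finite_measure_axioms) (auto simp: abs_square_le_1)
    show "integrable lam (\<lambda>x. \<integral>y. \<bar>mean u n x - mean u n y\<bar> \<partial>lam)"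
      using integrable_fst'[OF i3] by simp
  qed auto
  also have "\<dots> = (\<integral>z. \<bar>mean u n (fst z) - mean u n (snd z)\<bar> \<partial>(lam \<Otimes>\<^sub>M lam))"
    using integral_fst'[OF i3] by simp
  finally show ?thesis .
qed

lemma AE_pair_lam:
  assumes [measurable]: "Measurable.pred borel Q" and "AE x in lam. Q x"
  shows "AE z in lam \<Otimes>\<^sub>M lam. Q (fst z) \<and> Q (snd z)"
proof -
  interpret pair_prob_space lam lam ..
  show ?thesis
  proof (rule AE_pair_measure)
    show "{z \<in> space (lam \<Otimes>\<^sub>M lam). Q (fst z) \<and> Q (snd z)} \<in> sets (lam \<Otimes>\<^sub>M lam)"
      by measurable
    show "AE x in lam. AE y in lam. Q (fst (x, y)) \<and> Q (snd (x, y))"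
      using assms(2) by (auto elim: eventually_mono)
  qed
qed

text \<open>
  Suppose that the energy tends to \<open>c\<close>. The energy drop after time \<open>N k\<close> is at most \<open>4\<^sup>-\<^sup>k\<close>, so
  \<open>P\<^sup>N\<^sup>+\<^sup>m u(X\<^sub>0)\<close> is within \<open>2 \<cdot> 2\<^sup>-\<^sup>k\<close> of \<open>g k (X\<^sub>m)\<close> in mean, where \<open>g k\<close> is Lipschitz. Since no rate
  is known at which the distance of coupled paths vanishes, the comparison is averaged over \<open>T k\<close>
  times: on \<open>\<omega> \<sim>\<^sub>M \<omega>'\<close> the average of \<open>\<bar>g k (\<omega> m) - g k (\<omega>' m)\<bar>\<close> is at most \<open>(M + 1) 2\<^sup>-\<^sup>k\<close>,
  by the arithmetic-geometric mean inequality.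
\<close>

theorem energy_tendsto_0:
  assumes u [measurable]: "u \<in> borel_measurable borel" and b: "\<And>x. \<bar>u x\<bar> \<le> 1"
    and centered: "(\<integral>x. u x \<partial>lam) = 0"
    and overlap: "AE z in lam \<Otimes>\<^sub>M lam. \<exists>M \<delta>. \<delta> > 0 \<and> overlap M \<delta> (PL (fst z)) (PL (snd z))"
  shows "energy u \<longlonglongrightarrow> 0"
proof -
  interpret pair: pair_prob_space lam lam ..
  note mb = abs_mean_le[OF u b]
  have energy_nonneg: "0 \<le> energy u n" for n
    unfolding energy_def by (rule Bochner_Integration.integral_nonneg) simp
  obtain c where c: "energy u \<longlonglongrightarrow> c" and c_le: "\<And>n. c \<le> energy u n"
    using decseq_convergent[OF decseq_energy[OF u b], of 0] energy_nonneg by metis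
  have "\<exists>N g L B. energy u N - c \<le> (1/4)^k \<and> L-lipschitz_on UNIV g \<and> (\<forall>x. \<bar>g x\<bar> \<le> B) \<and>
      (\<integral>x. \<bar>mean u N x - g x\<bar> \<partial>lam) < (1/2)^k" for k
  proof -
    have "\<forall>\<^sub>F n in sequentially. energy u n < c + (1/4)^k"
      by (rule order_tendstoD(2)[OF c]) simp
    then obtain N where N: "energy u N < c + (1/4)^k"
      by (auto simp: eventually_sequentially)
    have "integrable lam (mean u N)"
      using mb by (intro integrable_bounded[where b=1] lam.finite_measure_axioms) auto
    then have "L1_approximable lam bounded_lipschitz (mean u N)"
      by (rule bounded_lipschitz_dense[OF lam.finite_measure_axioms sets_lam])
    moreover have "(0::real) < (1/2)^k" by simp
    ultimately obtain g L B where "L-lipschitz_on UNIV g" "\<forall>x. \<bar>g x\<bar> \<le> B" "(\<integral>x. \<bar>mean u N x - g x\<bar> \<partial>lam) < (1/2)^k"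
      unfolding L1_approximable_def bounded_lipschitz_def by blast
    then show ?thesis
      using N by (intro exI[of _ N] exI[of _ g] exI[of _ L] exI[of _ B]) auto
  qed
  then have "\<forall>k. \<exists>N g L B. energy u N - c \<le> (1/4)^k \<and> L-lipschitz_on UNIV g \<and> (\<forall>x. \<bar>g x\<bar> \<le> B) \<and>
      (\<integral>x. \<bar>mean u N x - g x\<bar> \<partial>lam) < (1/2)^k" by blast
  then have "\<exists>N g L B. \<forall>k. energy u (N k) - c \<le> (1/4)^k \<and> (L k)-lipschitz_on UNIV (g k) \<and>
      (\<forall>x. \<bar>g k x\<bar> \<le> B k) \<and> (\<integral>x. \<bar>mean u (N k) x - g k x\<bar> \<partial>lam) < (1/2)^k"
    by (simp only: choice_iff)
  then obtain N g L B where N: "\<And>k. energy u (N k) - c \<le> (1/4)^k"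
    and g: "\<And>k. (L k)-lipschitz_on UNIV (g k)" "\<And>k x. \<bar>g k x\<bar> \<le> B k"
    and mean_g: "\<And>k. (\<integral>x. \<bar>mean u (N k) x - g k x\<bar> \<partial>lam) < (1/2)^k"
    by blast
  have [measurable]: "g k \<in> borel_measurable borel" for k
    by (rule lipschitz_borel_measurable[OF g(1)])
  have L0: "0 \<le> L k" for k
    by (rule lipschitz_on_nonneg[OF g(1)])
  (* enough times to absorb the Lipschitz constant of g k *)
  define T where "T k = Suc (nat \<lceil>4^k * (L k)\<^sup>2\<rceil>)" for k
  have T: "4^k * (L k)\<^sup>2 \<le> real (T k)" "0 < T k" for k
    unfolding T_def by (linarith, simp)
  define U where "U k x \<omega> = (\<Sum>m<T k. \<bar>mean u (N k + m) x - g k (\<omega> m)\<bar>) / T k"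
    for k x and \<omega> :: "nat \<Rightarrow> 'a"
  have U_meas [measurable]: "U k x \<in> borel_measurable path_space"
    "(\<lambda>\<omega>. U k (\<omega> 0) \<omega>) \<in> borel_measurable path_space" for k x
    unfolding U_def by measurable
  have summand_bound: "\<bar>mean u (N k + m) x - g k y\<bar> \<le> 1 + B k" for k m x y
    using mb[of "N k + m" x] g(2)[of k y] by linarith
  have U_bounds: "0 \<le> U k x \<omega>" "U k x \<omega> \<le> 1 + B k" for k x \<omega>
  proof -
    show "0 \<le> U k x \<omega>"
      unfolding U_def by (intro divide_nonneg_nonneg sum_nonneg) auto
    have "(\<Sum>m<T k. \<bar>mean u (N k + m) x - g k (\<omega> m)\<bar>) \<le> (\<Sum>m<T k. 1 + B k)"
      by (intro sum_mono summand_bound)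
    then show "U k x \<omega> \<le> 1 + B k"
      using T(2)[of k] by (simp add: U_def divide_le_eq mult.commute)
  qed
  (* inserting the coordinate at time 0 for x makes S an integral against the path law, hence measurable *)
  define S where "S k x = (\<integral>\<omega>. U k (\<omega> 0) \<omega> \<partial>PL x)" for k x
  have S: "S k x = (\<integral>\<omega>. U k x \<omega> \<partial>PL x)" for k x
    unfolding S_def using AE_PL_start[of x] by (intro integral_cong_AE) auto
  have S_meas [measurable]: "S k \<in> borel_measurable borel" for k
    unfolding S_def[abs_def] by (rule measurable_integral_PL) measurable
  have S_bounds: "0 \<le> S k x" "S k x \<le> 1 + B k" for k x
  proof -
    show "0 \<le> S k x"
      unfolding S_def by (rule Bochner_Integration.integral_nonneg) (rule U_bounds)
    have "\<bar>S k x\<bar> \<le> 1 + B k"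
      unfolding S_def using U_bounds by (intro abs_integral_le prob_space_PL) auto
    then show "S k x \<le> 1 + B k" by simp
  qed
  have S_small: "(\<integral>x. S k x \<partial>lam) \<le> 2 * (1/2)^k" for k
  proof -
    have single: "(\<integral>\<omega>. \<bar>mean u (N k + m) (\<omega> 0) - g k (\<omega> m)\<bar> \<partial>Plam) \<le> 2 * (1/2)^k" for m
    proof -
      let ?a = "\<lambda>\<omega> :: nat \<Rightarrow> 'a. mean u (N k) (\<omega> m) - mean u (N k + m) (\<omega> 0)"
      have a2: "\<bar>?a \<omega>\<bar> \<le> 2" for \<omega>
        using mb[of "N k" "\<omega> m"] mb[of "N k + m" "\<omega> 0"] by linarith
      have ia: "integrable Plam (\<lambda>\<omega>. \<bar>?a \<omega>\<bar>)"
        using a2 by (intro integrable_bounded[where b=2] Plam.finite_measure_axioms) auto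
      have ia2: "integrable Plam (\<lambda>\<omega>. (?a \<omega>)\<^sup>2)"
        using power_mono[OF a2, where n=2]
        by (intro integrable_bounded[where b=4] Plam.finite_measure_axioms) auto
      have i0: "integrable Plam (\<lambda>\<omega>. \<bar>mean u (N k + m) (\<omega> 0) - g k (\<omega> m)\<bar>)"
        using summand_bound by (intro integrable_bounded[where b="1 + B k"] Plam.finite_measure_axioms) auto
      have i1: "integrable Plam (\<lambda>\<omega>. \<bar>mean u (N k) (\<omega> m) - g k (\<omega> m)\<bar>)"
        using summand_bound[of _ 0] by (intro integrable_bounded[where b="1 + B k"] Plam.finite_measure_axioms) auto
      have am_gm: "\<bar>t\<bar> \<le> (2^k * t\<^sup>2 + (1/2)^k) / 2" for t :: real
      proof -
        have "0 \<le> (1/2)^k * (2^k * \<bar>t\<bar> - 1)\<^sup>2"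
          by simp
        also have "\<dots> = 2^k * t\<^sup>2 - 2 * \<bar>t\<bar> + (1/2)^k"
          by (simp add: power2_eq_square algebra_simps power_one_over)
        finally show ?thesis by simp
      qed
      have "(\<integral>\<omega>. \<bar>?a \<omega>\<bar> \<partial>Plam) \<le> (\<integral>\<omega>. (2^k * (?a \<omega>)\<^sup>2 + (1/2)^k) / 2 \<partial>Plam)"
        using ia ia2 am_gm by (intro integral_mono) auto
      also have "\<dots> = (2^k * (energy u (N k) - energy u (N k + m)) + (1/2)^k) / 2"
        using ia2 energy_drop[OF u b, of "N k" m] by simp
      also have "\<dots> \<le> (2^k * (1/4)^k + (1/2)^k) / 2"
        using N[of k] c_le[of "N k + m"] by (intro divide_right_mono add_mono mult_left_mono) auto
      also have "\<dots> = (1/2)^k"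
        by (simp flip: power_mult_distrib)
      finally have 1: "(\<integral>\<omega>. \<bar>?a \<omega>\<bar> \<partial>Plam) \<le> (1/2)^k" .
      have 2: "(\<integral>\<omega>. \<bar>mean u (N k) (\<omega> m) - g k (\<omega> m)\<bar> \<partial>Plam) \<le> (1/2)^k"
        using integral_coordinate_Plam[of "\<lambda>y. \<bar>mean u (N k) y - g k y\<bar>" m] mean_g[of k] by simp
      have "(\<integral>\<omega>. \<bar>mean u (N k + m) (\<omega> 0) - g k (\<omega> m)\<bar> \<partial>Plam) \<le>
          (\<integral>\<omega>. \<bar>?a \<omega>\<bar> + \<bar>mean u (N k) (\<omega> m) - g k (\<omega> m)\<bar> \<partial>Plam)"
        using ia i0 i1 by (intro integral_mono) auto
      also have "\<dots> \<le> 2 * (1/2)^k"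
        using 1 2 ia i1 by simp
      finally show ?thesis .
    qed
    have "(\<integral>x. S k x \<partial>lam) = (\<integral>\<omega>. U k (\<omega> 0) \<omega> \<partial>Plam)"
      unfolding S_def using U_bounds by (intro integral_Plam[symmetric, where b="1 + B k"]) auto
    also have "\<dots> = (\<Sum>m<T k. \<integral>\<omega>. \<bar>mean u (N k + m) (\<omega> 0) - g k (\<omega> m)\<bar> \<partial>Plam) / T k"
    proof -
      have "integrable Plam (\<lambda>\<omega>. \<bar>mean u (N k + m) (\<omega> 0) - g k (\<omega> m)\<bar>)" for m
        using summand_bound by (intro integrable_bounded[where b="1 + B k"] Plam.finite_measure_axioms) auto
      then show ?thesis
        unfolding U_def by (simp add: Bochner_Integration.integral_sum)
    qed
    also have "\<dots> \<le> (\<Sum>m<T k. 2 * (1/2)^k) / T k"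
      by (intro divide_right_mono sum_mono single) auto
    finally show ?thesis
      using T(2)[of k] by simp
  qed
  have "AE x in lam. (\<lambda>k. S k x) \<longlonglongrightarrow> 0"
    using S_bounds(1) S_small
  proof (intro AE_tendsto_0_geometric)
    show "integrable lam (S k)" for k
      using S_bounds[of k] by (intro integrable_bounded[where b="1 + B k"] lam.finite_measure_axioms) auto
  qed auto
  then have S_pair: "AE z in lam \<Otimes>\<^sub>M lam. (\<lambda>k. S k (fst z)) \<longlonglongrightarrow> 0 \<and> (\<lambda>k. S k (snd z)) \<longlonglongrightarrow> 0"
    by (intro AE_pair_lam) auto
  define D where "D k x x' = (\<Sum>m<T k. \<bar>mean u (N k + m) x - mean u (N k + m) x'\<bar>) / T k" for k x x'
  have D_bounds: "0 \<le> D k x x'" "D k x x' \<le> 2" for k x x'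
  proof -
    show "0 \<le> D k x x'"
      unfolding D_def by (intro divide_nonneg_nonneg sum_nonneg) auto
    have "\<bar>mean u n x - mean u n x'\<bar> \<le> 2" for n
      using mb[of n x] mb[of n x'] by linarith
    then have "(\<Sum>m<T k. \<bar>mean u (N k + m) x - mean u (N k + m) x'\<bar>) \<le> (\<Sum>m<T k. 2)"
      by (intro sum_mono)
    then show "D k x x' \<le> 2"
      using T(2)[of k] by (simp add: D_def divide_le_eq mult.commute)
  qed
  have D_meas [measurable]: "(\<lambda>z. D k (fst z) (snd z)) \<in> borel_measurable (lam \<Otimes>\<^sub>M lam)" for k
    unfolding D_def by measurable
  have D_le: "D k x x' \<le> (U k x \<omega> + (real M + 1) * (1/2)^k) + U k x' \<omega>'" if "l2_close M \<omega> \<omega>'" for k x x' M \<omega> \<omega>'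
  proof -
    have lip: "L k * dist (\<omega> m) (\<omega>' m) \<le> 2^k * (L k)\<^sup>2 * (dist (\<omega> m) (\<omega>' m))\<^sup>2 + (1/2)^k" for m
    proof -
      let ?t = "L k * dist (\<omega> m) (\<omega>' m)"
      have "0 \<le> (1/2)^k * (2^k * ?t - 1)\<^sup>2"
        by simp
      also have "\<dots> = 2^k * ?t\<^sup>2 - 2 * ?t + (1/2)^k"
        by (simp add: power2_eq_square algebra_simps power_one_over)
      finally have "2 * ?t \<le> 2^k * ?t\<^sup>2 + (1/2)^k" by simp
      moreover have "0 \<le> ?t" using L0 by simp
      ultimately show ?thesis
        unfolding power_mult_distrib by (simp add: mult.assoc)
    qed
    have "(\<Sum>m<T k. L k * dist (\<omega> m) (\<omega>' m)) \<le>
        (\<Sum>m<T k. 2^k * (L k)\<^sup>2 * (dist (\<omega> m) (\<omega>' m))\<^sup>2 + (1/2)^k)"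
      by (intro sum_mono lip)
    also have "\<dots> = 2^k * (L k)\<^sup>2 * (\<Sum>m<T k. (dist (\<omega> m) (\<omega>' m))\<^sup>2) + T k * (1/2)^k"
      by (simp add: sum.distrib sum_distrib_left)
    also have "\<dots> \<le> 2^k * (L k)\<^sup>2 * real M + T k * (1/2)^k"
      using that by (intro add_right_mono mult_left_mono) (auto simp: l2_close_def)
    also have "\<dots> \<le> T k * ((real M + 1) * (1/2)^k)"
    proof -
      have "2^k * (L k)\<^sup>2 = (1/2)^k * (4^k * (L k)\<^sup>2)"
        using power_mult_distrib[of "1/2::real" 4 k] by (simp add: algebra_simps)
      also have "\<dots> \<le> (1/2)^k * real (T k)"
        using T(1)[of k] by (intro mult_left_mono) auto
      finally show ?thesis
        using mult_right_mono[of "2^k * (L k)\<^sup>2" "(1/2)^k * real (T k)" "real M"] by (simp add: algebra_simps)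
    qed
    finally have dist_sum: "(\<Sum>m<T k. L k * dist (\<omega> m) (\<omega>' m)) \<le> T k * ((real M + 1) * (1/2)^k)" .
    have "(\<Sum>m<T k. \<bar>mean u (N k + m) x - mean u (N k + m) x'\<bar>) \<le>
        (\<Sum>m<T k. \<bar>mean u (N k + m) x - g k (\<omega> m)\<bar> + \<bar>mean u (N k + m) x' - g k (\<omega>' m)\<bar>
          + L k * dist (\<omega> m) (\<omega>' m))"
    proof (rule sum_mono)
      fix m
      have "\<bar>g k (\<omega> m) - g k (\<omega>' m)\<bar> \<le> L k * dist (\<omega> m) (\<omega>' m)"
        using lipschitz_onD[OF g(1)[of k], of "\<omega> m" "\<omega>' m"] by (simp add: dist_real_def)
      then show "\<bar>mean u (N k + m) x - mean u (N k + m) x'\<bar> \<le>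
          \<bar>mean u (N k + m) x - g k (\<omega> m)\<bar> + \<bar>mean u (N k + m) x' - g k (\<omega>' m)\<bar> + L k * dist (\<omega> m) (\<omega>' m)"
        by linarith
    qed
    also have "\<dots> = T k * U k x \<omega> + T k * U k x' \<omega>' + (\<Sum>m<T k. L k * dist (\<omega> m) (\<omega>' m))"
      using T(2)[of k] by (simp add: sum.distrib U_def)
    also have "\<dots> \<le> T k * ((U k x \<omega> + (real M + 1) * (1/2)^k) + U k x' \<omega>')"
      using dist_sum by (simp add: algebra_simps)
    finally show ?thesis
      using T(2)[of k] by (simp add: D_def divide_le_eq mult.commute)
  qed
  have "AE z in lam \<Otimes>\<^sub>M lam. (\<lambda>k. D k (fst z) (snd z)) \<longlonglongrightarrow> 0"
    using S_pair overlap
  proof eventually_elim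
    case (elim z)
    then obtain M \<delta> where \<delta>: "\<delta> > 0" and ov: "overlap M \<delta> (PL (fst z)) (PL (snd z))"
      by blast
    have bound: "D k (fst z) (snd z) * \<delta> \<le> S k (fst z) + S k (snd z) + (real M + 1) * (1/2)^k" for k
    proof -
      let ?c = "(real M + 1) * (1/2)^k"
      have "D k (fst z) (snd z) * \<delta> \<le>
          (\<integral>\<omega>. U k (fst z) \<omega> + ?c \<partial>PL (fst z)) + (\<integral>\<omega>. U k (snd z) \<omega> \<partial>PL (snd z))"
        by (rule overlapD[OF ov, where b="1 + B k + ?c"])
           (use U_bounds D_le in \<open>auto intro: add_increasing2 add_mono\<close>)
      also have "(\<integral>\<omega>. U k (fst z) \<omega> + ?c \<partial>PL (fst z)) = S k (fst z) + ?c"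
      proof -
        have "integrable (PL (fst z)) (U k (fst z))"
          using U_bounds[of k] by (intro integrable_bounded[where b="1 + B k"] PL.finite_measure_axioms) auto
        then show ?thesis by (simp add: S)
      qed
      finally show ?thesis by (simp add: S)
    qed
    have rhs: "(\<lambda>k. S k (fst z) + S k (snd z) + (real M + 1) * (1/2)^k) \<longlonglongrightarrow> 0 + 0 + (real M + 1) * 0"
      by (intro tendsto_add tendsto_mult tendsto_const LIMSEQ_power_zero conjunct1[OF elim(1)] conjunct2[OF elim(1)]) simp
    have "(\<lambda>k. D k (fst z) (snd z) * \<delta>) \<longlonglongrightarrow> 0"
    proof (rule tendsto_sandwich)
      show "\<forall>\<^sub>F k in sequentially. 0 \<le> D k (fst z) (snd z) * \<delta>"
        using D_bounds(1) \<delta> by simp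
      show "\<forall>\<^sub>F k in sequentially. D k (fst z) (snd z) * \<delta> \<le> S k (fst z) + S k (snd z) + (real M + 1) * (1/2)^k"
        using bound by simp
      show "(\<lambda>k. S k (fst z) + S k (snd z) + (real M + 1) * (1/2)^k) \<longlonglongrightarrow> 0"
        using rhs by simp
    qed simp
    then have "(\<lambda>k. D k (fst z) (snd z) * \<delta> / \<delta>) \<longlonglongrightarrow> 0 / \<delta>"
      using \<delta> by (intro tendsto_divide tendsto_const) auto
    then show ?case
      using \<delta> by simp
  qed
  then have "(\<lambda>k. \<integral>z. D k (fst z) (snd z) \<partial>(lam \<Otimes>\<^sub>M lam)) \<longlonglongrightarrow> (\<integral>z. 0 \<partial>(lam \<Otimes>\<^sub>M lam))"
    using D_bounds by (intro integral_dominated_convergence[where w="\<lambda>_. 2"]) auto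
  moreover have "c \<le> (\<integral>z. D k (fst z) (snd z) \<partial>(lam \<Otimes>\<^sub>M lam))" for k
  proof -
    have two: "\<bar>\<bar>mean u n x - mean u n y\<bar>\<bar> \<le> 2" for n x y
      using mb[of n x] mb[of n y] by linarith
    have i: "integrable (lam \<Otimes>\<^sub>M lam) (\<lambda>z. \<bar>mean u n (fst z) - mean u n (snd z)\<bar>)" for n
      using two by (intro integrable_bounded[where b=2] pair.finite_measure_axioms) auto
    have "T k * c = (\<Sum>m<T k. c)"
      by simp
    also have "\<dots> \<le> (\<Sum>m<T k. \<integral>z. \<bar>mean u (N k + m) (fst z) - mean u (N k + m) (snd z)\<bar> \<partial>(lam \<Otimes>\<^sub>M lam))"
      by (intro sum_mono order_trans[OF c_le energy_le_spread[OF u b centered]])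
    also have "\<dots> = T k * (\<integral>z. D k (fst z) (snd z) \<partial>(lam \<Otimes>\<^sub>M lam))"
      unfolding D_def using i T(2)[of k] by (simp add: Bochner_Integration.integral_sum)
    finally show ?thesis
      using T(2)[of k] by simp
  qed
  ultimately have "c \<le> 0"
    by (intro LIMSEQ_le_const[of _ 0]) auto
  moreover have "0 \<le> c"
    using LIMSEQ_le_const[OF c] energy_nonneg by blast
  ultimately show ?thesis
    using c by simp
qed

end

section \<open>Time averages under the stationary law\<close>

lemma cesaro_tendsto_0:
  fixes c :: "nat \<Rightarrow> real"
  assumes "c \<longlonglongrightarrow> 0"
  shows "(\<lambda>n. (\<Sum>k<n. c k) / real n) \<longlonglongrightarrow> 0"
proof (rule LIMSEQ_I)
  fix e :: real assume "e > 0"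
  then obtain N where N: "\<And>k. k \<ge> N \<Longrightarrow> \<bar>c k\<bar> < e / 2"
    using LIMSEQ_D[OF assms, of "e / 2"] by auto
  define S where "S = (\<Sum>k<N. \<bar>c k\<bar>)"
  obtain n0 :: nat where n0: "2 * S / e < real n0"
    using reals_Archimedean2 by blast
  show "\<exists>no. \<forall>n\<ge>no. norm ((\<Sum>k<n. c k) / real n - 0) < e"
  proof (intro exI allI impI)
    fix n assume n: "n \<ge> max (max N n0) 1"
    have "\<bar>\<Sum>k<n. c k\<bar> \<le> (\<Sum>k<n. \<bar>c k\<bar>)"
      by (rule sum_abs)
    also have "\<dots> = S + (\<Sum>k=N..<n. \<bar>c k\<bar>)"
      using sum.atLeastLessThan_concat[of 0 N n "\<lambda>k. \<bar>c k\<bar>"] n by (simp add: S_def atLeast0LessThan)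
    also have "(\<Sum>k=N..<n. \<bar>c k\<bar>) \<le> (\<Sum>k=N..<n. e / 2)"
      using N by (intro sum_mono less_imp_le) auto
    also have "\<dots> \<le> real n * (e / 2)"
      using \<open>e > 0\<close> by (simp add: mult_right_mono)
    also have "S < real n * (e / 2)"
    proof -
      have "2 * S / e < real n"
        using n0 n by (meson le_less_trans less_le_trans max.bounded_iff of_nat_mono)
      then show ?thesis
        using \<open>e > 0\<close> by (simp add: field_simps)
    qed
    finally have "\<bar>\<Sum>k<n. c k\<bar> < real n * e"
      by (simp add: mult.commute)
    then show "norm ((\<Sum>k<n. c k) / real n - 0) < e"
      using n by (simp add: field_simps)
  qed
qed

context stationary_chain
begin

lemma abs_correlation_le:
  assumes u [measurable]: "u \<in> borel_measurable borel" and b: "\<And>x. \<bar>u x\<bar> \<le> 1"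
  shows "\<bar>\<integral>\<omega>. u (\<omega> n) * u (\<omega> (n + k)) \<partial>Plam\<bar> \<le> sqrt (energy u k)"
proof -
  note mb = abs_mean_le[OF u b]
  have i: "integrable lam (\<lambda>x. \<bar>mean u k x\<bar>)" "integrable lam (\<lambda>x. (\<bar>mean u k x\<bar>)\<^sup>2)"
    using mb by (auto intro!: integrable_bounded[where b=1] lam.finite_measure_axioms simp: abs_square_le_1)
  have "\<bar>\<integral>\<omega>. u (\<omega> n) * u (\<omega> (n + k)) \<partial>Plam\<bar> = \<bar>\<integral>x. u x * mean u k x \<partial>lam\<bar>"
    by (simp add: correlation[OF u u b b])
  also have "\<dots> \<le> (\<integral>x. \<bar>u x * mean u k x\<bar> \<partial>lam)"
    by (rule integral_abs_bound)
  also have "\<dots> \<le> (\<integral>x. \<bar>mean u k x\<bar> \<partial>lam)"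
  proof (rule integral_mono)
    show "integrable lam (\<lambda>x. \<bar>u x * mean u k x\<bar>)"
      using b mb by (intro integrable_bounded[where b=1] lam.finite_measure_axioms) (auto simp: abs_mult intro: mult_le_one)
    show "\<bar>u x * mean u k x\<bar> \<le> \<bar>mean u k x\<bar>" for x
      using mult_right_mono[OF b[of x], of "\<bar>mean u k x\<bar>"] by (simp add: abs_mult)
  qed (rule i)
  also have "\<dots> \<le> sqrt (energy u k)"
  proof (rule real_le_rsqrt)
    have "0 \<le> lam.variance (\<lambda>x. \<bar>mean u k x\<bar>)"
      by (rule lam.variance_positive)
    then show "(\<integral>x. \<bar>mean u k x\<bar> \<partial>lam)\<^sup>2 \<le> energy u k"
      using lam.variance_eq[OF i] by (simp add: energy_def)
  qed
  finally show ?thesis .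
qed

definition time_average :: "('a \<Rightarrow> real) \<Rightarrow> (nat \<Rightarrow> nat) \<Rightarrow> nat \<Rightarrow> (nat \<Rightarrow> 'a) \<Rightarrow> real" where
  "time_average u t n \<omega> = (\<Sum>k<n. u (\<omega> (t k))) / real n"

lemma abs_time_average_le:
  assumes "\<And>x. \<bar>u x\<bar> \<le> 1"
  shows "\<bar>time_average u t n \<omega>\<bar> \<le> 1"
proof -
  have "\<bar>\<Sum>k<n. u (\<omega> (t k))\<bar> \<le> (\<Sum>k<n. 1)"
    by (rule order_trans[OF sum_abs]) (intro sum_mono assms)
  then show ?thesis
    by (cases "n = 0") (auto simp: time_average_def divide_le_eq)
qed

lemma measurable_time_average [measurable]:
  assumes [measurable]: "u \<in> borel_measurable borel"
  shows "time_average u t n \<in> borel_measurable path_space"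
  unfolding time_average_def[abs_def] by measurable

lemma sum_abs_diff_le:
  fixes c :: "nat \<Rightarrow> real"
  assumes "\<And>k. 0 \<le> c k" "k < n"
  shows "(\<Sum>l<n. c (if k \<le> l then l - k else k - l)) \<le> 2 * (\<Sum>m<n. c m)"
proof -
  have split: "{..<n} = {..<k} \<union> {k..<n}"
    using assms(2) by auto
  have "(\<Sum>l<n. c (if k \<le> l then l - k else k - l)) =
      (\<Sum>l<k. c (k - l)) + (\<Sum>l=k..<n. c (l - k))"
    unfolding split by (subst sum.union_disjoint) (auto intro!: arg_cong2[where f="(+)"] sum.cong)
  also have "(\<Sum>l<k. c (k - l)) \<le> (\<Sum>m<n. c m)"
  proof -
    have "(\<Sum>l<k. c (k - l)) = (\<Sum>m\<in>(\<lambda>l. k - l) ` {..<k}. c m)"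
      by (subst sum.reindex) (auto simp: inj_on_def)
    also have "\<dots> \<le> (\<Sum>m<n. c m)"
      using assms by (intro sum_mono2) auto
    finally show ?thesis .
  qed
  also have "(\<Sum>l=k..<n. c (l - k)) \<le> (\<Sum>m<n. c m)"
  proof -
    have "(\<Sum>l=k..<n. c (l - k)) = (\<Sum>m\<in>(\<lambda>l. l - k) ` {k..<n}. c m)"
      by (subst sum.reindex) (auto simp: inj_on_def)
    also have "\<dots> \<le> (\<Sum>m<n. c m)"
      using assms by (intro sum_mono2) auto
    finally show ?thesis .
  qed
  finally show ?thesis by simp
qed

text \<open>
  The second moment of the average is at most twice the Cesaro mean of the correlation bounds
  \<open>sqrt (energy u k)\<close>: these decrease in \<open>k\<close>, and the gaps of \<open>t\<close> are at least the gaps of the indices.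
\<close>

theorem time_average_AE_subsequence:
  assumes u [measurable]: "u \<in> borel_measurable borel" and b: "\<And>x. \<bar>u x\<bar> \<le> 1"
    and energy: "energy u \<longlonglongrightarrow> 0" and t: "strict_mono t"
  shows "\<exists>r. strict_mono r \<and> (AE \<omega> in Plam. (\<lambda>j. time_average u t (r j) \<omega>) \<longlonglongrightarrow> 0)"
proof -
  define c where "c k = sqrt (energy u k)" for k
  have c0: "0 \<le> c k" for k
    unfolding c_def energy_def by (intro real_sqrt_ge_zero Bochner_Integration.integral_nonneg) simp
  have dec: "c m \<le> c k" if "k \<le> m" for k m
    unfolding c_def using decseqD[OF decseq_energy[OF u b] that] by simp
  have clim: "c \<longlonglongrightarrow> 0"
    unfolding c_def using tendsto_real_sqrt[OF energy] by simp
  have ordered: "\<bar>\<integral>\<omega>. u (\<omega> (t k)) * u (\<omega> (t l)) \<partial>Plam\<bar> \<le> c (l - k)" if "k \<le> l" for k l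
  proof -
    have gap: "l - k \<le> t l - t k"
      using that
    proof (induction rule: dec_induct)
      case (step l)
      have "t l < t (Suc l)" using t by (simp add: strict_mono_Suc_iff)
      moreover have "t k \<le> t l" using t step by (simp add: strict_mono_less_eq)
      ultimately show ?case using step by linarith
    qed simp
    have "t k \<le> t l" using t that by (simp add: strict_mono_less_eq)
    then have "\<bar>\<integral>\<omega>. u (\<omega> (t k)) * u (\<omega> (t l)) \<partial>Plam\<bar> \<le> c (t l - t k)"
      using abs_correlation_le[OF u b, of "t k" "t l - t k"] by (simp add: c_def)
    also have "\<dots> \<le> c (l - k)"
      by (rule dec[OF gap])
    finally show ?thesis .
  qed
  have pair: "(\<integral>\<omega>. u (\<omega> (t k)) * u (\<omega> (t l)) \<partial>Plam) \<le> c (if k \<le> l then l - k else k - l)" for k l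
    using ordered[of k l] ordered[of l k] by (auto simp: mult.commute)
  have prod: "\<bar>u x * u y\<bar> \<le> 1" for x y
    using b[of x] b[of y] by (simp add: abs_mult mult_le_one)
  have int: "integrable Plam (\<lambda>\<omega>. u (\<omega> k) * u (\<omega> l))" for k l
    using prod by (intro integrable_bounded[where b=1] Plam.finite_measure_axioms) auto
  have second_moment: "(\<integral>\<omega>. norm ((time_average u t n \<omega>)\<^sup>2) \<partial>Plam) \<le> 2 * ((\<Sum>m<n. c m) / n)" for n
  proof (cases "n = 0")
    case False
    have "(\<integral>\<omega>. norm ((time_average u t n \<omega>)\<^sup>2) \<partial>Plam) =
        (\<integral>\<omega>. (\<Sum>k<n. \<Sum>l<n. u (\<omega> (t k)) * u (\<omega> (t l))) / (real n)\<^sup>2 \<partial>Plam)"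
    proof (intro Bochner_Integration.integral_cong refl)
      fix \<omega>
      have "norm ((time_average u t n \<omega>)\<^sup>2) = (time_average u t n \<omega>)\<^sup>2"
        by simp
      also have "\<dots> = (\<Sum>k<n. u (\<omega> (t k))) * (\<Sum>l<n. u (\<omega> (t l))) / (real n)\<^sup>2"
        unfolding time_average_def power_divide by (simp add: power2_eq_square)
      finally show "norm ((time_average u t n \<omega>)\<^sup>2) = (\<Sum>k<n. \<Sum>l<n. u (\<omega> (t k)) * u (\<omega> (t l))) / (real n)\<^sup>2"
        unfolding sum_product .
    qed
    also have "\<dots> = (\<Sum>k<n. \<Sum>l<n. \<integral>\<omega>. u (\<omega> (t k)) * u (\<omega> (t l)) \<partial>Plam) / (real n)\<^sup>2"
      using int by (simp add: Bochner_Integration.integral_sum)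
    also have "\<dots> \<le> (\<Sum>k<n. \<Sum>l<n. c (if k \<le> l then l - k else k - l)) / (real n)\<^sup>2"
      by (intro divide_right_mono sum_mono pair) simp
    also have "\<dots> \<le> (\<Sum>k<n. 2 * (\<Sum>m<n. c m)) / (real n)\<^sup>2"
      by (intro divide_right_mono sum_mono sum_abs_diff_le) (auto simp: c0)
    also have "\<dots> = 2 * ((\<Sum>m<n. c m) / n)"
      using False by (simp add: power2_eq_square)
    finally show ?thesis .
  qed (simp add: time_average_def)
  have "(\<lambda>n. \<integral>\<omega>. norm ((time_average u t n \<omega>)\<^sup>2) \<partial>Plam) \<longlonglongrightarrow> 0"
  proof (rule tendsto_sandwich)
    show "\<forall>\<^sub>F n in sequentially. 0 \<le> (\<integral>\<omega>. norm ((time_average u t n \<omega>)\<^sup>2) \<partial>Plam)"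
      by (simp add: Bochner_Integration.integral_nonneg)
    show "(\<lambda>n. 2 * ((\<Sum>m<n. c m) / real n)) \<longlonglongrightarrow> 0"
      using tendsto_mult[OF tendsto_const cesaro_tendsto_0[OF clim], of 2] by simp
    show "\<forall>\<^sub>F n in sequentially. (\<integral>\<omega>. norm ((time_average u t n \<omega>)\<^sup>2) \<partial>Plam) \<le> 2 * ((\<Sum>m<n. c m) / real n)"
      using second_moment by simp
  qed simp
  moreover have "integrable Plam (\<lambda>\<omega>. (time_average u t n \<omega>)\<^sup>2)" for n
    using abs_time_average_le[of u t n, OF b]
    by (intro integrable_bounded[where b=1] Plam.finite_measure_axioms) (auto simp: abs_square_le_1)
  ultimately obtain r where r: "strict_mono r" "AE \<omega> in Plam. (\<lambda>j. (time_average u t (r j) \<omega>)\<^sup>2) \<longlonglongrightarrow> 0"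
    using tendsto_L1_AE_subseq[of Plam "\<lambda>n \<omega>. (time_average u t n \<omega>)\<^sup>2"] by blast
  have "AE \<omega> in Plam. (\<lambda>j. time_average u t (r j) \<omega>) \<longlonglongrightarrow> 0"
    using r(2)
  proof eventually_elim
    case (elim \<omega>)
    then have "(\<lambda>j. \<bar>time_average u t (r j) \<omega>\<bar>) \<longlonglongrightarrow> 0"
      using tendsto_real_sqrt[OF elim] by simp
    then show ?case
      by (rule tendsto_rabs_zero_cancel)
  qed
  with r(1) show ?thesis by blast
qed

end

section \<open>A lower bound for convergence of averages from every state\<close>

context stationary_chain
begin

text \<open>
  The pair consists of the number of terms by which the sum is divided and of the list of times.
  They are separate because a shift in time may drop entries of the list but must not change
  the divisor. Such pairs form a countable type, which makes \<open>calm_prob\<close> measurable.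
\<close>

definition average :: "('a \<Rightarrow> real) \<Rightarrow> nat \<times> nat list \<Rightarrow> (nat \<Rightarrow> 'a) \<Rightarrow> real" where
  "average f p \<omega> = (\<Sum>n\<leftarrow>snd p. f (\<omega> n)) / real (fst p)"

definition calm :: "('a \<Rightarrow> real) \<Rightarrow> real \<Rightarrow> (nat \<times> nat list) list \<Rightarrow> (nat \<Rightarrow> 'a) set" where
  "calm f e ps = {\<omega>. \<forall>p\<in>set ps. \<bar>average f p \<omega>\<bar> \<le> e}"

text \<open>
  The families of averages that are, up to probability \<open>2\<^sup>-\<^sup>k\<close>, small for the stationary chain, and for
  which smallness carries over between \<open>k\<close>-close paths at the price of a factor \<open>2\<close>. The threshold
  \<open>1 / (q + 1)\<close> is part of the family so that one function \<open>calm_prob\<close> serves all thresholds.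
\<close>

definition robust :: "('a \<Rightarrow> real) \<Rightarrow> nat \<Rightarrow> ((nat \<times> nat list) list \<times> nat) set" where
  "robust f k = {(ps, q).
     (\<forall>\<omega> \<omega>'. l2_close k \<omega> \<omega>' \<longrightarrow> \<omega>' \<in> calm f (1 / (2 * Suc q)) ps \<longrightarrow> \<omega> \<in> calm f (1 / Suc q) ps) \<and>
     measure Plam (- calm f (1 / (2 * Suc q)) ps) \<le> (1/2)^k}"

text \<open>
  The function \<open>\<rho>\<close> of the introduction. The infimum runs over a countable set that involves neither
  \<open>y\<close> nor a particular sequence of times.
\<close>

definition calm_prob :: "('a \<Rightarrow> real) \<Rightarrow> nat \<Rightarrow> 'a \<Rightarrow> real" where
  "calm_prob f k y = (INF i\<in>robust f k. measure (PL y) (calm f (1 / Suc (snd i)) (fst i)))"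

lemma measurable_average [measurable]:
  assumes [measurable]: "f \<in> borel_measurable borel"
  shows "average f p \<in> borel_measurable path_space"
proof -
  have [measurable]: "(\<lambda>\<omega>. \<Sum>n\<leftarrow>ns. f (\<omega> n)) \<in> borel_measurable path_space" for ns
    by (induction ns) simp_all
  show ?thesis
    unfolding average_def[abs_def] by measurable
qed

lemma sets_calm [measurable]:
  assumes [measurable]: "f \<in> borel_measurable borel"
  shows "calm f e ps \<in> sets path_space"
  unfolding calm_def by (rule path_Collect) measurable

lemma sets_Compl_path: "A \<in> sets path_space \<Longrightarrow> - A \<in> sets path_space"
  using sets.compl_sets[of A path_space] by (simp add: Compl_eq_Diff_UNIV)

lemma measure_eq_integral_indicator:
  assumes "A \<in> sets path_space"
  shows "measure (PL y) A = (\<integral>\<omega>. indicator A \<omega> \<partial>PL y)" "measure Plam A = (\<integral>\<omega>. indicator A \<omega> \<partial>Plam)"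
  by simp_all

lemma measure_Plam_eq:
  assumes A [measurable]: "A \<in> sets path_space"
  shows "measure Plam A = (\<integral>y. measure (PL y) A \<partial>lam)"
  unfolding measure_eq_integral_indicator[OF A]
  by (rule integral_Plam[where b=1]) (auto split: split_indicator)

lemma robustI:
  assumes "\<And>\<omega> \<omega>'. l2_close k \<omega> \<omega>' \<Longrightarrow> \<omega>' \<in> calm f (1 / (2 * Suc q)) ps \<Longrightarrow> \<omega> \<in> calm f (1 / Suc q) ps"
    and "measure Plam (- calm f (1 / (2 * Suc q)) ps) \<le> (1/2)^k"
  shows "(ps, q) \<in> robust f k"
  unfolding robust_def using assms by blast

lemma robust_nonempty: "([], 0) \<in> robust f k"
  by (simp add: robust_def calm_def)

lemma calm_prob_bdd: "bdd_below ((\<lambda>i. measure (PL y) (calm f (1 / Suc (snd i)) (fst i))) ` robust f k)"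
  by (rule bdd_belowI2[of _ 0]) simp

lemma calm_prob_bounds: "0 \<le> calm_prob f k y" "calm_prob f k y \<le> 1"
proof -
  show "0 \<le> calm_prob f k y"
    unfolding calm_prob_def using robust_nonempty by (intro cINF_greatest) auto
  have "calm_prob f k y \<le> measure (PL y) (calm f (1 / Suc (snd i)) (fst i))" if "i \<in> robust f k" for i
    unfolding calm_prob_def by (rule cINF_lower[OF calm_prob_bdd that])
  from this[OF robust_nonempty] show "calm_prob f k y \<le> 1"
    using PL.prob_le_1 by (rule order_trans)
qed

lemma measurable_calm_prob [measurable]:
  assumes [measurable]: "f \<in> borel_measurable borel"
  shows "calm_prob f k \<in> borel_measurable borel"
  unfolding calm_prob_def[abs_def]
proof (rule borel_measurable_cINF)
  show "bdd_below ((\<lambda>i. measure (PL y) (calm f (1 / Suc (snd i)) (fst i))) ` robust f k)" for y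
    by (rule calm_prob_bdd)
qed (auto intro: countableI_type)

text \<open>
  If the infima were zero for every \<open>k\<close>, there would be families, one for each \<open>k\<close>, that are calm with
  probability at most \<open>2\<^sup>-\<^sup>k\<close> from \<open>y\<close>, but by Borel-Cantelli with probability tending to \<open>1\<close> from almost
  every \<open>y'\<close>. This is incompatible with an overlap of the two path laws.
\<close>

lemma calm_prob_pos:
  assumes f [measurable]: "f \<in> borel_measurable borel"
    and overlap: "AE y' in lam. \<exists>M \<delta>. \<delta> > 0 \<and> overlap M \<delta> (PL y) (PL y')"
  shows "\<exists>k. calm_prob f k y > 0"
proof (rule ccontr)
  assume "\<not> ?thesis"
  (* a value that is not positive lies below every positive number, so near-minimisers exist *)
  then have "calm_prob f k y < (1/2)^k" for k
    by (metis not_less order_le_less_trans zero_less_divide_1_iff zero_less_numeral zero_less_power)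
  then have "\<exists>i\<in>robust f k. measure (PL y) (calm f (1 / Suc (snd i)) (fst i)) < (1/2)^k" for k
    using cINF_less_iff[OF _ calm_prob_bdd, of f k y "(1/2)^k"] robust_nonempty[of f k]
    unfolding calm_prob_def by blast
  then obtain i where i: "\<And>k. i k \<in> robust f k"
    and small: "\<And>k. measure (PL y) (calm f (1 / Suc (snd (i k))) (fst (i k))) < (1/2)^k"
    by metis
  define A where "A k = calm f (1 / Suc (snd (i k))) (fst (i k))" for k
  define B where "B k = - calm f (1 / (2 * Suc (snd (i k)))) (fst (i k))" for k
  have [measurable]: "A k \<in> sets path_space" "B k \<in> sets path_space" for k
    unfolding A_def B_def by (intro sets_calm f sets_Compl_path)+
  have B: "measure Plam (B k) \<le> (1/2)^k" for k
    using i[of k] by (auto simp: robust_def B_def)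
  have "AE y' in lam. (\<lambda>k. measure (PL y') (B k)) \<longlonglongrightarrow> 0"
  proof (rule AE_tendsto_0_geometric[where c=1])
    show "integrable lam (\<lambda>y'. measure (PL y') (B k))" for k
      by (intro integrable_bounded[where b=1] lam.finite_measure_axioms) auto
    show "(\<integral>y'. measure (PL y') (B k) \<partial>lam) \<le> 1 * (1/2)^k" for k
      using B[of k] measure_Plam_eq[of "B k"] by simp
  qed simp
  then have "AE y' in lam. False"
    using overlap
  proof eventually_elim
    case (elim y')
    then obtain M \<delta> where \<delta>: "\<delta> > 0" and ov: "overlap M \<delta> (PL y) (PL y')"
      by blast
    have bound: "\<delta> \<le> (1/2)^k + measure (PL y') (B k)" if "k \<ge> M" for k
    proof -
      have "1 * \<delta> \<le> (\<integral>\<omega>. indicator (A k) \<omega> \<partial>PL y) + (\<integral>\<omega>. indicator (B k) \<omega> \<partial>PL y')"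
      proof (rule overlapD[OF ov, where b=1])
        fix \<omega> \<omega>' :: "nat \<Rightarrow> 'a" assume "l2_close M \<omega> \<omega>'"
        then have "l2_close k \<omega> \<omega>'"
          using that unfolding l2_close_def by (meson of_nat_mono order_trans)
        then have "\<omega> \<in> A k \<or> \<omega>' \<in> B k"
          using i[of k] by (auto simp: robust_def A_def B_def)
        then show "1 \<le> indicator (A k) \<omega> + (indicator (B k) \<omega>' :: real)"
          by (auto split: split_indicator)
      qed (auto split: split_indicator)
      also have "\<dots> = measure (PL y) (A k) + measure (PL y') (B k)"
        by simp
      also have "measure (PL y) (A k) \<le> (1/2)^k"
        using small[of k] unfolding A_def by (rule less_imp_le)
      finally show ?thesis by simp
    qed
    have "(\<lambda>k. (1/2)^k + measure (PL y') (B k)) \<longlonglongrightarrow> 0 + 0"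
      using elim(1) by (intro tendsto_add LIMSEQ_power_zero) auto
    then have "\<delta> \<le> 0 + 0"
      by (rule LIMSEQ_le_const) (use bound in blast)
    with \<delta> show False by simp
  qed
  then show False by simp
qed

lemma integral_calm_prob_pos:
  assumes f [measurable]: "f \<in> borel_measurable borel"
    and overlap: "AE y in lam. AE y' in lam. \<exists>M \<delta>. \<delta> > 0 \<and> overlap M \<delta> (PL y) (PL y')"
  shows "\<exists>k. (\<integral>y. calm_prob f k y \<partial>lam) > 0"
proof (rule ccontr)
  assume "\<not> ?thesis"
  then have "(\<integral>y. calm_prob f k y \<partial>lam) = 0" for k
    using Bochner_Integration.integral_nonneg[of lam "calm_prob f k"] calm_prob_bounds(1)
    by (metis less_eq_real_def)
  moreover have "integrable lam (calm_prob f k)" for k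
    using calm_prob_bounds by (intro integrable_bounded[where b=1] lam.finite_measure_axioms) auto
  ultimately have "AE y in lam. calm_prob f k y = 0" for k
    using calm_prob_bounds(1) by (subst (asm) integral_nonneg_eq_0_iff_AE) auto
  then have "AE y in lam. \<forall>k. calm_prob f k y = 0"
    by (simp add: AE_all_countable)
  then have "AE y in lam. False"
    using overlap
  proof eventually_elim
    case (elim y)
    then show False
      using calm_prob_pos[OF f elim(2)] by auto
  qed
  then show False by simp
qed

definition averaging_sequence :: "(nat \<Rightarrow> nat \<times> nat list) \<Rightarrow> bool" where
  "averaging_sequence p \<longleftrightarrow> (\<forall>j. distinct (snd (p j)) \<and> length (snd (p j)) \<le> fst (p j)) \<and>
     filterlim (\<lambda>j. fst (p j)) at_top sequentially"

text \<open>
  Along \<open>k\<close>-close paths the sum over \<open>K\<close> times changes by order \<open>sqrt (k K)\<close> at most, which is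
  small against \<open>K\<close>.
\<close>

lemma average_close:
  assumes L: "L-lipschitz_on UNIV f" and p: "distinct (snd p)" "length (snd p) \<le> fst p"
    and e: "e > 0" and large: "4 * L\<^sup>2 * real k \<le> e\<^sup>2 * real (fst p)" and close: "l2_close k \<omega> \<omega>'"
  shows "\<bar>average f p \<omega> - average f p \<omega>'\<bar> \<le> e / 2"
proof (cases "fst p = 0")
  case True
  then show ?thesis using e by (simp add: average_def)
next
  case False
  define T where "T = set (snd p)"
  have T: "finite T" "card T \<le> fst p"
    using p by (auto simp: T_def distinct_card)
  have L0: "0 \<le> L"
    by (rule lipschitz_on_nonneg[OF L])
  have am_gm: "L * d \<le> (L\<^sup>2 * d\<^sup>2 / e) + e / 4" for d
  proof -
    have "0 \<le> (L * d / e - 1 / 2)\<^sup>2 * e"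
      using e by simp
    also have "\<dots> = L\<^sup>2 * d\<^sup>2 / e - L * d + e / 4"
      using e by (simp add: power2_eq_square field_simps)
    finally show ?thesis by simp
  qed
  have "\<bar>\<Sum>n\<in>T. f (\<omega> n) - f (\<omega>' n)\<bar> \<le> (\<Sum>n\<in>T. \<bar>f (\<omega> n) - f (\<omega>' n)\<bar>)"
    by (rule sum_abs)
  also have "\<dots> \<le> (\<Sum>n\<in>T. L\<^sup>2 * (dist (\<omega> n) (\<omega>' n))\<^sup>2 / e + e / 4)"
    using lipschitz_onD[OF L] by (intro sum_mono order_trans[OF _ am_gm]) (auto simp: dist_real_def)
  also have "\<dots> = L\<^sup>2 / e * (\<Sum>n\<in>T. (dist (\<omega> n) (\<omega>' n))\<^sup>2) + card T * (e / 4)"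
    by (simp add: sum.distrib sum_distrib_left mult_ac)
  also have "\<dots> \<le> L\<^sup>2 / e * real k + fst p * (e / 4)"
  proof (intro add_mono mult_left_mono mult_right_mono)
    obtain N where "T \<subseteq> {..<N}"
      using T(1) finite_nat_iff_bounded by blast
    then have "(\<Sum>n\<in>T. (dist (\<omega> n) (\<omega>' n))\<^sup>2) \<le> (\<Sum>n<N. (dist (\<omega> n) (\<omega>' n))\<^sup>2)"
      by (intro sum_mono2) auto
    also have "\<dots> \<le> real k"
      using close by (simp add: l2_close_def)
    finally show "(\<Sum>n\<in>T. (dist (\<omega> n) (\<omega>' n))\<^sup>2) \<le> real k" .
  qed (use e T in auto)
  also have "\<dots> \<le> fst p * (e / 4) + fst p * (e / 4)"
    using large e by (intro add_right_mono) (simp add: field_simps power2_eq_square)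
  finally have "\<bar>\<Sum>n\<in>T. f (\<omega> n) - f (\<omega>' n)\<bar> \<le> fst p * (e / 2)"
    by (simp add: mult.commute)
  moreover have "average f p \<omega> - average f p \<omega>' = (\<Sum>n\<in>T. f (\<omega> n) - f (\<omega>' n)) / fst p"
    using p(1) by (simp add: average_def T_def sum_list_distinct_conv_sum_set sum_subtractf diff_divide_distrib)
  ultimately show ?thesis
    using False by (simp add: divide_le_eq mult.commute)
qed

text \<open>
  Almost sure convergence makes the whole tail after \<open>J\<close> small with high probability, so the bound is
  uniform in the end \<open>J'\<close> of the stretch. The divisors grow, so \<open>average_close\<close> applies after \<open>J\<close>.
\<close>

lemma robust_tail:
  assumes L: "L-lipschitz_on UNIV f" and p: "averaging_sequence p"
    and lim: "AE \<omega> in Plam. (\<lambda>j. average f (p j) \<omega>) \<longlonglongrightarrow> 0"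
  shows "\<exists>J. \<forall>J'. (map p [J..<J'], q) \<in> robust f k"
proof -
  define e where "e = 1 / real (Suc q)"
  have e: "e > 0" "1 / real (2 * Suc q) = e / 2"
    by (simp_all add: e_def)
  have f [measurable]: "f \<in> borel_measurable borel"
    by (rule lipschitz_borel_measurable[OF L])
  have "\<forall>\<^sub>F j in sequentially. real (fst (p j)) \<ge> 4 * L\<^sup>2 * real k / e\<^sup>2"
    using filterlim_compose[OF filterlim_real_sequentially, of "\<lambda>j. fst (p j)" sequentially] p
    by (simp add: averaging_sequence_def filterlim_at_top)
  then obtain J1 where J1: "\<And>j. j \<ge> J1 \<Longrightarrow> real (fst (p j)) \<ge> 4 * L\<^sup>2 * real k / e\<^sup>2"
    by (auto simp: eventually_sequentially)
  define B where "B J = {\<omega>. \<forall>j\<ge>J. \<bar>average f (p j) \<omega>\<bar> \<le> e / 2}" for J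
  have B_sets: "B J \<in> sets path_space" for J
    unfolding B_def by (rule path_Collect) measurable
  have "(\<lambda>J. measure Plam (B J)) \<longlonglongrightarrow> measure Plam (\<Union>J. B J)"
  proof (rule Plam.finite_Lim_measure_incseq)
    show "range B \<subseteq> sets Plam"
      using B_sets by auto
  qed (auto simp: incseq_def B_def)
  also have "measure Plam (\<Union>J. B J) = 1"
  proof (rule Plam.prob_eq_1[THEN iffD2])
    show "AE \<omega> in Plam. \<omega> \<in> (\<Union>J. B J)"
      using lim
    proof eventually_elim
      case (elim \<omega>)
      then obtain J where "\<And>j. j \<ge> J \<Longrightarrow> \<bar>average f (p j) \<omega>\<bar> < e / 2"
        using LIMSEQ_D[OF elim, of "e / 2"] e by auto
      then show ?case
        by (auto simp: B_def intro!: exI[of _ J] less_imp_le)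
    qed
    show "(\<Union>J. B J) \<in> sets Plam"
      using B_sets by auto
  qed
  finally have "\<forall>\<^sub>F J in sequentially. measure Plam (B J) > 1 - (1/2)^k"
    by (rule order_tendstoD(1)) simp
  then obtain J2 where J2: "measure Plam (B J) > 1 - (1/2)^k" if "J \<ge> J2" for J
    by (auto simp: eventually_sequentially)
  define J where "J = max J1 J2"
  have "(map p [J..<J'], q) \<in> robust f k" for J'
  proof (rule robustI)
    fix \<omega> \<omega>' :: "nat \<Rightarrow> 'a"
    assume close: "l2_close k \<omega> \<omega>'" and calm: "\<omega>' \<in> calm f (1 / real (2 * Suc q)) (map p [J..<J'])"
    have "\<omega> \<in> calm f e (map p [J..<J'])"
      unfolding calm_def
    proof clarsimp
      fix j assume j: "J \<le> j" "j < J'"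
      have "\<bar>average f (p j) \<omega>'\<bar> \<le> e / 2"
        using calm j unfolding calm_def e(2) by simp
      moreover have "\<bar>average f (p j) \<omega> - average f (p j) \<omega>'\<bar> \<le> e / 2"
        using p J1[of j] j e by (intro average_close[OF L _ _ e(1) _ close]) (auto simp: averaging_sequence_def J_def field_simps)
      ultimately show "\<bar>average f (p j) \<omega>\<bar> \<le> e" by linarith
    qed
    then show "\<omega> \<in> calm f (1 / real (Suc q)) (map p [J..<J'])"
      by (simp only: e_def)
  next
    have "B J \<subseteq> calm f (1 / real (2 * Suc q)) (map p [J..<J'])"
      unfolding B_def calm_def e(2) by auto
    then have "measure Plam (B J) \<le> measure Plam (calm f (1 / real (2 * Suc q)) (map p [J..<J']))"
      by (intro Plam.finite_measure_mono) auto
    then have "measure Plam (calm f (1 / real (2 * Suc q)) (map p [J..<J'])) > 1 - (1/2)^k"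
      using J2[of J] by (simp add: J_def)
    then show "measure Plam (- calm f (1 / real (2 * Suc q)) (map p [J..<J'])) \<le> (1/2)^k"
      using Plam.prob_compl[of "calm f (1 / real (2 * Suc q)) (map p [J..<J'])"]
      by (simp add: Compl_eq_Diff_UNIV)
  qed
  then show ?thesis by blast
qed

text \<open>
  Every finite stretch of a late tail of the sequence is a robust family, so the infimum bounds the
  probability that it is calm. The bound survives the limits, first of longer stretches and then of
  smaller thresholds. It holds for every \<open>y\<close>, without an exceptional set.
\<close>

lemma calm_prob_le:
  assumes L: "L-lipschitz_on UNIV f" and p: "averaging_sequence p"
    and lim: "AE \<omega> in Plam. (\<lambda>j. average f (p j) \<omega>) \<longlonglongrightarrow> 0"
  shows "calm_prob f k y \<le> measure (PL y) {\<omega>. (\<lambda>j. average f (p j) \<omega>) \<longlonglongrightarrow> 0}"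
proof -
  have f [measurable]: "f \<in> borel_measurable borel"
    by (rule lipschitz_borel_measurable[OF L])
  define E where "E q = {\<omega>. \<exists>J. \<forall>j\<ge>J. \<bar>average f (p j) \<omega>\<bar> \<le> 1 / Suc q}" for q
  have E_sets: "E q \<in> sets path_space" for q
    unfolding E_def by (rule path_Collect) measurable
  have le_E: "calm_prob f k y \<le> measure (PL y) (E q)" for q
  proof -
    obtain J where J: "\<And>J'. (map p [J..<J'], q) \<in> robust f k"
      using robust_tail[OF assms] by blast
    define C where "C J' = calm f (1 / Suc q) (map p [J..<J'])" for J'
    have "calm_prob f k y \<le> measure (PL y) (C J')" for J'
      unfolding calm_prob_def C_def using cINF_lower[OF calm_prob_bdd J[of J']] by simp
    moreover have "(\<lambda>J'. measure (PL y) (C J')) \<longlonglongrightarrow> measure (PL y) (\<Inter>J'. C J')"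
    proof (rule PL.finite_Lim_measure_decseq)
      show "range C \<subseteq> sets (PL y)"
        by (auto simp: C_def)
    qed (auto simp: C_def decseq_def calm_def)
    ultimately have "calm_prob f k y \<le> measure (PL y) (\<Inter>J'. C J')"
      by (intro LIMSEQ_le_const) auto
    also have "\<dots> \<le> measure (PL y) (E q)"
    proof (rule PL.finite_measure_mono)
      show "(\<Inter>J'. C J') \<subseteq> E q"
      proof
        fix \<omega> assume *: "\<omega> \<in> (\<Inter>J'. C J')"
        have "\<bar>average f (p j) \<omega>\<bar> \<le> 1 / Suc q" if "j \<ge> J" for j
          using *[THEN INT_D, of "Suc j"] that by (auto simp: C_def calm_def)
        then show "\<omega> \<in> E q"
          by (auto simp: E_def)
      qed
    qed (simp add: E_sets)
    finally show ?thesis .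
  qed
  have eq: "{\<omega>. (\<lambda>j. average f (p j) \<omega>) \<longlonglongrightarrow> 0} = (\<Inter>q. E q)"
  proof (intro set_eqI iffI)
    fix \<omega> assume "\<omega> \<in> {\<omega>. (\<lambda>j. average f (p j) \<omega>) \<longlonglongrightarrow> 0}"
    then have lim: "(\<lambda>j. average f (p j) \<omega>) \<longlonglongrightarrow> 0" by simp
    have "\<exists>J. \<forall>j\<ge>J. \<bar>average f (p j) \<omega>\<bar> \<le> 1 / Suc q" for q
    proof -
      obtain J where "\<forall>j\<ge>J. norm (average f (p j) \<omega> - 0) < 1 / Suc q"
        using LIMSEQ_D[OF lim, of "1 / Suc q"] by auto
      then show ?thesis
        by (intro exI[of _ J]) (auto intro: less_imp_le)
    qed
    then show "\<omega> \<in> (\<Inter>q. E q)"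
      by (simp add: E_def)
  next
    fix \<omega> assume *: "\<omega> \<in> (\<Inter>q. E q)"
    have "(\<lambda>j. average f (p j) \<omega>) \<longlonglongrightarrow> 0"
    proof (rule LIMSEQ_I)
      fix e :: real assume "e > 0"
      then obtain q where q: "1 / Suc q < e"
        using nat_approx_posE by metis
      obtain J where "\<forall>j\<ge>J. \<bar>average f (p j) \<omega>\<bar> \<le> 1 / Suc q"
        using *[THEN INT_D, of q] by (auto simp: E_def)
      then show "\<exists>J. \<forall>j\<ge>J. norm (average f (p j) \<omega> - 0) < e"
        using q by (intro exI[of _ J]) force
    qed
    then show "\<omega> \<in> {\<omega>. (\<lambda>j. average f (p j) \<omega>) \<longlonglongrightarrow> 0}" by simp
  qed
  have "decseq E"
  proof (rule decseq_SucI)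
    fix q
    have "1 / real (Suc (Suc q)) \<le> 1 / real (Suc q)"
      by (intro divide_left_mono) auto
    then show "E (Suc q) \<le> E q"
      unfolding E_def by (auto intro: order_trans)
  qed
  then have "(\<lambda>q. measure (PL y) (E q)) \<longlonglongrightarrow> measure (PL y) (\<Inter>q. E q)"
    using E_sets by (intro PL.finite_Lim_measure_decseq) auto
  then show ?thesis
    unfolding eq using le_E by (intro LIMSEQ_le_const) auto
qed

end

section \<open>Convergence from almost every starting point\<close>

context stationary_chain
begin

definition shift_schedule :: "nat \<Rightarrow> nat \<times> nat list \<Rightarrow> nat \<times> nat list" where
  "shift_schedule n p = (fst p, map (\<lambda>i. i - n) (filter (\<lambda>i. n \<le> i) (snd p)))"

lemma averaging_sequence_shift:
  assumes "averaging_sequence p"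
  shows "averaging_sequence (\<lambda>j. shift_schedule n (p j))"
proof -
  have "length (filter (\<lambda>i. n \<le> i) (snd (p j))) \<le> fst (p j)" for j
    using assms length_filter_le[of "\<lambda>i. n \<le> i" "snd (p j)"]
    unfolding averaging_sequence_def by (meson order_trans)
  moreover have "distinct (map (\<lambda>i. i - n) (filter (\<lambda>i. n \<le> i) (snd (p j))))" for j
    using assms by (auto simp: averaging_sequence_def distinct_map inj_on_def)
  ultimately show ?thesis
    using assms by (simp add: averaging_sequence_def shift_schedule_def)
qed

lemma average_shift_diff:
  assumes f: "\<And>x. \<bar>f x\<bar> \<le> 1" and "distinct (snd p)"
  shows "\<bar>average f p \<omega> - average f (shift_schedule n p) (\<lambda>i. \<omega> (n + i))\<bar> \<le> real n / real (fst p)"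
proof -
  let ?T = "set (snd p)"
  have "(\<Sum>i\<leftarrow>snd (shift_schedule n p). f (\<omega> (n + i))) = (\<Sum>i\<leftarrow>filter (\<lambda>i. n \<le> i) (snd p). f (\<omega> i))"
    unfolding shift_schedule_def by (auto simp: comp_def intro!: arg_cong[where f=sum_list])
  also have "\<dots> = (\<Sum>i\<in>{i\<in>?T. n \<le> i}. f (\<omega> i))"
    using assms(2) by (simp add: sum_list_distinct_conv_sum_set)
  finally have eq: "average f (shift_schedule n p) (\<lambda>i. \<omega> (n + i)) = (\<Sum>i\<in>{i\<in>?T. n \<le> i}. f (\<omega> i)) / real (fst p)"
    by (simp add: average_def shift_schedule_def)
  have "average f p \<omega> = (\<Sum>i\<in>?T. f (\<omega> i)) / real (fst p)"
    using assms(2) by (simp add: average_def sum_list_distinct_conv_sum_set)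
  also have "(\<Sum>i\<in>?T. f (\<omega> i)) = (\<Sum>i\<in>{i\<in>?T. n \<le> i}. f (\<omega> i)) + (\<Sum>i\<in>{i\<in>?T. i < n}. f (\<omega> i))"
    by (subst sum.union_disjoint[symmetric]) (auto intro!: sum.cong)
  finally have "average f p \<omega> - average f (shift_schedule n p) (\<lambda>i. \<omega> (n + i)) = (\<Sum>i\<in>{i\<in>?T. i < n}. f (\<omega> i)) / real (fst p)"
    unfolding eq by (simp add: add_divide_distrib)
  moreover have "\<bar>\<Sum>i\<in>{i\<in>?T. i < n}. f (\<omega> i)\<bar> \<le> real n"
  proof -
    have "\<bar>\<Sum>i\<in>{i\<in>?T. i < n}. f (\<omega> i)\<bar> \<le> (\<Sum>i\<in>{i\<in>?T. i < n}. 1)"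
      by (rule order_trans[OF sum_abs]) (intro sum_mono f)
    also have "\<dots> = real (card {i\<in>?T. i < n})"
      by simp
    also have "\<dots> \<le> real (card {..<n})"
      by (intro of_nat_mono card_mono) auto
    finally show ?thesis by simp
  qed
  ultimately show ?thesis
    by (simp add: abs_divide divide_right_mono)
qed

lemma average_tendsto_shift_iff:
  assumes f: "\<And>x. \<bar>f x\<bar> \<le> 1" and p: "averaging_sequence p"
  shows "(\<lambda>j. average f (p j) \<omega>) \<longlonglongrightarrow> 0 \<longleftrightarrow>
    (\<lambda>j. average f (shift_schedule n (p j)) (\<lambda>i. \<omega> (n + i))) \<longlonglongrightarrow> 0"
proof (rule Lim_transform_eq)
  have "filterlim (\<lambda>j. real (fst (p j))) at_top sequentially"
    using p by (auto simp: averaging_sequence_def intro: filterlim_compose[OF filterlim_real_sequentially])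
  then have "(\<lambda>j. real n / real (fst (p j))) \<longlonglongrightarrow> 0"
    by (rule tendsto_divide_0[OF tendsto_const filterlim_at_top_imp_at_infinity])
  then show "(\<lambda>j. average f (p j) \<omega> - average f (shift_schedule n (p j)) (\<lambda>i. \<omega> (n + i))) \<longlonglongrightarrow> 0"
    by (rule Lim_null_comparison[rotated]) (use p average_shift_diff[of f, OF f] in \<open>simp add: averaging_sequence_def\<close>)
qed

lemma AE_Plam_shift:
  assumes Q: "Measurable.pred path_space Q" and "AE \<omega> in Plam. Q (\<lambda>i. \<omega> (n + i))"
  shows "AE \<omega> in Plam. Q \<omega>"
proof -
  have shift: "(\<lambda>\<omega> i. \<omega> (n + i)) \<in> Plam \<rightarrow>\<^sub>M path_space"
    by (simp add: measurable_cong_sets[OF sets_Plam refl] measurable_shift)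
  have "AE \<omega> in distr Plam path_space (\<lambda>\<omega> i. \<omega> (n + i)). Q \<omega>"
    by (subst AE_distr_iff[OF shift]) (use assms in \<open>simp_all add: pred_def\<close>)
  then show ?thesis
    unfolding distr_shift_Plam .
qed

text \<open>
  The zero-one law in integrated form. Let \<open>B\<close> be the event of divergence, and let \<open>\<rho>\<close> be the lower bound
  for the probability of convergence given the present state. If \<open>A\<close> is determined by time \<open>n\<close>, the
  Markov property gives \<open>E (1\<^sub>A \<rho>(X\<^sub>n)) \<le> P (A - B)\<close>. Choosing \<open>A\<close> close to \<open>B\<close> yields \<open>E (1\<^sub>B \<rho>(X\<^sub>n)) \<rightarrow> 0\<close>,
  which contradicts recurrence unless \<open>B\<close> is null.
\<close>

theorem averages_tendsto_0_AE:
  assumes L: "L-lipschitz_on UNIV f" and f1: "\<And>x. \<bar>f x\<bar> \<le> 1" and p: "averaging_sequence p"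
    and lim: "AE \<omega> in Plam. (\<lambda>j. average f (p j) \<omega>) \<longlonglongrightarrow> 0"
    and r: "strict_mono r" and c: "c > 0"
    and recurrent: "AE \<omega> in PL x. (\<lambda>j. time_average (calm_prob f k) id (r j) \<omega>) \<longlonglongrightarrow> c"
  shows "AE \<omega> in PL x. (\<lambda>j. average f (p j) \<omega>) \<longlonglongrightarrow> 0"
proof -
  have f [measurable]: "f \<in> borel_measurable borel"
    by (rule lipschitz_borel_measurable[OF L])
  define \<rho> where "\<rho> = calm_prob f k"
  have \<rho> [measurable]: "\<rho> \<in> borel_measurable borel"
    unfolding \<rho>_def by measurable
  have \<rho>_bounds: "0 \<le> \<rho> y" "\<rho> y \<le> 1" for y
    using calm_prob_bounds by (simp_all add: \<rho>_def)
  (* the complement of B, expressed through the path after time n *)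
  define N where "N n = {\<omega>. (\<lambda>j. average f (shift_schedule n (p j)) \<omega>) \<longlonglongrightarrow> 0}" for n
  have N_sets [measurable]: "N n \<in> sets path_space" for n
    unfolding N_def by (rule path_Collect) measurable
  define B where "B = {\<omega>. \<not> (\<lambda>j. average f (p j) \<omega>) \<longlonglongrightarrow> 0}"
  have B_sets [measurable]: "B \<in> sets path_space"
    unfolding B_def by (rule path_Collect) measurable
  have B_shift: "\<omega> \<notin> B \<longleftrightarrow> (\<lambda>i. \<omega> (n + i)) \<in> N n" for \<omega> n
    using average_tendsto_shift_iff[where f=f and p=p and n=n, OF f1 p] by (simp add: B_def N_def)
  have \<rho>_le: "\<rho> y \<le> measure (PL y) (N n)" for y n
    unfolding \<rho>_def N_def
  proof (rule calm_prob_le[OF L averaging_sequence_shift[OF p]])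
    show "AE \<omega> in Plam. (\<lambda>j. average f (shift_schedule n (p j)) \<omega>) \<longlonglongrightarrow> 0"
    proof (rule AE_Plam_shift[where n=n])
      show "AE \<omega> in Plam. (\<lambda>j. average f (shift_schedule n (p j)) (\<lambda>i. \<omega> (n + i))) \<longlonglongrightarrow> 0"
        using lim by (simp add: average_tendsto_shift_iff[where f=f and p=p and n=n, OF f1 p])
    qed measurable
  qed
  define \<beta> where "\<beta> n = (\<integral>\<omega>. indicator B \<omega> * \<rho> (\<omega> n) \<partial>PL x)" for n
  have \<beta>0: "0 \<le> \<beta> n" for n
    unfolding \<beta>_def using \<rho>_bounds by (intro Bochner_Integration.integral_nonneg) auto
  have \<beta>_lim: "\<beta> \<longlonglongrightarrow> 0"
  proof (rule LIMSEQ_I)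
    fix e :: real assume "e > 0"
    obtain n0 A where A [measurable]: "A \<in> sets path_space" and hor: "finite_horizon n0 (\<lambda>\<omega>. \<omega> \<in> A)"
      and close: "measure (PL x) (B - A) + measure (PL x) (A - B) < e"
      by (rule cylinder_set_approximation[OF prob_space_PL sets_PL B_sets \<open>e > 0\<close>])
    have "norm (\<beta> n - 0) < e" if n: "n \<ge> n0" for n
    proof -
      have G: "\<And>\<omega> \<omega>'. (\<forall>i\<le>n. \<omega> i = \<omega>' i) \<Longrightarrow> indicator A \<omega> = (indicator A \<omega>' :: ennreal)"
      proof -
        fix \<omega> \<omega>' :: "nat \<Rightarrow> 'a" assume "\<forall>i\<le>n. \<omega> i = \<omega>' i"
        then have "\<omega> \<in> A \<longleftrightarrow> \<omega>' \<in> A"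
          using finite_horizon_mono[OF hor n] unfolding finite_horizon_def by blast
        then show "indicator A \<omega> = (indicator A \<omega>' :: ennreal)"
          by (simp add: indicator_def)
      qed
      have i1: "integrable (PL x) (\<lambda>\<omega>. indicator S \<omega> * \<rho> (\<omega> n))" if [measurable]: "S \<in> sets path_space" for S
        using \<rho>_bounds by (intro integrable_bounded[where b=1] PL.finite_measure_axioms) (auto split: split_indicator)
      have i2: "integrable (PL x) (indicator S :: _ \<Rightarrow> real)" if [measurable]: "S \<in> sets path_space" for S
        by (intro integrable_bounded[where b=1] PL.finite_measure_axioms) (auto split: split_indicator)
      have "\<beta> n \<le> (\<integral>\<omega>. indicator (B - A) \<omega> + indicator A \<omega> * \<rho> (\<omega> n) \<partial>PL x)"
        unfolding \<beta>_def using \<rho>_bounds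
        by (intro integral_mono Bochner_Integration.integrable_add i1 i2) (auto split: split_indicator)
      also have "\<dots> = measure (PL x) (B - A) + (\<integral>\<omega>. indicator A \<omega> * \<rho> (\<omega> n) \<partial>PL x)"
        by (subst Bochner_Integration.integral_add) (auto intro!: i1 i2)
      also have "(\<integral>\<omega>. indicator A \<omega> * \<rho> (\<omega> n) \<partial>PL x) \<le> measure (PL x) (A - B)"
      proof -
        have "ennreal (\<integral>\<omega>. indicator A \<omega> * \<rho> (\<omega> n) \<partial>PL x) = (\<integral>\<^sup>+\<omega>. ennreal (indicator A \<omega> * \<rho> (\<omega> n)) \<partial>PL x)"
          using \<rho>_bounds i1[OF A] by (intro nn_integral_eq_integral[symmetric]) auto
        also have "\<dots> \<le> (\<integral>\<^sup>+\<omega>. indicator A \<omega> * (\<integral>\<^sup>+\<omega>'. indicator (N n) \<omega>' \<partial>PL (\<omega> n)) \<partial>PL x)"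
        proof (rule nn_integral_mono)
          fix \<omega> :: "nat \<Rightarrow> 'a"
          have "ennreal (\<rho> (\<omega> n)) \<le> emeasure (PL (\<omega> n)) (N n)"
            using \<rho>_le by (simp add: PL.emeasure_eq_measure)
          also have "\<dots> = (\<integral>\<^sup>+\<omega>'. indicator (N n) \<omega>' \<partial>PL (\<omega> n))"
            by (intro nn_integral_indicator[symmetric]) simp
          finally show "ennreal (indicator A \<omega> * \<rho> (\<omega> n)) \<le> indicator A \<omega> * (\<integral>\<^sup>+\<omega>'. indicator (N n) \<omega>' \<partial>PL (\<omega> n))"
            by (simp split: split_indicator)
        qed
        also have "\<dots> = (\<integral>\<^sup>+\<omega>. indicator A \<omega> * indicator (N n) (\<lambda>i. \<omega> (n + i)) \<partial>PL x)"
          by (rule markov_property[symmetric, OF _ _ G]) measurable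
        also have "\<dots> = (\<integral>\<^sup>+\<omega>. indicator (A - B) \<omega> \<partial>PL x)"
          using B_shift[of _ n] by (intro nn_integral_cong) (auto split: split_indicator)
        also have "\<dots> = emeasure (PL x) (A - B)"
          by (intro nn_integral_indicator) measurable
        finally show ?thesis
          by (simp add: PL.emeasure_eq_measure)
      qed
      finally show ?thesis
        using close \<beta>0[of n] by simp
    qed
    then show "\<exists>no. \<forall>n\<ge>no. norm (\<beta> n - 0) < e"
      by blast
  qed
  have "(\<lambda>j. (\<Sum>n<r j. \<beta> n) / real (r j)) \<longlonglongrightarrow> 0"
    using LIMSEQ_subseq_LIMSEQ[OF cesaro_tendsto_0[OF \<beta>_lim] r] by (simp add: comp_def)
  moreover have "(\<Sum>n<m. \<beta> n) / real m = (\<integral>\<omega>. indicator B \<omega> * time_average \<rho> id m \<omega> \<partial>PL x)" for m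
  proof -
    have int: "integrable (PL x) (\<lambda>\<omega>. indicator B \<omega> * \<rho> (\<omega> n))" for n
      using \<rho>_bounds by (intro integrable_bounded[where b=1] PL.finite_measure_axioms) (auto split: split_indicator)
    have "indicator B \<omega> * time_average \<rho> id m \<omega> = (\<Sum>n<m. indicator B \<omega> * \<rho> (\<omega> n)) / real m" for \<omega>
      unfolding time_average_def id_apply by (simp only: sum_distrib_left times_divide_eq_right)
    then show ?thesis
      unfolding \<beta>_def by (simp only: Bochner_Integration.integral_sum[OF int] integral_divide_zero)
  qed
  moreover have "(\<lambda>j. \<integral>\<omega>. indicator B \<omega> * time_average \<rho> id (r j) \<omega> \<partial>PL x) \<longlonglongrightarrow> (\<integral>\<omega>. indicator B \<omega> * c \<partial>PL x)"
  proof (rule integral_dominated_convergence[where w="\<lambda>_. 1"])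
    show "AE \<omega> in PL x. (\<lambda>j. indicator B \<omega> * time_average \<rho> id (r j) \<omega>) \<longlonglongrightarrow> indicator B \<omega> * c"
      using recurrent unfolding \<rho>_def by eventually_elim (intro tendsto_intros)
    show "AE \<omega> in PL x. norm (indicator B \<omega> * time_average \<rho> id (r j) \<omega>) \<le> 1" for j
      using abs_time_average_le[of \<rho> id "r j"] \<rho>_bounds by (auto split: split_indicator)
  qed auto
  ultimately have "(\<integral>\<omega>. indicator B \<omega> * c \<partial>PL x) = 0"
    using LIMSEQ_unique by force
  then have "measure (PL x) B = 0"
    using c by simp
  then have "AE \<omega> in PL x. \<omega> \<notin> B"
    using PL.prob_eq_0[of B x] by simp
  then show ?thesis
    by (simp add: B_def)
qed

text \<open>
  The law of large numbers for \<open>u - \<integral> u d\<lambda>\<close>. It serves for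
  \<open>u = calm_prob f k\<close>, the recurrence assumption of \<open>averages_tendsto_0_AE\<close>.
\<close>

lemma AE_PL_time_averages:
  assumes u [measurable]: "u \<in> borel_measurable borel" and u1: "\<And>x. 0 \<le> u x" "\<And>x. u x \<le> 1"
    and overlap: "AE z in lam \<Otimes>\<^sub>M lam. \<exists>M \<delta>. \<delta> > 0 \<and> overlap M \<delta> (PL (fst z)) (PL (snd z))"
  shows "\<exists>r. strict_mono r \<and> (AE x in lam. AE \<omega> in PL x.
    (\<lambda>j. time_average u id (r j) \<omega>) \<longlonglongrightarrow> (\<integral>y. u y \<partial>lam))"
proof -
  define c where "c = (\<integral>y. u y \<partial>lam)"
  have iu: "integrable lam u"
    using u1 by (intro integrable_bounded[where b=1] lam.finite_measure_axioms) auto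
  have c: "0 \<le> c" "c \<le> 1"
    unfolding c_def using u1 iu integral_mono[OF iu, of "\<lambda>_. 1"]
    by (auto intro: Bochner_Integration.integral_nonneg)
  define v where "v y = u y - c" for y
  have [measurable]: "v \<in> borel_measurable borel"
    unfolding v_def by measurable
  have v1: "\<bar>v y\<bar> \<le> 1" for y
    using u1[of y] c by (simp add: v_def)
  have "(\<integral>y. v y \<partial>lam) = 0"
    using iu by (simp add: v_def c_def)
  then have "energy v \<longlonglongrightarrow> 0"
    by (intro energy_tendsto_0 v1 overlap) auto
  then obtain r where r: "strict_mono r" "AE \<omega> in Plam. (\<lambda>j. time_average v id (r j) \<omega>) \<longlonglongrightarrow> 0"
    using time_average_AE_subsequence[of v id] v1 by (auto simp: strict_mono_def)
  have eq: "time_average u id (r j) \<omega> = time_average v id (r j) \<omega> + c" if "j \<ge> 1" for j \<omega>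
  proof -
    have "r j > 0"
      using seq_suble[OF r(1), of j] that by linarith
    then show ?thesis
      by (simp add: time_average_def v_def sum_subtractf diff_divide_distrib)
  qed
  have "AE \<omega> in Plam. (\<lambda>j. time_average u id (r j) \<omega>) \<longlonglongrightarrow> c"
    using r(2)
  proof eventually_elim
    case (elim \<omega>)
    have "(\<lambda>j. time_average v id (r j) \<omega> + c) \<longlonglongrightarrow> 0 + c"
      by (intro tendsto_add elim tendsto_const)
    then have "(\<lambda>j. time_average v id (r j) \<omega> + c) \<longlonglongrightarrow> c"
      by simp
    then show ?case
      by (rule Lim_transform_eventually) (auto simp: eventually_sequentially eq intro!: exI[of _ 1])
  qed
  then have "AE x in lam. AE \<omega> in PL x. (\<lambda>j. time_average u id (r j) \<omega>) \<longlonglongrightarrow> c"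
    by (subst (asm) AE_Plam) measurable
  with r(1) show ?thesis
    unfolding c_def by blast
qed

text \<open>
  The exceptional set is fixed before the times \<open>t\<close> are chosen: it is the set where the averages of
  \<open>calm_prob f k\<close> fail to converge. Both signs of the excess are covered by the factor \<open>s\<close>.
\<close>

theorem mean_tendsto_0_AE:
  assumes L: "L-lipschitz_on UNIV f" and f1: "\<And>x. \<bar>f x\<bar> \<le> 1" and centered: "(\<integral>x. f x \<partial>lam) = 0"
    and overlap: "AE z in lam \<Otimes>\<^sub>M lam. \<exists>M \<delta>. \<delta> > 0 \<and> overlap M \<delta> (PL (fst z)) (PL (snd z))"
  shows "AE x in lam. (\<lambda>n. mean f n x) \<longlonglongrightarrow> 0"
proof -
  interpret pair: pair_prob_space lam lam ..
  have f [measurable]: "f \<in> borel_measurable borel"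
    by (rule lipschitz_borel_measurable[OF L])
  have "AE x in lam. AE x' in lam. \<exists>M \<delta>. \<delta> > 0 \<and> overlap M \<delta> (PL x) (PL x')"
    using pair.AE_pair[OF overlap] by simp
  then obtain k where k: "(\<integral>y. calm_prob f k y \<partial>lam) > 0"
    using integral_calm_prob_pos[OF f] by blast
  obtain r where r: "strict_mono r" and good: "AE x in lam. AE \<omega> in PL x.
      (\<lambda>j. time_average (calm_prob f k) id (r j) \<omega>) \<longlonglongrightarrow> (\<integral>y. calm_prob f k y \<partial>lam)"
    using AE_PL_time_averages[of "calm_prob f k"] calm_prob_bounds overlap by auto
  have energy: "energy f \<longlonglongrightarrow> 0"
    by (rule energy_tendsto_0[OF f f1 centered overlap])
  have no_excess: "finite {n. s * mean f n x > e}"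
    if x: "AE \<omega> in PL x. (\<lambda>j. time_average (calm_prob f k) id (r j) \<omega>) \<longlonglongrightarrow> (\<integral>y. calm_prob f k y \<partial>lam)"
      and e: "e > 0" for e s :: real and x :: 'a
  proof (rule ccontr)
    assume inf: "infinite {n. s * mean f n x > e}"
    define t where "t = enumerate {n. s * mean f n x > e}"
    have t: "strict_mono t" and excess: "s * mean f (t n) x > e" for n
      using strict_mono_enumerate[OF inf] enumerate_in_set[OF inf, of n] by (auto simp: t_def)
    obtain q where q: "strict_mono q" "AE \<omega> in Plam. (\<lambda>j. time_average f t (q j) \<omega>) \<longlonglongrightarrow> 0"
      using time_average_AE_subsequence[OF f f1 energy t] by blast
    define p where "p j = (q j, map t [0..<q j])" for j
    have average_p: "average f (p j) \<omega> = time_average f t (q j) \<omega>" for j \<omega>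
      by (simp add: average_def p_def time_average_def comp_def interv_sum_list_conv_sum_set_nat atLeast0LessThan)
    have p: "averaging_sequence p"
      using filterlim_subseq[OF q(1)] strict_mono_imp_inj_on[OF t]
      by (auto simp: averaging_sequence_def p_def distinct_map intro: inj_on_subset)
    have "AE \<omega> in PL x. (\<lambda>j. average f (p j) \<omega>) \<longlonglongrightarrow> 0"
      using q(2) by (intro averages_tendsto_0_AE[OF L f1 p _ r k x]) (simp add: average_p)
    then have "(\<lambda>j. \<integral>\<omega>. time_average f t (q j) \<omega> \<partial>PL x) \<longlonglongrightarrow> (\<integral>\<omega>. 0 \<partial>PL x)"
      using abs_time_average_le[of f, OF f1]
      by (intro integral_dominated_convergence[where w="\<lambda>_. 1"]) (auto simp: average_p)
    then have "(\<lambda>j. s * (\<integral>\<omega>. time_average f t (q j) \<omega> \<partial>PL x)) \<longlonglongrightarrow> s * 0"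
      by (intro tendsto_mult tendsto_const) simp
    moreover have "e \<le> s * (\<integral>\<omega>. time_average f t (q j) \<omega> \<partial>PL x)" if "j \<ge> 1" for j
    proof -
      have qj: "q j > 0"
        using seq_suble[OF q(1), of j] that by linarith
      have "integrable (PL x) (\<lambda>\<omega>. f (\<omega> n))" for n
        using f1 by (intro integrable_bounded[where b=1] PL.finite_measure_axioms) auto
      then have "(\<integral>\<omega>. time_average f t (q j) \<omega> \<partial>PL x) = (\<Sum>n<q j. mean f (t n) x) / q j"
        by (simp add: time_average_def mean_def Bochner_Integration.integral_sum)
      then have "s * (\<integral>\<omega>. time_average f t (q j) \<omega> \<partial>PL x) = (\<Sum>n<q j. s * mean f (t n) x) / q j"
        by (simp add: sum_distrib_left)
      also have "\<dots> \<ge> (\<Sum>n<q j. e) / q j"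
        by (intro divide_right_mono sum_mono) (auto intro: less_imp_le excess)
      finally show ?thesis
        using qj by simp
    qed
    ultimately have "e \<le> s * 0"
      by (intro LIMSEQ_le_const) auto
    with e show False by simp
  qed
  show ?thesis
    using good
  proof eventually_elim
    case (elim x)
    show ?case
    proof (rule LIMSEQ_I)
      fix e :: real assume "e > 0"
      define S where "S = {n. 1 * mean f n x > e / 2} \<union> {n. - 1 * mean f n x > e / 2}"
      have "finite S"
        unfolding S_def using \<open>e > 0\<close> by (intro finite_UnI no_excess[OF elim]) simp_all
      then obtain m where m: "\<And>n. n \<in> S \<Longrightarrow> n < m"
        unfolding finite_nat_set_iff_bounded by blast
      have "norm (mean f n x - 0) < e" if "n \<ge> m" for n
      proof -
        have "n \<notin> S"
          using m[of n] that by auto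
        then show ?thesis
          using \<open>e > 0\<close> unfolding S_def by simp arith
      qed
      then show "\<exists>no. \<forall>n\<ge>no. norm (mean f n x - 0) < e"
        by blast
    qed
  qed
qed

end

section \<open>The bounded Lipschitz norm\<close>

lemma bounded_lipschitz_mult:
  fixes g h :: "'a :: metric_space \<Rightarrow> real"
  assumes "bounded_lipschitz g" "bounded_lipschitz h"
  shows "bounded_lipschitz (\<lambda>x. g x * h x)"
proof -
  obtain L b L' b' where *: "L-lipschitz_on UNIV g" "\<And>x. \<bar>g x\<bar> \<le> b" "L'-lipschitz_on UNIV h" "\<And>x. \<bar>h x\<bar> \<le> b'"
    using assms unfolding bounded_lipschitz_def by blast
  have b: "0 \<le> b" "0 \<le> b'"
    using order_trans[OF abs_ge_zero *(2)] order_trans[OF abs_ge_zero *(4)] by auto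
  show ?thesis
  proof (rule bounded_lipschitzI[where L="b * L' + L * b'"])
    show "\<bar>g x * h x\<bar> \<le> b * b'" for x
      unfolding abs_mult by (intro mult_mono * b) auto
    show "(b * L' + L * b')-lipschitz_on UNIV (\<lambda>x. g x * h x)"
    proof (rule lipschitz_onI)
      fix x y
      have "\<bar>g x * h x - g y * h y\<bar> = \<bar>g x * (h x - h y) + (g x - g y) * h y\<bar>"
        by (simp add: algebra_simps)
      also have "\<dots> \<le> \<bar>g x\<bar> * \<bar>h x - h y\<bar> + \<bar>g x - g y\<bar> * \<bar>h y\<bar>"
        by (metis abs_mult abs_triangle_ineq)
      also have "\<dots> \<le> b * (L' * dist x y) + (L * dist x y) * b'"
        using lipschitz_onD[OF *(1), of x y] lipschitz_onD[OF *(3), of x y] lipschitz_on_nonneg[OF *(1)]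
        by (intro add_mono mult_mono * b) (auto simp: dist_real_def)
      finally show "dist (g x * h x) (g y * h y) \<le> (b * L' + L * b') * dist x y"
        by (simp add: dist_real_def algebra_simps)
    qed (use b lipschitz_on_nonneg[OF *(1)] lipschitz_on_nonneg[OF *(3)] in simp)
  qed
qed

definition bump :: "real \<Rightarrow> 'a :: metric_space \<Rightarrow> 'a \<Rightarrow> real" where
  "bump \<eta> c x = max 0 (min 1 (2 - dist x c / \<eta>))"

text \<open>
  The successive remainders: \<open>piece \<eta> c i\<close> is what ball \<open>i\<close> adds to the cover by the earlier balls.
\<close>

definition piece :: "real \<Rightarrow> (nat \<Rightarrow> 'a :: metric_space) \<Rightarrow> nat \<Rightarrow> 'a \<Rightarrow> real" where
  "piece \<eta> c i x = bump \<eta> (c i) x * (\<Prod>j<i. 1 - bump \<eta> (c j) x)"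

lemma bump_bounds: "0 \<le> bump \<eta> c x" "bump \<eta> c x \<le> 1"
  by (simp_all add: bump_def)

lemma bounded_lipschitz_bump:
  assumes "\<eta> > 0"
  shows "bounded_lipschitz (bump \<eta> c)"
proof (rule bounded_lipschitzI[where b=1])
  show "\<bar>bump \<eta> c x\<bar> \<le> 1" for x
    using bump_bounds[of \<eta> c x] by simp
  show "(1 / \<eta>)-lipschitz_on UNIV (bump \<eta> c)"
  proof (rule lipschitz_onI)
    fix x y
    have "\<bar>bump \<eta> c x - bump \<eta> c y\<bar> \<le> \<bar>dist x c / \<eta> - dist y c / \<eta>\<bar>"
      unfolding bump_def by linarith
    also have "\<dots> = \<bar>dist x c - dist y c\<bar> / \<eta>"
      using assms by (simp flip: diff_divide_distrib)
    also have "\<dots> \<le> dist x y / \<eta>"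
      using assms abs_dist_diff_le[of x c y] by (intro divide_right_mono) (auto simp: dist_commute)
    finally show "dist (bump \<eta> c x) (bump \<eta> c y) \<le> 1 / \<eta> * dist x y"
      by (simp add: dist_real_def)
  qed (use assms in simp)
qed

lemma bounded_lipschitz_piece:
  assumes "\<eta> > 0"
  shows "bounded_lipschitz (piece \<eta> c i)"
proof -
  have "bounded_lipschitz (\<lambda>x. \<Prod>j<i. 1 - bump \<eta> (c j) x)"
  proof (induction i)
    case 0
    show ?case using bounded_lipschitz_const[of 1] by simp
  next
    case (Suc i)
    have "bounded_lipschitz (\<lambda>x. 1 + (-1) * bump \<eta> (c i) x)"
      by (intro bounded_lipschitz_add bounded_lipschitz_const bounded_lipschitz_cmult bounded_lipschitz_bump assms)
    then show ?case
      using bounded_lipschitz_mult[OF Suc] by simp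
  qed
  then show ?thesis
    unfolding piece_def[abs_def] by (intro bounded_lipschitz_mult bounded_lipschitz_bump assms)
qed

lemma piece_bounds: "0 \<le> piece \<eta> c i x" "piece \<eta> c i x \<le> 1"
proof -
  have "0 \<le> (\<Prod>j<i. 1 - bump \<eta> (c j) x)" "(\<Prod>j<i. 1 - bump \<eta> (c j) x) \<le> 1"
    using bump_bounds[of \<eta> _ x] by (auto intro!: prod_nonneg prod_le_1)
  then show "0 \<le> piece \<eta> c i x" "piece \<eta> c i x \<le> 1"
    unfolding piece_def using bump_bounds[of \<eta> "c i" x] by (auto intro: mult_le_one)
qed

lemma abs_piece_le: "\<bar>piece \<eta> c i x\<bar> \<le> 1"
  using piece_bounds[of \<eta> c i x] by simp

lemma sum_piece: "(\<Sum>i<m. piece \<eta> c i x) = 1 - (\<Prod>i<m. 1 - bump \<eta> (c i) x)"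
  by (induction m) (simp_all add: piece_def algebra_simps)

lemma sum_piece_bounds: "0 \<le> (\<Sum>i<m. piece \<eta> c i x)" "(\<Sum>i<m. piece \<eta> c i x) \<le> 1"
proof -
  show "0 \<le> (\<Sum>i<m. piece \<eta> c i x)"
    by (intro sum_nonneg piece_bounds)
  have "0 \<le> (\<Prod>i<m. 1 - bump \<eta> (c i) x)"
    using bump_bounds by (intro prod_nonneg) auto
  then show "(\<Sum>i<m. piece \<eta> c i x) \<le> 1"
    unfolding sum_piece by simp
qed

lemma piece_support:
  assumes "\<eta> > 0" "piece \<eta> c i x \<noteq> 0"
  shows "dist x (c i) \<le> 2 * \<eta>"
proof (rule ccontr)
  assume "\<not> ?thesis"
  then have "2 - dist x (c i) / \<eta> \<le> 0"
    using assms(1) by (simp add: field_simps)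
  then have "bump \<eta> (c i) x = 0"
    by (simp add: bump_def)
  with assms(2) show False
    by (simp add: piece_def)
qed

lemma Lip_measurable: "f \<in> Lip \<Longrightarrow> f \<in> borel_measurable borel"
  by (rule lipschitz_borel_measurable[of 1]) (auto simp: Lip_def lipschitz_on_def dist_real_def)

lemma Lip_minus_pieces:
  assumes f: "f \<in> Lip" and \<eta>: "\<eta> > 0"
  shows "\<bar>f x - (\<Sum>i<m. f (c i) * piece \<eta> c i x)\<bar> \<le> 2 * \<eta> + (1 - (\<Sum>i<m. piece \<eta> c i x))"
proof -
  let ?s = "\<Sum>i<m. piece \<eta> c i x"
  have f1: "\<bar>f x\<bar> \<le> 1" and fL: "\<bar>f x - f y\<bar> \<le> dist x y" for x y
    using f by (auto simp: Lip_def)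
  have "f x - (\<Sum>i<m. f (c i) * piece \<eta> c i x) = f x * (1 - ?s) + (\<Sum>i<m. (f x - f (c i)) * piece \<eta> c i x)"
    by (simp add: sum_subtractf sum_distrib_left algebra_simps)
  moreover have "\<bar>f x * (1 - ?s)\<bar> \<le> 1 - ?s"
    using mult_right_mono[OF f1, of "1 - ?s"] sum_piece_bounds(2)[where m=m and \<eta>=\<eta> and c=c and x=x]
    by (simp add: abs_mult)
  moreover have "\<bar>\<Sum>i<m. (f x - f (c i)) * piece \<eta> c i x\<bar> \<le> 2 * \<eta>"
  proof -
    have "\<bar>\<Sum>i<m. (f x - f (c i)) * piece \<eta> c i x\<bar> \<le> (\<Sum>i<m. \<bar>(f x - f (c i)) * piece \<eta> c i x\<bar>)"
      by (rule sum_abs)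
    also have "\<dots> \<le> (\<Sum>i<m. 2 * \<eta> * piece \<eta> c i x)"
    proof (rule sum_mono)
      fix i
      show "\<bar>(f x - f (c i)) * piece \<eta> c i x\<bar> \<le> 2 * \<eta> * piece \<eta> c i x"
      proof (cases "piece \<eta> c i x = 0")
        case False
        have "\<bar>f x - f (c i)\<bar> \<le> 2 * \<eta>"
          using fL[of x "c i"] piece_support[OF \<eta> False] by simp
        then show ?thesis
          using piece_bounds(1)[of \<eta> c i x] by (simp add: abs_mult mult_right_mono)
      qed simp
    qed
    also have "\<dots> = 2 * \<eta> * ?s"
      by (simp add: sum_distrib_left)
    also have "\<dots> \<le> 2 * \<eta>"
      using mult_left_mono[OF sum_piece_bounds(2)[where m=m and \<eta>=\<eta> and c=c and x=x], of "2 * \<eta>"] \<eta> by simp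
    finally show ?thesis .
  qed
  ultimately show ?thesis
    by linarith
qed

text \<open>
  A function \<open>f\<close> in \<open>Lip\<close> differs from \<open>\<Sum>\<^sub>i f(c\<^sub>i) p\<^sub>i\<close> by at most \<open>2 \<eta>\<close> plus the uncovered part, where the \<open>p\<^sub>i\<close>
  are the pieces; the coefficients are bounded by \<open>1\<close>. So the bound is uniform in \<open>f\<close>.
\<close>

lemma BL_norm_diff_le_pieces:
  fixes \<mu> \<nu> :: "'a :: metric_space measure"
  assumes "prob_space \<mu>" "prob_space \<nu>" and sets: "sets \<mu> = sets borel" "sets \<nu> = sets borel" and \<eta>: "\<eta> > 0"
  shows "BL_norm_diff \<mu> \<nu> \<le> (\<Sum>i<m. \<bar>(\<integral>x. piece \<eta> c i x \<partial>\<mu>) - (\<integral>x. piece \<eta> c i x \<partial>\<nu>)\<bar>) + 4 * \<eta>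
     + (1 - (\<Sum>i<m. \<integral>x. piece \<eta> c i x \<partial>\<mu>)) + (1 - (\<Sum>i<m. \<integral>x. piece \<eta> c i x \<partial>\<nu>))"
  unfolding BL_norm_diff_def
proof (rule cSUP_least)
  show "Lip \<noteq> ({} :: ('a \<Rightarrow> real) set)"
    by (auto simp: Lip_def intro!: exI[of _ "\<lambda>_. 0"])
  fix f :: "'a \<Rightarrow> real" assume f: "f \<in> Lip"
  then have f1: "\<bar>f x\<bar> \<le> 1" for x
    by (simp add: Lip_def)
  define g where "g x = (\<Sum>i<m. f (c i) * piece \<eta> c i x)" for x
  have one: "\<bar>(\<integral>x. f x \<partial>M) - (\<Sum>i<m. f (c i) * (\<integral>x. piece \<eta> c i x \<partial>M))\<bar> \<le> 2 * \<eta> + (1 - (\<Sum>i<m. \<integral>x. piece \<eta> c i x \<partial>M))"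
    if "prob_space M" and sM: "sets M = sets borel" for M
  proof -
    interpret prob_space M by fact
    have p: "integrable M (piece \<eta> c i)" for i
      using abs_piece_le bounded_lipschitz_measurable[OF bounded_lipschitz_piece[OF \<eta>]]
      by (intro integrable_bounded[where b=1] finite_measure_axioms) (auto simp: measurable_cong_sets[OF sM refl])
    have fi: "integrable M f"
      using f1 Lip_measurable[OF f]
      by (intro integrable_bounded[where b=1] finite_measure_axioms) (auto simp: measurable_cong_sets[OF sM refl])
    have gi: "integrable M g"
      unfolding g_def using p by auto
    have "(\<integral>x. f x \<partial>M) - (\<Sum>i<m. f (c i) * (\<integral>x. piece \<eta> c i x \<partial>M)) = (\<integral>x. f x - g x \<partial>M)"
      unfolding g_def using p fi by (simp add: Bochner_Integration.integral_sum)
    also have "\<bar>\<dots>\<bar> \<le> (\<integral>x. \<bar>f x - g x\<bar> \<partial>M)"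
      by (rule integral_abs_bound)
    also have "\<dots> \<le> (\<integral>x. 2 * \<eta> + (1 - (\<Sum>i<m. piece \<eta> c i x)) \<partial>M)"
      using Lip_minus_pieces[OF f \<eta>] fi gi p unfolding g_def by (intro integral_mono) auto
    also have "\<dots> = 2 * \<eta> + (1 - (\<Sum>i<m. \<integral>x. piece \<eta> c i x \<partial>M))"
      using p by (simp add: Bochner_Integration.integral_sum prob_space)
    finally show ?thesis .
  qed
  have "\<bar>(\<Sum>i<m. f (c i) * (\<integral>x. piece \<eta> c i x \<partial>\<mu>)) - (\<Sum>i<m. f (c i) * (\<integral>x. piece \<eta> c i x \<partial>\<nu>))\<bar>
      \<le> (\<Sum>i<m. \<bar>(\<integral>x. piece \<eta> c i x \<partial>\<mu>) - (\<integral>x. piece \<eta> c i x \<partial>\<nu>)\<bar>)"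
  proof -
    have "\<bar>(\<Sum>i<m. f (c i) * (\<integral>x. piece \<eta> c i x \<partial>\<mu>)) - (\<Sum>i<m. f (c i) * (\<integral>x. piece \<eta> c i x \<partial>\<nu>))\<bar> =
        \<bar>\<Sum>i<m. f (c i) * ((\<integral>x. piece \<eta> c i x \<partial>\<mu>) - (\<integral>x. piece \<eta> c i x \<partial>\<nu>))\<bar>"
      by (simp add: sum_subtractf right_diff_distrib)
    also have "\<dots> \<le> (\<Sum>i<m. \<bar>f (c i) * ((\<integral>x. piece \<eta> c i x \<partial>\<mu>) - (\<integral>x. piece \<eta> c i x \<partial>\<nu>))\<bar>)"
      by (rule sum_abs)
    also have "\<dots> \<le> (\<Sum>i<m. \<bar>(\<integral>x. piece \<eta> c i x \<partial>\<mu>) - (\<integral>x. piece \<eta> c i x \<partial>\<nu>)\<bar>)"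
    proof (rule sum_mono)
      fix i
      show "\<bar>f (c i) * ((\<integral>x. piece \<eta> c i x \<partial>\<mu>) - (\<integral>x. piece \<eta> c i x \<partial>\<nu>))\<bar>
          \<le> \<bar>(\<integral>x. piece \<eta> c i x \<partial>\<mu>) - (\<integral>x. piece \<eta> c i x \<partial>\<nu>)\<bar>"
        unfolding abs_mult using mult_right_mono[OF f1 abs_ge_zero] by simp
    qed
    finally show ?thesis .
  qed
  then show "\<bar>(\<integral>y. f y \<partial>\<mu>) - (\<integral>y. f y \<partial>\<nu>)\<bar> \<le> (\<Sum>i<m. \<bar>(\<integral>x. piece \<eta> c i x \<partial>\<mu>) - (\<integral>x. piece \<eta> c i x \<partial>\<nu>)\<bar>) + 4 * \<eta>
     + (1 - (\<Sum>i<m. \<integral>x. piece \<eta> c i x \<partial>\<mu>)) + (1 - (\<Sum>i<m. \<integral>x. piece \<eta> c i x \<partial>\<nu>))"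
    using one[OF assms(1) sets(1)] one[OF assms(2) sets(2)] by linarith
qed

lemma sum_piece_tendsto_1:
  fixes c :: "nat \<Rightarrow> 'a :: metric_space"
  assumes "prob_space \<nu>" and sets: "sets \<nu> = sets borel" and \<eta>: "\<eta> > 0"
    and dense: "\<And>x. \<exists>i. dist x (c i) < \<eta>"
  shows "(\<lambda>m. \<Sum>i<m. \<integral>x. piece \<eta> c i x \<partial>\<nu>) \<longlonglongrightarrow> 1"
proof -
  interpret prob_space \<nu> by fact
  have p: "integrable \<nu> (piece \<eta> c i)" for i
    using abs_piece_le bounded_lipschitz_measurable[OF bounded_lipschitz_piece[OF \<eta>]]
    by (intro integrable_bounded[where b=1] finite_measure_axioms) (auto simp: measurable_cong_sets[OF sets refl])
  note [measurable] = borel_measurable_integrable[OF p]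
  have "(\<lambda>m. \<integral>x. (\<Sum>i<m. piece \<eta> c i x) \<partial>\<nu>) \<longlonglongrightarrow> (\<integral>x. 1 \<partial>\<nu>)"
  proof (rule integral_dominated_convergence[where w="\<lambda>_. 1"])
    show "AE x in \<nu>. (\<lambda>m. \<Sum>i<m. piece \<eta> c i x) \<longlonglongrightarrow> 1"
    proof (rule AE_I2)
      fix x
      obtain k where k: "dist x (c k) < \<eta>"
        using dense by blast
      then have "1 \<le> 2 - dist x (c k) / \<eta>"
        using \<eta> by (simp add: field_simps)
      then have b: "bump \<eta> (c k) x = 1"
        by (simp add: bump_def)
      have "(\<Sum>i<m. piece \<eta> c i x) = 1" if "m \<ge> Suc k" for m
      proof -
        have "(\<Prod>i<m. 1 - bump \<eta> (c i) x) = 0"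
          using that b by (intro prod_zero) (auto intro!: bexI[of _ k])
        then show ?thesis
          by (simp add: sum_piece)
      qed
      then show "(\<lambda>m. \<Sum>i<m. piece \<eta> c i x) \<longlonglongrightarrow> 1"
        by (intro tendsto_eventually) (auto simp: eventually_sequentially)
    qed
    show "AE x in \<nu>. norm (\<Sum>i<m. piece \<eta> c i x) \<le> 1" for m
      using sum_piece_bounds[where m=m and \<eta>=\<eta> and c=c] by simp
  qed auto
  then show ?thesis
    using p by (simp add: Bochner_Integration.integral_sum prob_space)
qed

lemma BL_norm_diff_nonneg:
  assumes "finite_measure \<mu>" "finite_measure \<nu>"
  shows "0 \<le> BL_norm_diff \<mu> \<nu>"
proof -
  have "(\<lambda>_. 0) \<in> Lip"
    by (simp add: Lip_def)
  from cSUP_upper[OF this bdd_above_BL[OF assms]] show ?thesis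
    by (simp add: BL_norm_diff_def)
qed

text \<open>
  Given \<open>e\<close>, the radius \<open>\<eta>\<close> is chosen first, then the number \<open>m\<close> of balls, by the mass that \<open>\<nu>\<close> leaves
  uncovered. For large \<open>n\<close> the measure \<open>\<mu> n\<close> leaves nearly the same mass uncovered.
\<close>

lemma BL_norm_diff_tendsto_0:
  fixes c :: "nat \<Rightarrow> 'a :: metric_space"
  assumes \<mu>: "\<And>n. prob_space (\<mu> n)" "\<And>n. sets (\<mu> n) = sets borel"
    and \<nu>: "prob_space \<nu>" "sets \<nu> = sets borel"
    and dense: "\<And>x \<eta>. \<eta> > 0 \<Longrightarrow> \<exists>i. dist x (c i) < \<eta>"
    and conv: "\<And>q i. (\<lambda>n. \<integral>x. piece (1 / Suc q) c i x \<partial>\<mu> n) \<longlonglongrightarrow> (\<integral>x. piece (1 / Suc q) c i x \<partial>\<nu>)"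
  shows "(\<lambda>n. BL_norm_diff (\<mu> n) \<nu>) \<longlonglongrightarrow> 0"
proof (rule order_tendstoI)
  have nonneg: "0 \<le> BL_norm_diff (\<mu> n) \<nu>" for n
    using \<mu>(1)[of n] \<nu>(1) by (intro BL_norm_diff_nonneg) (auto simp: prob_space_def)
  show "\<forall>\<^sub>F n in sequentially. a < BL_norm_diff (\<mu> n) \<nu>" if "a < 0" for a
    by (intro always_eventually allI less_le_trans[OF that nonneg])
  fix e :: real assume e: "0 < e"
  then obtain q where q: "1 / Suc q < e / 8"
    using nat_approx_posE[of "e / 8"] by auto
  define \<eta> where "\<eta> = 1 / real (Suc q)"
  have \<eta>: "\<eta> > 0" "4 * \<eta> < e / 2"
    using q by (simp_all add: \<eta>_def)
  have "\<forall>\<^sub>F m in sequentially. (\<Sum>i<m. \<integral>x. piece \<eta> c i x \<partial>\<nu>) > 1 - e / 8"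
    using e by (intro order_tendstoD(1)[OF sum_piece_tendsto_1[OF \<nu> \<eta>(1) dense[OF \<eta>(1)]]]) auto
  then obtain m where m: "(\<Sum>i<m. \<integral>x. piece \<eta> c i x \<partial>\<nu>) > 1 - e / 8"
    by (auto simp: eventually_sequentially)
  let ?bound = "\<lambda>n. (\<Sum>i<m. \<bar>(\<integral>x. piece \<eta> c i x \<partial>\<mu> n) - (\<integral>x. piece \<eta> c i x \<partial>\<nu>)\<bar>) + 4 * \<eta>
     + (1 - (\<Sum>i<m. \<integral>x. piece \<eta> c i x \<partial>\<mu> n)) + (1 - (\<Sum>i<m. \<integral>x. piece \<eta> c i x \<partial>\<nu>))"
  have lim: "?bound \<longlonglongrightarrow> (\<Sum>i<m. \<bar>(\<integral>x. piece \<eta> c i x \<partial>\<nu>) - (\<integral>x. piece \<eta> c i x \<partial>\<nu>)\<bar>) + 4 * \<eta>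
     + (1 - (\<Sum>i<m. \<integral>x. piece \<eta> c i x \<partial>\<nu>)) + (1 - (\<Sum>i<m. \<integral>x. piece \<eta> c i x \<partial>\<nu>))"
    unfolding \<eta>_def by (intro tendsto_intros conv)
  have "\<forall>\<^sub>F n in sequentially. ?bound n < e"
    by (rule order_tendstoD(2)[OF lim]) (use m \<eta>(2) e in simp)
  then show "\<forall>\<^sub>F n in sequentially. BL_norm_diff (\<mu> n) \<nu> < e"
    by eventually_elim
       (rule le_less_trans[OF BL_norm_diff_le_pieces[OF \<mu>(1) \<nu>(1) \<mu>(2) \<nu>(2) \<eta>(1), where m=m and c=c]])
qed

context stationary_chain
begin

lemma mean_tendsto_AE:
  assumes L: "L-lipschitz_on UNIV f" and f: "\<And>x. 0 \<le> f x" "\<And>x. f x \<le> 1"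
    and overlap: "AE z in lam \<Otimes>\<^sub>M lam. \<exists>M \<delta>. \<delta> > 0 \<and> overlap M \<delta> (PL (fst z)) (PL (snd z))"
  shows "AE x in lam. (\<lambda>n. mean f n x) \<longlonglongrightarrow> (\<integral>y. f y \<partial>lam)"
proof -
  have fm [measurable]: "f \<in> borel_measurable borel"
    by (rule lipschitz_borel_measurable[OF L])
  define c where "c = (\<integral>y. f y \<partial>lam)"
  have fi: "integrable lam f"
    using f by (intro integrable_bounded[where b=1] lam.finite_measure_axioms) auto
  have c: "0 \<le> c" "c \<le> 1"
    unfolding c_def using f fi integral_mono[OF fi, of "\<lambda>_. 1"]
    by (auto intro: Bochner_Integration.integral_nonneg)
  define g where "g y = f y - c" for y
  have gL: "L-lipschitz_on UNIV g"
    using L by (simp add: g_def lipschitz_on_def dist_real_def)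
  have "\<bar>g y\<bar> \<le> 1" for y
    using f[of y] c by (simp add: g_def)
  moreover have "(\<integral>y. g y \<partial>lam) = 0"
    using fi by (simp add: g_def c_def)
  ultimately have "AE x in lam. (\<lambda>n. mean g n x) \<longlonglongrightarrow> 0"
    by (intro mean_tendsto_0_AE[OF gL] overlap)
  moreover have "mean g n x = mean f n x - c" for n x
  proof -
    have "integrable (PL x) (\<lambda>\<omega>. f (\<omega> n))"
      using f by (intro integrable_bounded[where b=1] PL.finite_measure_axioms) auto
    then show ?thesis
      by (simp add: mean_def g_def)
  qed
  ultimately have "AE x in lam. (\<lambda>n. mean f n x - c) \<longlonglongrightarrow> 0"
    by simp
  then show ?thesis
    unfolding c_def by eventually_elim (rule LIM_zero_cancel)
qed

theorem weak_ergodicity: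
  assumes overlap: "AE z in lam \<Otimes>\<^sub>M lam. \<exists>M \<delta>. \<delta> > 0 \<and> overlap M \<delta> (PL (fst z)) (PL (snd z))"
  shows "AE x in lam. (\<lambda>n. BL_norm_diff (kernel_power P n x) lam) \<longlonglongrightarrow> 0"
proof -
  obtain D :: "'a set" where D: "countable D" "\<And>X. open X \<Longrightarrow> X \<noteq> {} \<Longrightarrow> \<exists>d\<in>D. d \<in> X"
    using countable_dense_setE by blast
  have "D \<noteq> {}"
    using D(2)[of UNIV] by auto
  define c where "c = from_nat_into D"
  have dense: "\<exists>i. dist x (c i) < \<eta>" if "\<eta> > 0" for x \<eta>
  proof -
    obtain d where d: "d \<in> D" "d \<in> ball x \<eta>"
      using D(2)[of "ball x \<eta>"] \<open>\<eta> > 0\<close> centre_in_ball[of x \<eta>] by blast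
    obtain i where "c i = d"
      using from_nat_into_surj[OF D(1) d(1)] by (auto simp: c_def)
    with d(2) show ?thesis
      by auto
  qed
  have "AE x in lam. (\<lambda>n. mean (piece (1 / Suc q) c i) n x) \<longlonglongrightarrow> (\<integral>y. piece (1 / Suc q) c i y \<partial>lam)" for q i
  proof -
    obtain L where "L-lipschitz_on UNIV (piece (1 / real (Suc q)) c i)"
      using bounded_lipschitz_piece[of "1 / real (Suc q)" c i] by (auto simp: bounded_lipschitz_def)
    then show ?thesis
      by (rule mean_tendsto_AE[OF _ piece_bounds overlap])
  qed
  then have "AE x in lam. \<forall>q i. (\<lambda>n. mean (piece (1 / Suc q) c i) n x) \<longlonglongrightarrow> (\<integral>y. piece (1 / Suc q) c i y \<partial>lam)"
    by (simp add: AE_all_countable)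
  then show ?thesis
  proof eventually_elim
    case (elim x)
    show ?case
    proof (rule BL_norm_diff_tendsto_0[OF _ _ lam.prob_space_axioms sets_lam dense])
      show "prob_space (kernel_power P n x)" "sets (kernel_power P n x) = sets borel" for n
        unfolding distr_coordinate[symmetric] by (auto intro: PL.prob_space_distr measurable_coordinate)
      have "piece (1 / Suc q) c i \<in> borel_measurable borel" for q i
        by (intro bounded_lipschitz_measurable bounded_lipschitz_piece) simp
      then show "(\<lambda>n. \<integral>y. piece (1 / Suc q) c i y \<partial>kernel_power P n x) \<longlonglongrightarrow> (\<integral>y. piece (1 / Suc q) c i y \<partial>lam)" for q i
        using elim by (simp add: mean_eq_kernel_power)
    qed
  qed
qed

end

theorem theorem2p13:
  fixes P :: "'a :: polish_space \<Rightarrow> 'a measure" and lam :: "'a measure"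
  assumes "transition_kernel P"
    and "invariant_prob P lam"
    and "AE (x, x') in lam \<Otimes>\<^sub>M lam. \<exists>Q \<in> couplings (path_law P x) (path_law P x').
           measure Q {(\<omega>, \<omega>') \<in> space Q. summable (\<lambda>n. (dist (\<omega> n) (\<omega>' n))\<^sup>2)} > 0"
  shows "AE x in lam. (\<lambda>n. BL_norm_diff (kernel_power P n x) lam) \<longlonglongrightarrow> 0"
proof -
  interpret stationary_chain P lam
    by unfold_locales (fact assms)+
  have "AE z in lam \<Otimes>\<^sub>M lam. \<exists>M \<delta>. \<delta> > 0 \<and> overlap M \<delta> (path_law P (fst z)) (path_law P (snd z))"
    using assms(3)
  proof eventually_elim
    case (elim z)
    then show ?case
      using overlap_if_coupling[OF sets_PL sets_PL] by (auto simp: case_prod_beta)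
  qed
  then show ?thesis
    by (rule weak_ergodicity)
qed

end
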